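(* Let $\lambda$ be a JS-partition of type $\alpha$ with residue symbol $R_p(\lambda)=\left\{\begin{smallmatrix}x_1&\cdots&x_{k+1}\\ y_1&\cdots&y_{k+1}\end{smallmatrix}\right\}$ of length $k+1\ge1$. For $1\le j\le k+1$ let $\lambda[j]$ denote the partition whose residue symbol consists of the first $j$ columns of $R_p(\lambda)$ (so $\lambda[k+1]=\lambda$). Put $d_0=1$ if $(x_1,y_1)=(\alpha,\alpha+1)$ and $d_0=0$ otherwise. For $1\le i\le k$, with $(x',y')=(x_i,y_i)$ and $(x,y)=(x_{i+1},y_{i+1})$, define $t,t',s\in\{0,\dots,p-1\}$ by $t\equiv x-y+1$, $t'\equiv x'-y'+1$, $s\equiv y'-y\pmod p$, let $\varepsilon=0$ if $t=0$ and $1$ otherwise, $\varepsilon'=0$ if $t'=0$ and $1$ otherwise, and set $$d_i=\begin{cases}\left\lfloor\frac{t'+2s}{p}\right\rfloor & \text{if } \varepsilon'=\varepsilon=1,\\ \left\lfloor\frac{t'+s+p}{p}\right\rfloor & \text{if } \varepsilon'=1,\ \varepsilon=0,\\ \left\lfloor\frac{p-1+s-t}{p}\right\rfloor & \text{if } \varepsilon'=0,\end{cases}\qquad e_i=\begin{cases}1 & \text{if } |\lambda[i+1]_{(p)}|<|\lambda[i]_{(p)}|,\\ 0 & \text{otherwise.}\end{cases}$$ Then the $p$-weight of $\lambda$ is $w(\lambda)=\sum_{i=0}^{k}(k+1-i)d_i+\sum_{i=1}^{k}e_i$.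
   Context: Fix an integer $p\ge 2$. A partition is written $\lambda=(l_1^{a_1},\dots,l_t^{a_t})$ with $l_1>\dots>l_t>0$, $a_i\ge1$; it is $p$-regular if all $a_i\le p-1$. A $p$-regular $\lambda$ is a JS-partition if $l_i-l_{i+1}+a_i+a_{i+1}\equiv 0\pmod p$ for $1\le i<t$; its type is $l_1-a_1 \bmod p$. The $p$-core $\nu_{(p)}$ of a partition $\nu$ is obtained by repeatedly removing rim hooks of length $p$ until none remains; the $p$-weight is $w(\nu)=(|\nu|-|\nu_{(p)}|)/p$. Residue symbol: the rim of $\lambda$ is the set of nodes $(i,j)$ of the Young diagram with $(i+1,j+1)$ not in it, ordered from the end of the first row to the start of the last row. The $p$-rim is the union of $p$-segments: the first consists of the first $p$ nodes of the rim (or all of it), each next one consists of the first $p$ (or all remaining) rim nodes starting at the last node of the row just below the lowest row of the previous segment, until the last row is reached. Let $a_1$ = size of the $p$-rim of $\lambda^{(1)}=\lambda$, $r_1$ = its number of parts; removing the $p$-rim gives $\lambda^{(2)}$; iterate until $\lambda^{(m+1)}=\emptyset$, defining $a_j,r_j$ for $\lambda^{(j)}$. The residue symbol $R_p(\lambda)$ has columns $(x_j,y_j)$, $j=1,\dots,m$, with $x_j\equiv a_{m+1-j}-r_{m+1-j}$, $y_j\equiv 1-r_{m+1-j}\pmod p$; $m$ is its length. Deleting the last column of $R_p(\lambda)$ gives $R_p(\lambda^{(2)})$, so the first $j$ columns of $R_p(\lambda)$ form the residue symbol of $\lambda^{(m+1-j)}$. *)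

theory Defs
  imports "HOL-Number_Theory.Cong"
begin

definition is_partition :: "nat list \<Rightarrow> bool" where
  "is_partition lam \<longleftrightarrow> sorted_wrt (\<ge>) lam \<and> (\<forall>l \<in> set lam. 0 < l)"

text \<open>
  A partition \<open>(l\<^sub>1^a\<^sub>1, \<dots>, l\<^sub>t^a\<^sub>t)\<close> with \<open>l\<^sub>1 > \<dots> > l\<^sub>t\<close> has \<open>distinct_parts = [l\<^sub>1, \<dots>, l\<^sub>t]\<close>
  and \<open>multiplicities = [a\<^sub>1, \<dots>, a\<^sub>t]\<close>.
\<close>

definition distinct_parts :: "nat list \<Rightarrow> nat list" where
  "distinct_parts lam = remdups lam"

definition multiplicities :: "nat list \<Rightarrow> nat list" where
  "multiplicities lam = map (count_list lam) (distinct_parts lam)"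

definition p_regular :: "nat \<Rightarrow> nat list \<Rightarrow> bool" where
  "p_regular p lam \<longleftrightarrow> is_partition lam \<and> (\<forall>a \<in> set (multiplicities lam). a \<le> p - 1)"

definition JS_partition :: "nat \<Rightarrow> nat list \<Rightarrow> bool" where
  "JS_partition p lam \<longleftrightarrow> p_regular p lam \<and>
     (let l = distinct_parts lam; a = multiplicities lam in
        \<forall>i. Suc i < length l \<longrightarrow>
          [int (l ! i) - int (l ! Suc i) + int (a ! i) + int (a ! Suc i) = 0] (mod int p))"

definition JS_type :: "nat \<Rightarrow> nat list \<Rightarrow> int" where
  "JS_type p lam = (int (hd (distinct_parts lam)) - int (hd (multiplicities lam))) mod int p"

text \<open>Rows and columns are numbered from 1; row \<open>i\<close> has length \<open>lam ! (i - 1)\<close>.\<close>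

definition diagram :: "nat list \<Rightarrow> (nat \<times> nat) set" where
  "diagram lam = {(i, j). 1 \<le> i \<and> i \<le> length lam \<and> 1 \<le> j \<and> j \<le> lam ! (i - 1)}"

text \<open>The rim, listed from the end of the first row to the start of the last row.\<close>

definition rim :: "nat list \<Rightarrow> (nat \<times> nat) list" where
  "rim lam = concat (map (\<lambda>i. filter (\<lambda>(i, j). (i + 1, j + 1) \<notin> diagram lam)
                              (map (Pair i) (rev [1..<lam ! (i - 1) + 1])))
                         [1..<length lam + 1])"

text \<open>
  A rim hook of length \<open>p\<close> consists of \<open>p\<close> consecutive nodes of the rim whose removal leaves
  the diagram of a partition.
\<close>

definition removes_rim_hook :: "nat \<Rightarrow> nat list \<Rightarrow> nat list \<Rightarrow> bool" where
  "removes_rim_hook p lam mu \<longleftrightarrow> is_partition mu \<and>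
     (\<exists>i. i + p \<le> length (rim lam) \<and>
          diagram mu = diagram lam - set (take p (drop i (rim lam))))"

definition p_core :: "nat \<Rightarrow> nat list \<Rightarrow> nat list" where
  "p_core p lam =
     (THE kappa. (removes_rim_hook p)\<^sup>*\<^sup>* lam kappa \<and> (\<nexists>mu. removes_rim_hook p kappa mu))"

text \<open>The division is exact, since each rim hook removed has \<open>p\<close> nodes.\<close>

definition p_weight :: "nat \<Rightarrow> nat list \<Rightarrow> nat" where
  "p_weight p lam = (sum_list lam - sum_list (p_core p lam)) div p"

text \<open>
  The argument is the part of the rim from some row downwards.  The \<open>p\<close>-segment starting there
  is \<open>take p (v # vs)\<close> for \<open>p > 0\<close>; the next one starts with the first rim node (that is, the
  last node) of the row just below the lowest row of the current segment.
\<close>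

function p_segments :: "nat \<Rightarrow> (nat \<times> nat) list \<Rightarrow> (nat \<times> nat) list list" where
  "p_segments p [] = []"
| "p_segments p (v # vs) =
     (let seg = v # take (p - 1) vs
      in seg # p_segments p (filter (\<lambda>u. fst (last seg) < fst u) vs))"
  by pat_completeness auto
termination
  by (relation "measure (\<lambda>(p, vs). length vs)") (auto simp: less_Suc_eq_le)

definition p_rim :: "nat \<Rightarrow> nat list \<Rightarrow> (nat \<times> nat) list" where
  "p_rim p lam = concat (p_segments p (rim lam))"

definition remove_p_rim :: "nat \<Rightarrow> nat list \<Rightarrow> nat list" where
  "remove_p_rim p lam =
     filter (\<lambda>l. 0 < l)
       (map (\<lambda>i. length (filter (\<lambda>j. (i, j) \<notin> set (p_rim p lam)) [1..<lam ! (i - 1) + 1]))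
            [1..<length lam + 1])"

text \<open>\<open>peel p lam j\<close> is \<open>\<lambda>^(j)\<close>, so \<open>peel p lam 1 = lam\<close>.\<close>

definition peel :: "nat \<Rightarrow> nat list \<Rightarrow> nat \<Rightarrow> nat list" where
  "peel p lam j = (remove_p_rim p ^^ (j - 1)) lam"

definition symbol_length :: "nat \<Rightarrow> nat list \<Rightarrow> nat" where
  "symbol_length p lam = (LEAST m. peel p lam (m + 1) = [])"

text \<open>Entries are reduced to representatives in \<open>{0..<p}\<close>; the column \<open>(x\<^sub>j, y\<^sub>j)\<close> has list index \<open>j - 1\<close>.\<close>

definition residue_symbol :: "nat \<Rightarrow> nat list \<Rightarrow> (int \<times> int) list" where
  "residue_symbol p lam =
     (let m = symbol_length p lam in
      map (\<lambda>j. let mu = peel p lam (m + 1 - j);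
                   a = int (length (p_rim p mu));
                   r = int (length mu)
               in ((a - r) mod int p, (1 - r) mod int p))
          [1..<m + 1])"

text \<open>
  The partition \<open>\<lambda>[j]\<close>.  Among \<open>p\<close>-regular partitions the residue symbol determines the partition;
  without regularity this fails, e.g. for \<open>p = 2\<close> the partitions \<open>(1)\<close> and \<open>(1,1,1)\<close> have
  the same symbol.
\<close>

definition symbol_truncation :: "nat \<Rightarrow> nat list \<Rightarrow> nat \<Rightarrow> nat list" where
  "symbol_truncation p lam j =
     (THE mu. p_regular p mu \<and> residue_symbol p mu = take j (residue_symbol p lam))"

definition d_zero :: "nat \<Rightarrow> int \<Rightarrow> int \<times> int \<Rightarrow> int" where
  "d_zero p alpha = (\<lambda>(x, y).
     if [x = alpha] (mod int p) \<and> [y = alpha + 1] (mod int p) then 1 else 0)"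

definition d_step :: "nat \<Rightarrow> int \<times> int \<Rightarrow> int \<times> int \<Rightarrow> int" where
  "d_step p = (\<lambda>(x', y') (x, y).
     let t  = (x - y + 1) mod int p;
         t' = (x' - y' + 1) mod int p;
         s  = (y' - y) mod int p
     in if t' \<noteq> 0 \<and> t \<noteq> 0 then (t' + 2 * s) div int p
        else if t' \<noteq> 0 \<and> t = 0 then (t' + s + int p) div int p
        else (int p - 1 + s - t) div int p)"

definition d_coeff :: "nat \<Rightarrow> int \<Rightarrow> nat list \<Rightarrow> nat \<Rightarrow> int" where
  "d_coeff p alpha lam i =
     (let R = residue_symbol p lam in
      if i = 0 then d_zero p alpha (R ! 0) else d_step p (R ! (i - 1)) (R ! i))"

definition e_coeff :: "nat \<Rightarrow> nat list \<Rightarrow> nat \<Rightarrow> int" where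
  "e_coeff p lam i =
     (if sum_list (p_core p (symbol_truncation p lam (i + 1)))
           < sum_list (p_core p (symbol_truncation p lam i)) then 1 else 0)"

end

theory Submission
  imports Defs
begin

text \<open>
  Write a JS-partition as a list of blocks \<open>(l\<^sub>i, a\<^sub>i)\<close>.  A \<open>p\<close>-segment starting at the top of a block
  either ends in the last row of that block, or, exactly when
  \<open>l\<^sub>i - l\<^sub>i\<^sub>+\<^sub>1 + a\<^sub>i + a\<^sub>i\<^sub>+\<^sub>1 = p\<close>, covers this block and the next one completely.  Removing the
  \<open>p\<close>-rim therefore acts on blocks by an explicit rule, preserves the JS property and the type, and
  changes the number \<open>q\<close> of full segments only at the bottom of the diagram; comparing bottoms
  gives \<open>q(\<lambda>[i+1]) - q(\<lambda>[i]) = d\<^sub>i\<close>.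

  The beta-numbers of a JS-partition of type \<open>\<alpha>\<close> with \<open>r\<close> rows occupy \<open>r\<close> consecutive residues
  starting at \<open>\<alpha> + r\<close>, so its \<open>p\<close>-core is that of a rectangle and has size \<open>a c\<close> or
  \<open>(p - a) (p - c)\<close>, where \<open>a = r mod p\<close> and \<open>c = (\<alpha> + r) mod p\<close>.  Comparing the sizes of
  successive cores gives \<open>w(\<lambda>[i+1]) - w(\<lambda>[i]) = q(\<lambda>[i+1]) + e\<^sub>i\<close>.  Finally \<open>\<lambda>[i]\<close> is the partition
  obtained by peeling, because the residue symbol determines a \<open>p\<close>-regular partition.
\<close>

section \<open>Removing the p-rim row by row\<close>

text \<open>The quantities \<open>t\<close> and \<open>s\<close> are the size of the incomplete last
  segment (0 if there is none) and the number of rows lost in peeling. Both are read off the last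
  one or two blocks, and type plus twice the number of rows, constant modulo \<open>p\<close> along
  the tails of the block list, leaves only the combinations in \<open>end_relation\<close>. This
  makes the core sizes comparable: the size of the partition drops by \<open>p q + t\<close>, and
  \<open>t\<close> plus the core size after peeling is the core size before it, plus
  \<open>p\<close> if the core shrank. Since \<open>q\<close> is itself the sum of all
  \<open>d_j\<close> so far, summing the weight steps counts \<open>d_i\<close> exactly
  \<open>k + 1 - i\<close> times. The obstacle is degeneration. Peeling may leave blocks of height
  or width 0, whose neighbours then become adjacent, and the block that one segment leaves may join
  the first block of the peeled tail. Hence the weaker block condition, and an induction that also
  follows the peeled list without its first block. For injectivity the danger is that a column shows
  sizes only modulo \<open>p\<close>; regularity confines the number of lost rows to
  \<open>p\<close> consecutive values.\<close>

declare upt_Suc [simp del]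

definition first_part :: "nat list \<Rightarrow> nat" where
  "first_part xs = (case xs of [] \<Rightarrow> 0 | x # _ \<Rightarrow> x)"

lemma first_part_simps [simp]: "first_part [] = 0" "first_part (x # xs) = x"
  by (simp_all add: first_part_def)

lemma is_partition_Nil [simp]: "is_partition []"
  by (simp add: is_partition_def)

lemma is_partition_Cons:
  "is_partition (x # xs) \<longleftrightarrow> 0 < x \<and> first_part xs \<le> x \<and> is_partition xs"
  unfolding is_partition_def by (cases xs) auto

lemma first_part_pos: "is_partition xs \<Longrightarrow> xs \<noteq> [] \<Longrightarrow> 0 < first_part xs"
  by (cases xs) (auto simp: is_partition_Cons)

text \<open>
  The \<open>p\<close>-rim is traversed row by row; the state \<open>c\<close> is the number of nodes still missing from the
  current segment when a row is entered.
\<close>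

definition row_cut :: "nat \<Rightarrow> nat \<Rightarrow> nat list \<Rightarrow> nat" where
  "row_cut c x xs = min c (x + 1 - max 1 (first_part xs))"

text \<open>A segment used up in this row restarts with \<open>p\<close> nodes in the next row, and
  the remaining rim nodes of the row are skipped. So the state is never 0: it runs from 1 to
  \<open>p\<close>.\<close>

definition next_state :: "nat \<Rightarrow> nat \<Rightarrow> nat \<Rightarrow> nat list \<Rightarrow> nat" where
  "next_state p c x xs = (if row_cut c x xs = c then p else c - row_cut c x xs)"

fun strip_rim :: "nat \<Rightarrow> nat \<Rightarrow> nat list \<Rightarrow> nat list" where
  "strip_rim p c [] = []"
| "strip_rim p c (x # xs) = (x - row_cut c x xs) # strip_rim p (next_state p c x xs) xs"

text \<open>Started from \<open>p\<close>, the value \<open>p\<close> at the end means that the last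
  segment is full; a smaller value is what it lacks. This is the part of the \<open>p\<close>-rim
  length that is visible modulo \<open>p\<close>.\<close>

fun final_state :: "nat \<Rightarrow> nat \<Rightarrow> nat list \<Rightarrow> nat" where
  "final_state p c [] = c"
| "final_state p c (x # xs) = final_state p (next_state p c x xs) xs"

fun rim_from :: "nat \<Rightarrow> nat list \<Rightarrow> (nat \<times> nat) list" where
  "rim_from i [] = []"
| "rim_from i (x # xs) =
     map (Pair i) (rev [max 1 (first_part xs)..<x + 1]) @ rim_from (Suc i) xs"

lemma filter_ge_upt: "filter (\<lambda>j. m \<le> j) [a..<b] = [max a m..<b]"
proof (induction b)
  case (Suc b)
  then show ?case by (auto simp: max_def not_le upt_Suc)
qed simp

text \<open>The prefix \<open>pre\<close> preserves the absolute row numbers used by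
  \<open>diagram\<close>; the induction moves rows from \<open>xs\<close> into
  \<open>pre\<close>.\<close>

lemma rim_from_append:
  assumes "is_partition (pre @ xs)"
  shows "concat (map (\<lambda>i. filter (\<lambda>(i, j). (i + 1, j + 1) \<notin> diagram (pre @ xs))
                   (map (Pair i) (rev [1..<(pre @ xs) ! (i - 1) + 1])))
                [length pre + 1..<length (pre @ xs) + 1]) = rim_from (length pre + 1) xs"
  using assms
proof (induction xs arbitrary: pre)
  case Nil
  then show ?case by simp
next
  case (Cons x xs)
  let ?i = "length pre + 1"
  have IH: "concat (map (\<lambda>i. filter (\<lambda>(i, j). (i + 1, j + 1) \<notin> diagram (pre @ x # xs))
                   (map (Pair i) (rev [1..<(pre @ x # xs) ! (i - 1) + 1])))
                [length pre + 2..<length (pre @ x # xs) + 1]) = rim_from (length pre + 2) xs"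
    using Cons.IH[of "pre @ [x]"] Cons.prems by simp
  have upt: "[?i..<length (pre @ x # xs) + 1] = ?i # [length pre + 2..<length (pre @ x # xs) + 1]"
    by (subst upt_conv_Cons) auto
  have mem: "(?i + 1, j + 1) \<notin> diagram (pre @ x # xs) \<longleftrightarrow> first_part xs \<le> j" if "1 \<le> j" for j
  proof (cases xs)
    case Nil
    then show ?thesis using that by (simp add: diagram_def)
  next
    case (Cons y ys)
    then show ?thesis using that by (auto simp: diagram_def nth_append)
  qed
  have "filter (\<lambda>(i, j). (i + 1, j + 1) \<notin> diagram (pre @ x # xs)) (map (Pair ?i) (rev [1..<x + 1]))
      = map (Pair ?i) (filter (\<lambda>j. (?i + 1, j + 1) \<notin> diagram (pre @ x # xs)) (rev [1..<x + 1]))"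
    by (simp add: filter_map o_def)
  also have "filter (\<lambda>j. (?i + 1, j + 1) \<notin> diagram (pre @ x # xs)) (rev [1..<x + 1])
      = filter (\<lambda>j. first_part xs \<le> j) (rev [1..<x + 1])"
    by (rule filter_cong) (use mem in auto)
  also have "\<dots> = rev [max 1 (first_part xs)..<x + 1]"
    by (simp only: rev_filter[symmetric] filter_ge_upt)
  finally show ?case
    unfolding upt using IH by (simp add: nth_append)
qed

lemma rim_eq_rim_from: "is_partition lam \<Longrightarrow> rim lam = rim_from 1 lam"
  using rim_from_append[of "[]" lam] by (simp add: rim_def)

lemma fst_rim_from: "u \<in> set (rim_from i xs) \<Longrightarrow> i \<le> fst u"
proof (induction xs arbitrary: i)
  case (Cons x xs)
  then show ?case by (auto dest: Cons.IH)
qed simp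

lemma rim_from_eq_Nil: "is_partition xs \<Longrightarrow> rim_from i xs = [] \<longleftrightarrow> xs = []"
  by (cases xs) (auto simp: is_partition_Cons)

text \<open>\<open>p_segments\<close> can only start afresh. This is the rest of the
  \<open>p\<close>-rim when \<open>c\<close> nodes of the current segment are still missing, so that
  a recursion over rows can cross a row in the middle of a segment.\<close>

definition p_rim_state :: "nat \<Rightarrow> nat \<Rightarrow> (nat \<times> nat) list \<Rightarrow> (nat \<times> nat) list" where
  "p_rim_state p c vs = (if vs = [] then [] else
     take c vs @ concat (p_segments p (filter (\<lambda>u. fst (last (take c vs)) < fst u) vs)))"

lemma concat_p_segments:
  assumes "0 < p" "\<And>u. u \<in> set vs \<Longrightarrow> fst (hd vs) \<le> fst u"
  shows "concat (p_segments p vs) = p_rim_state p p vs"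
proof (cases vs)
  case (Cons v ws)
  have "last (v # take (p - 1) ws) \<in> set (v # take (p - 1) ws)" by (rule last_in_set) simp
  then have "last (v # take (p - 1) ws) \<in> set vs" unfolding Cons by (auto dest: in_set_takeD)
  then have "fst v \<le> fst (last (v # take (p - 1) ws))" using assms(2) Cons by fastforce
  moreover have "take p (v # ws) = v # take (p - 1) ws" using assms(1) by (cases p) auto
  ultimately show ?thesis using Cons by (simp add: p_rim_state_def Let_def not_less)
qed (simp add: p_rim_state_def)

lemma concat_p_segments_rim_from:
  assumes "0 < p" "is_partition xs"
  shows "concat (p_segments p (rim_from i xs)) = p_rim_state p p (rim_from i xs)"
proof (cases xs)
  case (Cons x ys)
  then have "fst (hd (rim_from i xs)) = i"
    using assms by (auto simp: is_partition_Cons hd_append hd_map upt_eq_Nil_conv)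
  then show ?thesis using assms fst_rim_from[of _ i xs] by (intro concat_p_segments) auto
qed (simp add: p_rim_state_def)

text \<open>If the row has at least \<open>c\<close> rim nodes, the segment ends here and the rows
  below start afresh. Otherwise it takes all \<open>n\<close> of them and carries
  \<open>c - n\<close> down, where it may find no further row.\<close>

lemma p_rim_state_Cons:
  assumes "is_partition (x # xs)" "0 < c" "0 < p"
  shows "p_rim_state p c (rim_from i (x # xs)) =
    map (Pair i) (rev [x + 1 - row_cut c x xs..<x + 1]) @
      p_rim_state p (next_state p c x xs) (rim_from (Suc i) xs)"
proof -
  define n where "n = x + 1 - max 1 (first_part xs)"
  define row where "row = map (Pair i) (rev [max 1 (first_part xs)..<x + 1])"
  have n: "0 < n" "n \<le> x" "first_part xs \<le> x" using assms by (auto simp: n_def is_partition_Cons)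
  have len: "length row = n" by (simp add: row_def n_def)
  have row': "row = map (Pair i) (rev [x + 1 - n..<x + 1])"
  proof -
    have "x + 1 - n = max 1 (first_part xs)" using n by (simp add: n_def)
    then show ?thesis by (simp add: row_def)
  qed
  have rim: "rim_from i (x # xs) = row @ rim_from (Suc i) xs" by (simp add: row_def)
  have fst_row: "fst u = i" if "u \<in> set row" for u using that by (auto simp: row_def)
  have fr: "filter (\<lambda>u. i < fst u) (row @ rim_from (Suc i) xs) = rim_from (Suc i) xs"
    using fst_row fst_rim_from[of _ "Suc i" xs] by (auto simp: filter_empty_conv filter_id_conv Suc_le_eq)
  have cut: "row_cut c x xs = min c n" by (simp add: row_cut_def n_def)
  show ?thesis
  proof (cases "c \<le> n")
    case True
    have tk: "take c row = map (Pair i) (rev [x + 1 - c..<x + 1])"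
      unfolding row' using True n
      by (simp add: take_map rev_drop[symmetric] take_rev)
    have "take c row \<noteq> []" using True len assms(2) by auto
    then have "fst (last (take c row)) = i"
      using fst_row by (meson in_set_takeD last_in_set)
    then have "p_rim_state p c (rim_from i (x # xs)) = take c row @ concat (p_segments p (rim_from (Suc i) xs))"
      unfolding rim using True len n fr by (auto simp: p_rim_state_def)
    moreover have "next_state p c x xs = p" using True cut by (simp add: next_state_def)
    ultimately show ?thesis using True tk cut assms by (simp add: concat_p_segments_rim_from is_partition_Cons)
  next
    case False
    have ns: "next_state p c x xs = c - n" using False cut by (simp add: next_state_def)
    have tk: "take c (row @ rim_from (Suc i) xs) = row @ take (c - n) (rim_from (Suc i) xs)"
      using False len by simp
    show ?thesis
    proof (cases "xs = []")
      case True
      have "last row \<in> set row" using len n by (intro last_in_set) auto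
      then have "fst (last row) = i" using fst_row by blast
      then show ?thesis
        using True False len n fst_row unfolding rim cut ns
        by (auto simp: p_rim_state_def row' filter_empty_conv min_def)
    next
      case xs: False
      let ?R = "rim_from (Suc i) xs"
      have R: "?R \<noteq> []" using xs assms by (simp add: rim_from_eq_Nil is_partition_Cons)
      then have T: "take (c - n) ?R \<noteq> []" using False by auto
      then have "last (take (c - n) ?R) \<in> set ?R" by (meson in_set_takeD last_in_set)
      then have "Suc i \<le> fst (last (take (c - n) ?R))" by (rule fst_rim_from)
      then have "filter (\<lambda>u. fst (last (take (c - n) ?R)) < fst u) row = []"
        using fst_row by (auto simp: filter_empty_conv)
      moreover have "min c n = n" using False by simp
      ultimately show ?thesis
        using False R T len unfolding rim cut ns p_rim_state_def tk by simp (use row' in simp)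
    qed
  qed
qed

lemma next_state_pos: "0 < p \<Longrightarrow> 0 < c \<Longrightarrow> 0 < next_state p c x xs"
  by (auto simp: next_state_def row_cut_def)

lemma next_state_le: "c \<le> p \<Longrightarrow> next_state p c x xs \<le> p"
  by (auto simp: next_state_def)

lemma row_cut_le: "0 < x \<Longrightarrow> row_cut c x xs \<le> x"
  by (auto simp: row_cut_def)

lemma row_cut_pos: "0 < c \<Longrightarrow> is_partition (x # xs) \<Longrightarrow> 0 < row_cut c x xs"
  by (auto simp: row_cut_def is_partition_Cons)

lemma length_strip_rim [simp]: "length (strip_rim p c xs) = length xs"
  by (induction xs arbitrary: c) auto

text \<open>In each row the \<open>p\<close>-rim occupies the last nodes, so removing it merely
  shortens rows.\<close>

lemma mem_p_rim_state:
  assumes "is_partition xs" "0 < c" "0 < p"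
  shows "(i, j) \<in> set (p_rim_state p c (rim_from i0 xs)) \<longleftrightarrow>
    i0 \<le> i \<and> i < i0 + length xs \<and> strip_rim p c xs ! (i - i0) < j \<and> j \<le> xs ! (i - i0)"
  using assms
proof (induction xs arbitrary: c i0)
  case Nil
  then show ?case by (simp add: p_rim_state_def)
next
  case (Cons x xs)
  have cx: "row_cut c x xs \<le> x" using Cons.prems by (simp add: row_cut_le is_partition_Cons)
  have IH: "(i, j) \<in> set (p_rim_state p (next_state p c x xs) (rim_from (Suc i0) xs)) \<longleftrightarrow>
    Suc i0 \<le> i \<and> i < Suc i0 + length xs \<and>
    strip_rim p (next_state p c x xs) xs ! (i - Suc i0) < j \<and> j \<le> xs ! (i - Suc i0)"
    by (rule Cons.IH) (use Cons.prems in \<open>auto simp: is_partition_Cons next_state_pos\<close>)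
  have "(i, j) \<in> set (p_rim_state p c (rim_from i0 (x # xs))) \<longleftrightarrow>
      i = i0 \<and> x - row_cut c x xs < j \<and> j \<le> x \<or>
      (i, j) \<in> set (p_rim_state p (next_state p c x xs) (rim_from (Suc i0) xs))"
    using cx by (auto simp: p_rim_state_Cons[OF Cons.prems] simp del: rim_from.simps)
  then show ?case unfolding IH
    by (cases "i = i0") (auto simp: nth_Cons' Suc_le_eq)
qed

lemma length_p_rim_state:
  assumes "is_partition xs" "0 < c" "0 < p"
  shows "length (p_rim_state p c (rim_from i0 xs)) + sum_list (strip_rim p c xs) = sum_list xs"
  using assms
proof (induction xs arbitrary: c i0)
  case (Cons x xs)
  have cx: "row_cut c x xs \<le> x" using Cons.prems by (simp add: row_cut_le is_partition_Cons)
  have IH: "length (p_rim_state p (next_state p c x xs) (rim_from (Suc i0) xs)) +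
     sum_list (strip_rim p (next_state p c x xs) xs) = sum_list xs"
    by (rule Cons.IH) (use Cons.prems in \<open>auto simp: is_partition_Cons next_state_pos\<close>)
  then show ?case
    using cx by (simp add: p_rim_state_Cons[OF Cons.prems] del: rim_from.simps)
qed (simp add: p_rim_state_def)

lemma p_rim_eq:
  "is_partition lam \<Longrightarrow> 0 < p \<Longrightarrow> p_rim p lam = p_rim_state p p (rim_from 1 lam)"
  by (simp add: p_rim_def rim_eq_rim_from concat_p_segments_rim_from)

lemma length_p_rim:
  "is_partition lam \<Longrightarrow> 0 < p \<Longrightarrow> length (p_rim p lam) + sum_list (strip_rim p p lam) = sum_list lam"
  by (simp add: p_rim_eq length_p_rim_state)

lemma strip_rim_le: "is_partition xs \<Longrightarrow> i < length xs \<Longrightarrow> strip_rim p c xs ! i \<le> xs ! i"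
proof (induction xs arbitrary: c i)
  case (Cons x xs)
  then show ?case using Cons.IH[of "i - 1"] by (cases i) (auto simp: is_partition_Cons)
qed simp

lemma remove_p_rim_eq:
  assumes "is_partition lam" "0 < p"
  shows "remove_p_rim p lam = filter (\<lambda>l. 0 < l) (strip_rim p p lam)"
proof -
  have "map (\<lambda>i. length (filter (\<lambda>j. (i, j) \<notin> set (p_rim p lam)) [1..<lam ! (i - 1) + 1]))
            [1..<length lam + 1] = strip_rim p p lam"
  proof (rule nth_equalityI)
    fix i assume "i < length (map (\<lambda>i. length (filter (\<lambda>j. (i, j) \<notin> set (p_rim p lam))
            [1..<lam ! (i - 1) + 1])) [1..<length lam + 1])"
    then have i: "i < length lam" by simp
    let ?v = "strip_rim p p lam ! i"
    have v: "?v \<le> lam ! i" using strip_rim_le[OF assms(1) i] .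
    have "filter (\<lambda>j. (Suc i, j) \<notin> set (p_rim p lam)) [1..<lam ! i + 1]
        = filter (\<lambda>j. j \<le> ?v) [1..<lam ! i + 1]"
      by (rule filter_cong)
        (use i in \<open>auto simp: p_rim_eq[OF assms] mem_p_rim_state[OF assms(1) assms(2) assms(2)]\<close>)
    also have "length \<dots> = card {j. 1 \<le> j \<and> j \<le> ?v}"
    proof -
      have "set (filter (\<lambda>j. j \<le> ?v) [1..<lam ! i + 1]) = {j. 1 \<le> j \<and> j \<le> ?v}"
        using v by auto
      then show ?thesis by (metis distinct_card distinct_filter distinct_upt)
    qed
    also have "\<dots> = ?v" by (simp flip: atLeastAtMost_iff)
    finally show "map (\<lambda>i. length (filter (\<lambda>j. (i, j) \<notin> set (p_rim p lam))
            [1..<lam ! (i - 1) + 1])) [1..<length lam + 1] ! i = ?v"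
      using i by (simp)
  qed simp
  then show ?thesis by (simp add: remove_p_rim_def)
qed

lemma final_state_bounds: "0 < c \<Longrightarrow> c \<le> p \<Longrightarrow> 0 < final_state p c xs \<and> final_state p c xs \<le> p"
proof (induction xs arbitrary: c)
  case (Cons x xs)
  then show ?case using next_state_pos[of p c x xs] next_state_le[of c p x xs] by simp
qed simp

text \<open>Each row lowers the state by the number of nodes cut, and the reset from 0 to
  \<open>p\<close> is invisible modulo \<open>p\<close>.\<close>

lemma final_state_cong:
  assumes "is_partition xs"
  shows "[int (final_state p c xs) = int c + int (sum_list (strip_rim p c xs)) - int (sum_list xs)] (mod int p)"
  using assms
proof (induction xs arbitrary: c)
  case (Cons x xs)
  have x: "row_cut c x xs \<le> x" "row_cut c x xs \<le> c"
    using Cons.prems by (auto simp: row_cut_le is_partition_Cons row_cut_def)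
  have 1: "[int (next_state p c x xs) = int c - int (row_cut c x xs)] (mod int p)"
    using x by (auto simp: next_state_def cong_def of_nat_diff)
  have "[int (final_state p c (x # xs)) = int (next_state p c x xs) +
      (int (sum_list (strip_rim p (next_state p c x xs) xs)) - int (sum_list xs))] (mod int p)"
    using Cons.IH[of "next_state p c x xs"] Cons.prems by (simp add: is_partition_Cons algebra_simps)
  also have "[int (next_state p c x xs) +
      (int (sum_list (strip_rim p (next_state p c x xs) xs)) - int (sum_list xs)) =
      int c - int (row_cut c x xs) +
      (int (sum_list (strip_rim p (next_state p c x xs) xs)) - int (sum_list xs))] (mod int p)"
    by (rule cong_add[OF 1 cong_refl])
  finally show ?case using x by (simp add: of_nat_diff algebra_simps)
qed simp

lemma strip_rim_hd_ge:
  assumes "is_partition (x # y # xs)"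
  shows "y \<le> x - row_cut c x (y # xs) + 1"
  using assms by (auto simp: row_cut_def is_partition_Cons)

text \<open>A segment goes on below only if it took every rim node of the row, down to the one above
  the end of the next row.\<close>

lemma strip_rim_hd_continue:
  assumes "is_partition (x # y # xs)" "next_state p c x (y # xs) < p" "c \<le> p"
  shows "x - row_cut c x (y # xs) + 1 = y"
  using assms by (auto simp: next_state_def row_cut_def is_partition_Cons min_def split: if_splits)

text \<open>
  Reading the rows from the bottom, the row above decides whether a segment starts in the
  current row: if it does not, the stripped row above has length exactly one less than the
  current row.
\<close>

lemma strip_rim_inj_aux:
  assumes "is_partition (x # xs)" "is_partition (y # ys)" "length xs = length ys"
    "0 < c" "c \<le> p" "0 < d" "d \<le> p"
    "strip_rim p c (x # xs) = strip_rim p d (y # ys)"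
    "final_state p c (x # xs) = final_state p d (y # ys)"
  shows "xs = ys \<and> x + d = y + c"
  using assms
proof (induction xs arbitrary: x y ys c d)
  case Nil
  have "0 < row_cut c x [] \<and> row_cut c x [] \<le> x" "0 < row_cut d y [] \<and> row_cut d y [] \<le> y"
    using Nil.prems by (auto simp: row_cut_le row_cut_pos is_partition_Cons)
  moreover have "row_cut c x [] \<le> c" "row_cut d y [] \<le> d" by (auto simp: row_cut_def)
  ultimately show ?case using Nil.prems
    by (auto simp: next_state_def split: if_splits)
next
  case (Cons x' xs)
  obtain y' ys' where ys: "ys = y' # ys'" using Cons.prems(3) by (cases ys) auto
  let ?c = "next_state p c x (x' # xs)" and ?d = "next_state p d y (y' # ys')"
  have bnd: "0 < ?c" "?c \<le> p" "0 < ?d" "?d \<le> p"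
    using Cons.prems by (auto simp: next_state_le next_state_pos)
  have IH: "xs = ys' \<and> x' + ?d = y' + ?c"
    by (rule Cons.IH) (use Cons.prems bnd ys in \<open>auto simp: is_partition_Cons\<close>)
  have hd: "x - row_cut c x (x' # xs) = y - row_cut d y (y' # ys')"
    using Cons.prems ys by simp
  have ge: "x' \<le> x - row_cut c x (x' # xs) + 1" "y' \<le> y - row_cut d y (y' # ys') + 1"
    using strip_rim_hd_ge Cons.prems(1,2) ys by auto
  have cont: "?c < p \<Longrightarrow> x - row_cut c x (x' # xs) + 1 = x'"
    "?d < p \<Longrightarrow> y - row_cut d y (y' # ys') + 1 = y'"
    using strip_rim_hd_continue Cons.prems(1,2,5,7) ys by blast+
  \<comment> \<open>If \<open>?c < ?d\<close>, then \<open>x' < y'\<close> by \<open>IH\<close>. But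
    \<open>?c < p\<close> fixes the common stripped row above at \<open>x' - 1\<close>, while
    \<open>y'\<close> exceeds that row by at most 1, so \<open>y' \<le> x'\<close>. The other case
    is symmetric.\<close>
  have cd: "?c = ?d"
    using IH hd ge cont bnd by linarith
  then have xy: "x' = y'" using IH by linarith
  have "row_cut c x (x' # xs) \<le> x" "row_cut d y (y' # ys') \<le> y"
    "0 < row_cut c x (x' # xs)" "0 < row_cut d y (y' # ys')"
    using Cons.prems ys by (auto simp: row_cut_le row_cut_pos is_partition_Cons)
  moreover have "row_cut c x (x' # xs) \<le> c" "row_cut d y (y' # ys') \<le> d" by (auto simp: row_cut_def)
  ultimately have "x + d = y + c"
    using cd hd Cons.prems(5,7) by (auto simp: next_state_def split: if_splits)
  then show ?case using IH xy ys by simp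
qed

lemma strip_rim_inj:
  assumes "is_partition xs" "is_partition ys" "length xs = length ys" "0 < p"
    "strip_rim p p xs = strip_rim p p ys" "final_state p p xs = final_state p p ys"
  shows "xs = ys"
proof (cases xs)
  case Nil
  then show ?thesis using assms by simp
next
  case (Cons x xs')
  then obtain y ys' where "ys = y # ys'" using assms(3) by (cases ys) auto
  then show ?thesis using strip_rim_inj_aux[of x xs' y ys' p p p] assms Cons by auto
qed

lemma strip_rim_sorted:
  assumes "is_partition xs" "0 < c" "0 < p"
  shows "sorted_wrt (\<ge>) (strip_rim p c xs)"
  using assms
proof (induction xs arbitrary: c)
  case (Cons x xs)
  have IH: "sorted_wrt (\<ge>) (strip_rim p (next_state p c x xs) xs)"
    by (rule Cons.IH) (use Cons.prems in \<open>auto simp: is_partition_Cons next_state_pos\<close>)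
  show ?case
  proof (cases xs)
    case (Cons y ys)
    let ?c = "next_state p c x xs"
    have "is_partition (y # ys)" "0 < ?c"
      using Cons.prems \<open>xs = y # ys\<close> by (auto simp: is_partition_Cons next_state_pos)
    then have "0 < row_cut ?c y ys" by (simp add: row_cut_pos)
    moreover have "y \<le> x - row_cut c x xs + 1"
      using strip_rim_hd_ge[of x y ys c] Cons.prems Cons by simp
    ultimately have "y - row_cut ?c y ys \<le> x - row_cut c x xs" by linarith
    then show ?thesis using IH Cons by auto
  qed simp
qed simp

lemma is_partition_filter: "sorted_wrt (\<ge>) xs \<Longrightarrow> is_partition (filter (\<lambda>l. 0 < l) xs)"
  by (auto simp: is_partition_def sorted_wrt_filter)

lemma is_partition_remove_p_rim:
  "is_partition lam \<Longrightarrow> 0 < p \<Longrightarrow> is_partition (remove_p_rim p lam)"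
  by (simp add: remove_p_rim_eq is_partition_filter strip_rim_sorted)

lemma sum_list_filter_pos: "sum_list (filter (\<lambda>l. 0 < l) xs) = sum_list (xs :: nat list)"
  by (induction xs) auto

lemma sum_remove_p_rim:
  "is_partition lam \<Longrightarrow> 0 < p \<Longrightarrow>
    length (p_rim p lam) + sum_list (remove_p_rim p lam) = sum_list lam"
  using length_p_rim by (simp add: remove_p_rim_eq sum_list_filter_pos)


section \<open>Regularity under removal of the p-rim\<close>

lemma count_list_eq_card: "count_list xs x = card {i. i < length xs \<and> xs ! i = x}"
  by (simp add: count_list_eq_length_filter length_filter_conv_card eq_commute)

lemma sorted_wrt_ge_nth: "sorted_wrt (\<ge>) xs \<Longrightarrow> i \<le> j \<Longrightarrow> j < length xs \<Longrightarrow> xs ! j \<le> (xs ! i :: nat)"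
  by (cases "i = j") (auto simp: sorted_wrt_iff_nth_less)

text \<open>Equal parts of a sorted list are adjacent, so a multiplicity exceeds
  \<open>p - 1\<close> exactly when some part recurs \<open>p - 1\<close> places later.\<close>

lemma count_list_less_iff:
  assumes "sorted_wrt (\<ge>) (xs :: nat list)" "0 < p"
  shows "(\<forall>x\<in>set xs. count_list xs x \<le> p - 1) \<longleftrightarrow>
    (\<forall>i. i + (p - 1) < length xs \<longrightarrow> xs ! (i + (p - 1)) < xs ! i)"
proof (intro iffI allI impI ballI)
  fix i assume *: "\<forall>x\<in>set xs. count_list xs x \<le> p - 1" and i: "i + (p - 1) < length xs"
  show "xs ! (i + (p - 1)) < xs ! i"
  proof (rule ccontr)
    assume "\<not> xs ! (i + (p - 1)) < xs ! i"
    then have eq: "xs ! j = xs ! i" if "j \<in> {i..i + (p - 1)}" for j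
      using sorted_wrt_ge_nth[OF assms(1), of i j] sorted_wrt_ge_nth[OF assms(1), of j "i + (p - 1)"] that i
      by auto
    have "card {i..i + (p - 1)} \<le> card {j. j < length xs \<and> xs ! j = xs ! i}"
    proof (rule card_mono)
      show "{i..i + (p - 1)} \<subseteq> {j. j < length xs \<and> xs ! j = xs ! i}"
      proof
        fix j assume "j \<in> {i..i + (p - 1)}"
        with eq[OF this] i show "j \<in> {j. j < length xs \<and> xs ! j = xs ! i}" by simp
      qed
    qed simp
    moreover have "xs ! i \<in> set xs" using i by auto
    then have "count_list xs (xs ! i) \<le> p - 1" using * by blast
    ultimately show False using assms(2) by (simp add: count_list_eq_card)
  qed
next
  fix x assume *: "\<forall>i. i + (p - 1) < length xs \<longrightarrow> xs ! (i + (p - 1)) < xs ! i" and "x \<in> set xs"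
  let ?I = "{i. i < length xs \<and> xs ! i = x}"
  have ne: "?I \<noteq> {}" using \<open>x \<in> set xs\<close> by (auto simp: in_set_conv_nth)
  have fin: "finite ?I" by simp
  define i where "i = Min ?I"
  have i: "i < length xs" "xs ! i = x" using Min_in[OF fin ne] by (auto simp: i_def)
  have "?I \<subseteq> {i..<i + (p - 1)}"
  proof
    fix j assume j: "j \<in> ?I"
    then have "i \<le> j" using fin by (simp add: i_def)
    moreover have "j < i + (p - 1)"
    proof (rule ccontr)
      assume "\<not> j < i + (p - 1)"
      then have "xs ! j \<le> xs ! (i + (p - 1))" "i + (p - 1) < length xs"
        using sorted_wrt_ge_nth[OF assms(1), of "i + (p - 1)" j] j by auto
      then show False using * i j by (metis (mono_tags, lifting) linorder_not_less mem_Collect_eq)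
    qed
    ultimately show "j \<in> {i..<i + (p - 1)}" by simp
  qed
  then have "card ?I \<le> card {i..<i + (p - 1)}" by (intro card_mono) auto
  then show "count_list xs x \<le> p - 1" by (simp add: count_list_eq_card)
qed

lemma p_regular_iff:
  assumes "0 < p"
  shows "p_regular p xs \<longleftrightarrow> is_partition xs \<and>
    (\<forall>i. i + (p - 1) < length xs \<longrightarrow> xs ! (i + (p - 1)) < xs ! i)"
  using count_list_less_iff[OF _ assms, of xs]
  by (auto simp: p_regular_def multiplicities_def distinct_parts_def is_partition_def)

lemma p_regular_Cons: "0 < p \<Longrightarrow> p_regular p (x # xs) \<Longrightarrow> p_regular p xs"
proof -
  assume p: "0 < p" and reg: "p_regular p (x # xs)"
  have "xs ! (i + (p - 1)) < xs ! i" if "i + (p - 1) < length xs" for i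
  proof -
    have "\<forall>i. i + (p - 1) < length (x # xs) \<longrightarrow> (x # xs) ! (i + (p - 1)) < (x # xs) ! i"
      using reg p by (simp add: p_regular_iff)
    from this[rule_format, of "Suc i"] show ?thesis using that by simp
  qed
  then show ?thesis using p reg by (simp add: p_regular_iff is_partition_Cons)
qed

text \<open>The last row of the run has at least two rim nodes but loses only one, so it is entered
  in state 1. Each earlier row costs one node, and after a restart at \<open>p\<close> inside the
  run too many nodes would be left, because \<open>Suc n < p\<close>.\<close>

lemma strip_rim_run:
  assumes "strip_rim p c (replicate (Suc n) w @ rest) ! n = w - 1" "first_part rest < w" "2 \<le> w"
    "Suc n < p" "0 < c" "c \<le> p"
  shows "c = Suc n"
  using assms
proof (induction n arbitrary: c)
  case 0
  then have "w - min c (w + 1 - max 1 (first_part rest)) = w - 1" by (simp add: row_cut_def)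
  moreover have "2 \<le> w + 1 - max 1 (first_part rest)" using 0 by auto
  ultimately show ?case using 0 by (auto simp: min_def split: if_splits)
next
  case (Suc n)
  let ?xs = "replicate (Suc n) w @ rest"
  have cut: "row_cut c w ?xs = 1" using Suc.prems by (auto simp: row_cut_def)
  have "next_state p c w ?xs = Suc n"
  proof (rule Suc.IH)
    show "strip_rim p (next_state p c w ?xs) ?xs ! n = w - 1"
      using Suc.prems(1) by simp
  qed (use Suc.prems in \<open>auto simp: next_state_pos next_state_le\<close>)
  then show ?case using cut Suc.prems by (auto simp: next_state_def split: if_splits)
qed

lemma strip_rim_less:
  assumes "is_partition xs" "i < length xs" "0 < c" "0 < p"
  shows "strip_rim p c xs ! i < xs ! i"
  using assms
proof (induction xs arbitrary: c i)
  case (Cons x xs)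
  have "0 < row_cut c x xs" "0 < x" using Cons.prems by (auto simp: row_cut_pos is_partition_Cons)
  then show ?case
    using Cons.IH[of "i - 1" "next_state p c x xs"] Cons.prems
    by (cases i) (auto simp: is_partition_Cons next_state_pos)
qed simp

lemma strip_rim_ge_next:
  assumes "is_partition xs" "Suc i < length xs"
  shows "xs ! Suc i \<le> strip_rim p c xs ! i + 1"
  using assms
proof (induction xs arbitrary: c i)
  case (Cons x xs)
  show ?case
  proof (cases i)
    case 0
    then obtain y ys where "xs = y # ys" using Cons.prems by (cases xs) auto
    then show ?thesis using 0 strip_rim_hd_ge[of x y ys c] Cons.prems by simp
  next
    case (Suc j)
    then show ?thesis using Cons by (simp add: is_partition_Cons)
  qed
qed simp

text \<open>Suppose \<open>p\<close> stripped rows have the same length \<open>v > 0\<close>.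
  Stripped rows interlace with the original ones, so the lower \<open>p - 1\<close> of these rows
  had length \<open>v + 1\<close>, and by regularity the row above them was longer and the row below
  shorter. \<open>strip_rim_run\<close> forces the state \<open>p - 1\<close> after the top row,
  that is, a cut of at most one node there; but its cut was at least 2.\<close>

lemma strip_rim_regular:
  assumes "p_regular p xs" "2 \<le> p" "0 < c" "c \<le> p"
    "i + (p - 1) < length xs" "0 < strip_rim p c xs ! (i + (p - 1))"
  shows "strip_rim p c xs ! (i + (p - 1)) < strip_rim p c xs ! i"
  using assms
proof (induction xs arbitrary: c i)
  case (Cons x xs)
  have part: "is_partition (x # xs)" using Cons.prems(1) by (simp add: p_regular_def)
  let ?ys = "strip_rim p c (x # xs)"
  let ?c = "next_state p c x xs"
  have c: "0 < ?c" "?c \<le> p" using Cons.prems by (auto simp: next_state_pos next_state_le)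
  show ?case
  proof (cases i)
    case (Suc j)
    then show ?thesis using Cons.IH[of ?c j] Cons.prems c p_regular_Cons[of p x xs] by auto
  next
    case 0
    show ?thesis
    proof (rule ccontr)
      assume neg: "\<not> ?thesis"
      define v where "v = ?ys ! 0"
      have len: "p - 1 < length (x # xs)" using Cons.prems 0 by simp
      have srt: "sorted_wrt (\<ge>) ?ys" by (rule strip_rim_sorted[OF part]) (use Cons.prems in auto)
      have eq: "?ys ! j = v" if "j \<le> p - 1" for j
        using neg 0 sorted_wrt_ge_nth[OF srt, of 0 j] sorted_wrt_ge_nth[OF srt, of j "p - 1"] that len
        by (simp add: v_def)
      have v: "0 < v" using eq[of "p - 1"] Cons.prems 0 by simp
      have xsj: "xs ! j = v + 1" if "j < p - 1" for j
      proof -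
        have "?ys ! Suc j < (x # xs) ! Suc j"
          by (rule strip_rim_less) (use part that len Cons.prems in auto)
        moreover have "(x # xs) ! Suc j \<le> ?ys ! j + 1"
          by (rule strip_rim_ge_next) (use part that len in auto)
        ultimately show ?thesis using eq[of j] eq[of "Suc j"] that by simp
      qed
      define rest where "rest = drop (p - 1) xs"
      have "take (p - 1) xs = replicate (p - 1) (v + 1)"
        by (rule nth_equalityI) (use len xsj in auto)
      then have xs: "xs = replicate (Suc (p - 2)) (v + 1) @ rest"
        using append_take_drop_id[of "p - 1" xs] Cons.prems(2)
        by (simp add: rest_def numeral_2_eq_2 Suc_diff_Suc del: append_take_drop_id replicate_Suc)
      have reg: "(x # xs) ! (i + (p - 1)) < (x # xs) ! i" if "i + (p - 1) < length (x # xs)" for i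
        using Cons.prems that by (simp add: p_regular_iff)
      have "first_part rest < v + 1"
      proof (cases rest)
        case (Cons z zs)
        then have l: "p - 1 < length xs"
          unfolding rest_def by (metis drop_all list.distinct(1) not_le)
        then have "xs ! (p - 1) = z"
          using Cons by (metis rest_def hd_drop_conv_nth list.sel(1))
        then show ?thesis using reg[of 1] xsj[of 0] l \<open>2 \<le> p\<close> Cons by simp
      qed simp
      moreover have "strip_rim p ?c xs ! (p - 2) = v"
        using eq[of "Suc (p - 2)"] Cons.prems(2) by simp
      ultimately have "?c = Suc (p - 2)"
        using strip_rim_run[of p ?c "p - 2" "v + 1" rest] xs c v Cons.prems(2) by simp
      moreover have "v + 1 < x" using reg[of 0] len xsj[of "p - 2"] Cons.prems(2)
        by (auto simp: nth_Cons' numeral_2_eq_2 split: if_splits)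
      then have "2 \<le> row_cut c x xs" using eq[of 0] by simp
      ultimately show False using Cons.prems by (auto simp: next_state_def split: if_splits)
    qed
  qed
qed simp

lemma filter_pos_eq_take:
  "sorted_wrt (\<ge>) xs \<Longrightarrow> filter (\<lambda>l. 0 < l) xs = take (length (filter (\<lambda>l. 0 < l) xs)) (xs :: nat list)"
proof (induction xs)
  case (Cons x xs)
  then show ?case by (cases "x = 0") (auto simp: filter_empty_conv)
qed simp

lemma filter_pos_append_zeros:
  "sorted_wrt (\<ge>) xs \<Longrightarrow>
    filter (\<lambda>l. 0 < l) xs @ replicate (length (filter (\<lambda>l. l = 0) xs)) 0 = (xs :: nat list)"
proof (induction xs)
  case (Cons x xs)
  show ?case
  proof (cases "x = 0")
    case True
    then have z: "\<forall>y\<in>set xs. y = 0" using Cons.prems by auto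
    then have "filter (\<lambda>l. 0 < l) xs = []" "filter (\<lambda>l. l = 0) xs = xs"
      by (auto simp: filter_empty_conv filter_id_conv)
    then show ?thesis using True z by (simp add: replicate_length_same)
  qed (use Cons in auto)
qed simp

lemma p_regular_remove_p_rim:
  assumes "p_regular p lam" "2 \<le> p"
  shows "p_regular p (remove_p_rim p lam)"
proof -
  let ?ys = "strip_rim p p lam"
  have part: "is_partition lam" using assms by (simp add: p_regular_def)
  have srt: "sorted_wrt (\<ge>) ?ys" using strip_rim_sorted part assms by simp
  define n where "n = length (filter (\<lambda>l. 0 < l) ?ys)"
  have n: "n \<le> length lam" unfolding n_def by (metis length_filter_le length_strip_rim)
  have eq: "remove_p_rim p lam = take n ?ys"
    unfolding n_def using filter_pos_eq_take[OF srt] assms part by (simp add: remove_p_rim_eq)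
  have "?ys ! (i + (p - 1)) < ?ys ! i" if "i + (p - 1) < n" for i
  proof (rule strip_rim_regular)
    have "take n ?ys ! (i + (p - 1)) \<in> set (filter (\<lambda>l. 0 < l) ?ys)"
      unfolding n_def using filter_pos_eq_take[OF srt] that n
      by (metis n_def nth_mem)
    then show "0 < ?ys ! (i + (p - 1))" using that by simp
  qed (use assms that n in auto)
  then show ?thesis
    using assms part n eq is_partition_remove_p_rim[OF part, of p] by (simp add: p_regular_iff)
qed

text \<open>The counterpart of \<open>strip_rim_run\<close> for rows of length 1, where the end of
  the diagram replaces the longer last row.\<close>

lemma final_state_ones:
  assumes "final_state p c (replicate (Suc n) 1) = p" "Suc n < p" "0 < c" "c \<le> p"
  shows "c = Suc n"
  using assms
proof (induction n arbitrary: c)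
  case 0
  then show ?case by (auto simp: next_state_def row_cut_def split: if_splits)
next
  case (Suc n)
  let ?xs = "replicate (Suc n) (1 :: nat)"
  have cut: "row_cut c 1 ?xs = 1" using Suc.prems by (auto simp: row_cut_def)
  have "next_state p c 1 ?xs = Suc n"
    by (rule Suc.IH) (use Suc.prems in \<open>auto simp: next_state_pos next_state_le\<close>)
  then show ?case using cut Suc.prems by (auto simp: next_state_def split: if_splits)
qed

text \<open>An incomplete last segment takes every rim node of the last row, and there the rim is
  the whole row.\<close>

lemma last_strip_rim:
  "final_state p c xs \<noteq> p \<Longrightarrow> xs \<noteq> [] \<Longrightarrow> last (strip_rim p c xs) = 0"
proof (induction xs arbitrary: c)
  case (Cons x xs)
  show ?case
  proof (cases "xs = []")
    case True
    then show ?thesis using Cons.prems by (auto simp: next_state_def row_cut_def split: if_splits)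
  next
    case False
    then have "strip_rim p (next_state p c x xs) xs \<noteq> []" by (metis length_0_conv length_strip_rim)
    then show ?thesis using Cons False by simp
  qed
qed simp

text \<open>Below a vanishing row all rows have length 1, and regularity allows at most
  \<open>p - 1\<close> of these. Together with \<open>last_strip_rim\<close>, the number of
  vanishing rows lies in \<open>0..p-1\<close> if the last segment is full and in
  \<open>1..p\<close> otherwise; either way its residue determines it.\<close>

lemma strip_rim_zeros:
  assumes "p_regular p xs" "2 \<le> p" "0 < c" "c \<le> p"
  shows "length (filter (\<lambda>l. l = 0) (strip_rim p c xs)) \<le> p \<and>
    (final_state p c xs = p \<longrightarrow> length (filter (\<lambda>l. l = 0) (strip_rim p c xs)) < p)"
  using assms
proof (induction xs arbitrary: c)
  case (Cons x xs)
  have part: "is_partition (x # xs)" using Cons.prems(1) by (simp add: p_regular_def)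
  let ?c = "next_state p c x xs"
  have c: "0 < ?c" "?c \<le> p" using Cons.prems by (auto simp: next_state_pos next_state_le)
  show ?case
  proof (cases "x - row_cut c x xs = 0")
    case False
    then show ?thesis using Cons.IH[of ?c] Cons.prems c p_regular_Cons[of p x xs] by auto
  next
    case True
    have le: "row_cut c x xs \<le> x" using part by (simp add: row_cut_le is_partition_Cons)
    have one: "y = 1" if y: "y \<in> set xs" for y
    proof -
      obtain z zs where xs: "xs = z # zs" using y by (cases xs) auto
      have "y \<le> z" using y part xs by (auto simp: is_partition_def)
      moreover have "z \<le> 1" using strip_rim_hd_ge[of x z zs c] True part xs by simp
      moreover have "0 < y" using y part by (auto simp: is_partition_def)
      ultimately show ?thesis by simp
    qed
    define n where "n = length xs"
    have xs: "xs = replicate n 1" unfolding n_def using one by (simp add: replicate_length_same)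
    have reg: "(x # xs) ! (i + (p - 1)) < (x # xs) ! i" if "i + (p - 1) < length (x # xs)" for i
      using Cons.prems that by (simp add: p_regular_iff)
    have n: "n < p"
    proof (rule ccontr)
      assume "\<not> n < p"
      then have "0 < length xs" "p - 1 < length xs" using Cons.prems(2) unfolding n_def by linarith+
      then have "xs ! 0 \<in> set xs" "xs ! (p - 1) \<in> set xs" "p - 1 < length xs"
        by simp_all
      then have "xs ! 0 = 1" "xs ! (p - 1) = 1" "p - 1 < length xs" using one by blast+
      then show False using reg[of 1] by simp
    qed
    have "length (filter (\<lambda>l. l = 0) (strip_rim p c (x # xs))) \<le> length (strip_rim p c (x # xs))"
      by (rule length_filter_le)
    then have z: "length (filter (\<lambda>l. l = 0) (strip_rim p c (x # xs))) \<le> Suc n"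
      by (simp only: length_strip_rim n_def length_Cons)
    moreover have False if "Suc n = p" "final_state p c (x # xs) = p"
    proof -
      have "final_state p ?c (replicate (Suc (p - 2)) 1) = p"
      proof -
        have "Suc (p - 2) = n" using that(1) Cons.prems(2) by simp
        then show ?thesis using that(2) xs by simp
      qed
      then have "?c = Suc (p - 2)" by (rule final_state_ones) (use c Cons.prems in auto)
      moreover have "1 < x" using reg[of 0] that one[of "xs ! (p - 2)"] Cons.prems(2)
        by (auto simp: nth_Cons' n_def numeral_2_eq_2 split: if_splits)
      then have "2 \<le> row_cut c x xs" using True le by simp
      ultimately show False using Cons.prems by (auto simp: next_state_def split: if_splits)
    qed
    ultimately show ?thesis using n by fastforce
  qed
qed simp


section \<open>The residue symbol and its injectivity\<close>

definition symbol_column :: "nat \<Rightarrow> nat list \<Rightarrow> int \<times> int" where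
  "symbol_column p lam =
     ((int (length (p_rim p lam)) - int (length lam)) mod int p, (1 - int (length lam)) mod int p)"

lemma p_rim_nonempty:
  assumes "is_partition lam" "lam \<noteq> []" "0 < p"
  shows "0 < length (p_rim p lam)"
proof -
  obtain x xs where lam: "lam = x # xs" using assms(2) by (cases lam) auto
  have "0 < row_cut p x xs" using assms lam by (simp add: row_cut_pos)
  then show ?thesis
    using assms p_rim_state_Cons[of x xs p p 1] unfolding lam by (simp add: p_rim_eq)
qed

lemma ex_peel_Nil:
  assumes "is_partition lam" "0 < p"
  shows "\<exists>m. (remove_p_rim p ^^ m) lam = []"
  using assms
proof (induction "sum_list lam" arbitrary: lam rule: less_induct)
  case less
  show ?case
  proof (cases "lam = []")
    case True
    then show ?thesis by (intro exI[of _ 0]) simp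
  next
    case False
    have "sum_list (remove_p_rim p lam) < sum_list lam"
      using sum_remove_p_rim[OF less.prems] p_rim_nonempty[OF less.prems(1) False less.prems(2)] by linarith
    then obtain m where "(remove_p_rim p ^^ m) (remove_p_rim p lam) = []"
      using less.hyps less.prems is_partition_remove_p_rim by blast
    then show ?thesis by (intro exI[of _ "Suc m"]) (simp only: funpow_Suc_right o_apply)
  qed
qed

lemma symbol_length_Nil: "symbol_length p [] = 0"
  unfolding symbol_length_def peel_def by (rule Least_eq_0) simp

lemma symbol_length_step:
  assumes "is_partition lam" "lam \<noteq> []" "0 < p"
  shows "symbol_length p lam = Suc (symbol_length p (remove_p_rim p lam))"
proof -
  obtain m where "(remove_p_rim p ^^ m) lam = []" using ex_peel_Nil assms by blast
  then have "(LEAST m. (remove_p_rim p ^^ m) lam = []) =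
      Suc (LEAST m. (remove_p_rim p ^^ Suc m) lam = [])"
    by (rule Least_Suc) (use assms in simp)
  then show ?thesis by (simp add: symbol_length_def peel_def funpow_swap1)
qed

lemma residue_symbol_Nil: "residue_symbol p [] = []"
  by (simp add: residue_symbol_def symbol_length_Nil)

text \<open>Columns are numbered from the innermost partition outwards, so the last one belongs to
  \<open>lam\<close> itself.\<close>

lemma residue_symbol_step:
  assumes "is_partition lam" "lam \<noteq> []" "0 < p"
  shows "residue_symbol p lam = residue_symbol p (remove_p_rim p lam) @ [symbol_column p lam]"
proof -
  define m where "m = symbol_length p (remove_p_rim p lam)"
  have m: "symbol_length p lam = Suc m" using symbol_length_step[OF assms] by (simp add: m_def)
  have upt: "[1..<Suc m + 1] = [1..<m + 1] @ [Suc m]" by (simp add: upt_Suc)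
  have peel: "peel p lam (Suc m + 1 - j) = peel p (remove_p_rim p lam) (m + 1 - j)"
    if "j \<in> set [1..<m + 1]" for j
  proof -
    have "Suc m + 1 - j - 1 = Suc (m + 1 - j - 1)" using that by auto
    then show ?thesis unfolding peel_def by (simp only: funpow_Suc_right o_apply)
  qed
  show ?thesis
    unfolding residue_symbol_def m m_def[symmetric] Let_def upt map_append
    by (intro arg_cong2[where f = append] map_cong)
      (use peel in \<open>auto simp: symbol_column_def peel_def\<close>)
qed

lemma residue_symbol_eq_Nil_iff: "is_partition lam \<Longrightarrow> 0 < p \<Longrightarrow> residue_symbol p lam = [] \<longleftrightarrow> lam = []"
  using residue_symbol_step by (cases "lam = []") (auto simp: residue_symbol_Nil)

lemma cong_less_imp_eq: "[int a = int b] (mod int p) \<Longrightarrow> a \<le> b \<Longrightarrow> b < a + p \<Longrightarrow> a = b"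
proof -
  assume "[int a = int b] (mod int p)" "a \<le> b" "b < a + p"
  then have "int p dvd int b - int a" by (simp add: cong_iff_dvd_diff dvd_diff_commute)
  then show ?thesis
    using zdvd_imp_le[of "int p" "int b - int a"] \<open>a \<le> b\<close> \<open>b < a + p\<close> by fastforce
qed

text \<open>The column gives the \<open>p\<close>-rim length and the number of rows modulo
  \<open>p\<close>. The former fixes \<open>final_state\<close>, which lies between 1 and
  \<open>p\<close>; then the latter fixes the number of rows that vanished. Once these are restored
  as zeros, the stripped rows agree and \<open>strip_rim_inj\<close> applies.\<close>

lemma residue_symbol_step_inj:
  assumes "p_regular p lam" "p_regular p mu" "2 \<le> p" "lam \<noteq> []" "mu \<noteq> []"
    "remove_p_rim p lam = remove_p_rim p mu" "symbol_column p lam = symbol_column p mu"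
  shows "lam = mu"
proof -
  have part: "is_partition lam" "is_partition mu" using assms by (auto simp: p_regular_def)
  let ?z = "\<lambda>nu. length (filter (\<lambda>l. l = 0) (strip_rim p p nu))"
  let ?a = "\<lambda>nu. length (p_rim p nu)"
  have r: "length nu = length (remove_p_rim p nu) + ?z nu" if "is_partition nu" for nu
    using sum_length_filter_compl[of "\<lambda>l. 0 < l" "strip_rim p p nu"] that assms
    by (simp add: remove_p_rim_eq)
  have a: "[int (final_state p p nu) = - int (?a nu)] (mod int p)" if "is_partition nu" for nu
  proof -
    have "int (?a nu) + int (sum_list (strip_rim p p nu)) = int (sum_list nu)"
      using length_p_rim[OF that, of p] assms(3) by linarith
    then have "[int (final_state p p nu) = int p - int (?a nu)] (mod int p)"
      using final_state_cong[OF that, of p p] by (smt (verit, best))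
    then show ?thesis by (simp add: cong_def)
  qed
  have f: "0 < final_state p p nu \<and> final_state p p nu \<le> p" for nu
    using final_state_bounds[of p p nu] assms(3) by simp
  have col: "[int (?a lam) - int (length lam) = int (?a mu) - int (length mu)] (mod int p)"
    "[1 - int (length lam) = 1 - int (length mu)] (mod int p)"
    using assms(7) by (auto simp: symbol_column_def cong_def)
  have len: "[int (length lam) = int (length mu)] (mod int p)"
    using cong_diff[OF cong_refl[of 1] col(2)] by simp
  have "[int (?a lam) = int (?a mu)] (mod int p)"
    using cong_add[OF col(1) len] by simp
  then have "[int (final_state p p lam) = int (final_state p p mu)] (mod int p)"
    using a[OF part(1)] a[OF part(2)] by (meson cong_minus_minus_iff cong_sym cong_trans)
  then have fin: "final_state p p lam = final_state p p mu"
    using f[of lam] f[of mu] cong_less_imp_eq[of "final_state p p lam" "final_state p p mu" p]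
      cong_less_imp_eq[of "final_state p p mu" "final_state p p lam" p]
    by (metis add.commute cong_sym le_cases le_neq_implies_less less_add_same_cancel1 order_le_less_trans order_less_le_trans trans_less_add2)
  have zpos: "0 < ?z nu" if "final_state p p nu \<noteq> p" "nu \<noteq> []" for nu
  proof -
    have "last (strip_rim p p nu) = 0" using last_strip_rim that by blast
    moreover have "strip_rim p p nu \<noteq> []" using that by (metis length_0_conv length_strip_rim)
    ultimately show ?thesis by (metis (mono_tags, lifting) filter_empty_conv last_in_set length_greater_0_conv)
  qed
  have zle: "?z nu \<le> p \<and> (final_state p p nu = p \<longrightarrow> ?z nu < p)" if "p_regular p nu" for nu
    using strip_rim_zeros[OF that assms(3), of p] assms(3) by simp
  have "[int (?z lam) = int (?z mu)] (mod int p)"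
    using cong_diff[OF len cong_refl[of "int (length (remove_p_rim p lam))"]] r part assms(6) by simp
  then have "?z lam = ?z mu"
    using cong_less_imp_eq[of "?z lam" "?z mu" p] cong_less_imp_eq[of "?z mu" "?z lam" p]
      zle[OF assms(1)] zle[OF assms(2)] zpos[of lam] zpos[of mu] fin assms(4,5)
    by (smt (verit) cong_sym nle_le add_gr_0 le_add2 le_neq_implies_less less_add_same_cancel2 order_le_less_trans)
  then have len_eq: "length lam = length mu" using r part assms(6) by simp
  have dec: "strip_rim p p nu = remove_p_rim p nu @ replicate (?z nu) 0" if "is_partition nu" for nu
  proof -
    have "sorted_wrt (\<ge>) (strip_rim p p nu)" using strip_rim_sorted that assms(3) by simp
    from filter_pos_append_zeros[OF this] show ?thesis
      using that assms(3) by (simp add: remove_p_rim_eq)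
  qed
  have "strip_rim p p lam = strip_rim p p mu"
    using dec part assms(6) \<open>?z lam = ?z mu\<close> by metis
  then show ?thesis using strip_rim_inj[OF part len_eq, of p] fin assms(3) by simp
qed

lemma residue_symbol_inj:
  assumes "p_regular p lam" "p_regular p mu" "2 \<le> p" "residue_symbol p lam = residue_symbol p mu"
  shows "lam = mu"
  using assms
proof (induction "residue_symbol p lam" arbitrary: lam mu rule: rev_induct)
  case Nil
  then have "is_partition lam" "is_partition mu" "0 < p" by (auto simp: p_regular_def)
  then show ?case using Nil residue_symbol_eq_Nil_iff by metis
next
  case (snoc c R)
  have part: "is_partition lam" "is_partition mu" "0 < p" using snoc.prems by (auto simp: p_regular_def)
  then have ne: "lam \<noteq> []" "mu \<noteq> []" using snoc.hyps(2) snoc.prems(4) by (auto simp: residue_symbol_Nil)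
  have "residue_symbol p (remove_p_rim p lam) = R" "symbol_column p lam = c"
    using residue_symbol_step[OF part(1) ne(1) part(3)] snoc.hyps(2) by auto
  moreover have "residue_symbol p (remove_p_rim p mu) = R" "symbol_column p mu = c"
    using residue_symbol_step[OF part(2) ne(2) part(3)] snoc.hyps(2) snoc.prems(4) by auto
  ultimately show ?case
    using snoc.hyps(1)[of "remove_p_rim p lam" "remove_p_rim p mu"] snoc.prems ne
    by (intro residue_symbol_step_inj[of p lam mu]) (auto simp: p_regular_remove_p_rim)
qed

lemma symbol_truncation_length:
  assumes "p_regular p lam" "2 \<le> p"
  shows "symbol_truncation p lam (length (residue_symbol p lam)) = lam"
  unfolding symbol_truncation_def
  by (rule the_equality) (use assms residue_symbol_inj in auto)

lemma symbol_truncation_remove_p_rim: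
  assumes "is_partition lam" "lam \<noteq> []" "0 < p" "j \<le> length (residue_symbol p (remove_p_rim p lam))"
  shows "symbol_truncation p lam j = symbol_truncation p (remove_p_rim p lam) j"
  using assms residue_symbol_step[OF assms(1-3)] by (simp add: symbol_truncation_def)

section \<open>Blocks of a JS-partition\<close>

fun js_blocks :: "nat \<Rightarrow> (nat \<times> nat) list \<Rightarrow> bool" where
  "js_blocks p [] = True"
| "js_blocks p [(l, a)] = (0 < l \<and> 0 < a \<and> a < p)"
| "js_blocks p ((l, a) # (m, b) # bs) =
     (0 < a \<and> a < p \<and> m < l \<and> p dvd l + a + b - m \<and> js_blocks p ((m, b) # bs))"

text \<open>Peeling may leave blocks of height or width 0; the JS congruence makes sense for them too.\<close>

fun weak_blocks :: "nat \<Rightarrow> (nat \<times> nat) list \<Rightarrow> bool" where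
  "weak_blocks p [] = True"
| "weak_blocks p [(l, a)] = (a < p)"
| "weak_blocks p ((l, a) # (m, b) # bs) =
     (a < p \<and> m < l \<and> p dvd l + a + b - m \<and> weak_blocks p ((m, b) # bs))"

definition proper_blocks :: "(nat \<times> nat) list \<Rightarrow> (nat \<times> nat) list" where
  "proper_blocks = filter (\<lambda>(l, a). 0 < l \<and> 0 < a)"

lemma proper_blocks_simps [simp]:
  "proper_blocks [] = []"
  "proper_blocks ((l, a) # bs) = (if 0 < l \<and> 0 < a then (l, a) # proper_blocks bs else proper_blocks bs)"
  by (auto simp: proper_blocks_def)

text \<open>A segment entering at the top of \<open>(l, a)\<close> takes one node from each of the
  first \<open>a - 1\<close> rows. If it ends in the last row, that row keeps
  \<open>l + a - p - 1\<close> nodes and becomes a block of height 1. In the joined case the last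
  row shrinks to \<open>m - 1\<close>, as do all rows of the next block, hence the height
  \<open>b + 1\<close>. A short last block loses its bottom row.\<close>

fun peel_blocks :: "nat \<Rightarrow> (nat \<times> nat) list \<Rightarrow> (nat \<times> nat) list" where
  "peel_blocks p [] = []"
| "peel_blocks p [(l, a)] =
     (if l + a \<le> p then [(l - 1, a - 1)] else [(l - 1, a - 1), (l + a - p - 1, 1)])"
| "peel_blocks p ((l, a) # (m, b) # bs) =
     (if l + a + b = p + m then (l - 1, a - 1) # (m - 1, b + 1) # peel_blocks p bs
      else (l - 1, a - 1) # (l + a - p - 1, 1) # peel_blocks p ((m, b) # bs))"

fun full_segments :: "nat \<Rightarrow> (nat \<times> nat) list \<Rightarrow> nat" where
  "full_segments p [] = 0"
| "full_segments p [(l, a)] = (if l + a \<le> p then 0 else 1)"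
| "full_segments p ((l, a) # (m, b) # bs) =
     (if l + a + b = p + m then Suc (full_segments p bs) else Suc (full_segments p ((m, b) # bs)))"

fun short_segment :: "nat \<Rightarrow> (nat \<times> nat) list \<Rightarrow> nat" where
  "short_segment p [] = 0"
| "short_segment p [(l, a)] = (if l + a \<le> p then l + a - 1 else 0)"
| "short_segment p ((l, a) # (m, b) # bs) =
     (if l + a + b = p + m then short_segment p bs else short_segment p ((m, b) # bs))"

text \<open>Only rows of the last segment can vanish: the bottom row of a short block (or all rows
  if \<open>l = 1\<close>), a row of which nothing is left over when \<open>l + a = p + 1\<close>,
  or the \<open>b + 1\<close> rows of length \<open>m - 1 = 0\<close> in the joined case.\<close>

fun lost_rows :: "nat \<Rightarrow> (nat \<times> nat) list \<Rightarrow> nat" where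
  "lost_rows p [] = 0"
| "lost_rows p [(l, a)] = (if l + a \<le> p then (if l = 1 then a else 1) else if l + a = p + 1 then 1 else 0)"
| "lost_rows p ((l, a) # (m, b) # bs) =
     (if l + a + b = p + m then (if bs = [] then (if m = 1 then b + 1 else 0) else lost_rows p bs)
      else lost_rows p ((m, b) # bs))"

text \<open>This is \<open>d_step\<close> in terms of the reduced quantities \<open>t'\<close>, \<open>t\<close> and \<open>s\<close>.\<close>

definition segment_gain :: "nat \<Rightarrow> nat \<Rightarrow> nat \<Rightarrow> nat \<Rightarrow> nat" where
  "segment_gain p t' t s =
     (if t' \<noteq> 0 \<and> t \<noteq> 0 then (t' + 2 * s) div p
      else if t' \<noteq> 0 then (t' + s + p) div p
      else (p - 1 + s - t) div p)"

text \<open>The number \<open>l + a + b - m\<close> is a positive multiple of \<open>p\<close>. If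
  it is \<open>p\<close>, one segment covers both blocks; if it is larger, the segment ends in the
  upper block.\<close>

lemma link_cases:
  fixes l a b m p :: nat
  assumes "p dvd l + a + b - m" "m < l"
  obtains "l + a + b = p + m" | "2 * p + m \<le> l + a + b"
proof -
  obtain k where k: "l + a + b - m = p * k" using assms by auto
  then have "k \<noteq> 0" using assms by (intro notI) simp
  then consider "k = 1" | "2 \<le> k" by linarith
  then show ?thesis
  proof cases
    case 1
    then show ?thesis using k assms that(1) by auto
  next
    case 2
    then have "p * 2 \<le> p * k" by (rule mult_le_mono2)
    then show ?thesis using k assms that(2) by linarith
  qed
qed

lemma js_blocks_hd: "js_blocks p ((l, a) # bs) \<Longrightarrow> 0 < l \<and> 0 < a \<and> a < p"
  by (cases bs rule: list.exhaust) auto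

lemma js_blocks_tl: "js_blocks p (x # bs) \<Longrightarrow> js_blocks p bs"
  by (cases x; cases bs) auto

text \<open>The congruences above and below a block of height 0 add up to the one between its
  neighbours.\<close>

lemma weak_blocks_skip:
  assumes "weak_blocks p (x # (m, 0) # bs)"
  shows "weak_blocks p (x # bs)"
proof -
  obtain l a where x: "x = (l, a)" by (cases x)
  show ?thesis
  proof (cases bs)
    case Nil
    then show ?thesis using assms x by simp
  next
    case (Cons y ys)
    obtain n b where y: "y = (n, b)" by (cases y)
    have "p dvd (l + a - m) + (m + b - n)" using assms by (intro dvd_add) (auto simp: x y Cons)
    moreover have "(l + a - m) + (m + b - n) = l + a + b - n" using assms by (auto simp: x y Cons)
    ultimately show ?thesis using assms by (auto simp: x y Cons)
  qed
qed

text \<open>Blocks of height 0 are skipped; a block of width 0 can only be the last one, since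
  widths decrease strictly.\<close>

lemma js_proper_blocks_Cons: "weak_blocks p (x # bs) \<Longrightarrow> js_blocks p (proper_blocks (x # bs))"
proof (induction bs arbitrary: x)
  case Nil
  then show ?case by (cases x) auto
next
  case (Cons y bs)
  obtain l a where x: "x = (l, a)" by (cases x)
  obtain m b where y: "y = (m, b)" by (cases y)
  consider "b = 0" | "m = 0" "0 < b" | "0 < m" "0 < b" by auto
  then show ?case
  proof cases
    case 1
    then have "js_blocks p (proper_blocks (x # bs))"
      using Cons.IH[of x] weak_blocks_skip[of p x m bs] Cons.prems y by simp
    then show ?thesis using 1 x y by (auto split: if_splits)
  next
    case 2
    then have "bs = []" using Cons.prems x y by (cases bs) auto
    then show ?thesis using 2 Cons.prems x y by auto
  next
    case 3
    then show ?thesis using Cons.IH[of y] Cons.prems x y by auto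
  qed
qed

lemma js_proper_blocks: "weak_blocks p bs \<Longrightarrow> js_blocks p (proper_blocks bs)"
  by (cases bs) (use js_proper_blocks_Cons in auto)

lemma peel_blocks_Cons: "\<exists>R. peel_blocks p ((l, a) # bs) = (l - 1, a - 1) # R"
  by (cases bs rule: list.exhaust) auto

lemma dvd_link_peel:
  fixes l a b m p :: nat
  shows "p dvd l + a + b - m \<Longrightarrow> 2 * p + m \<le> l + a + b \<Longrightarrow> p dvd l + a + b - p - m"
  using dvd_diff_nat[of p "l + a + b - m" p] by (simp add: add.commute)

lemma weak_blocks_Cons:
  "weak_blocks p ((l, a) # bs) \<longleftrightarrow> a < p \<and> weak_blocks p bs \<and>
    (bs \<noteq> [] \<longrightarrow> fst (hd bs) < l \<and> p dvd l + a + snd (hd bs) - fst (hd bs))"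
  by (cases bs) auto

text \<open>The two blocks left by a full segment are linked by exactly \<open>p\<close>. The link
  to the next segment is the old one, reduced by \<open>p\<close> if the segment stayed inside one
  block.\<close>

lemma weak_peel_blocks:
  assumes "js_blocks p bs" "2 \<le> p"
  shows "weak_blocks p (peel_blocks p bs)"
  using assms
proof (induction p bs rule: peel_blocks.induct)
  case (2 p l a)
  have "l - 1 + (a - 1) + 1 - (l + a - p - 1) = p" if "\<not> l + a \<le> p"
    using that "2.prems" by auto
  then show ?case using "2.prems" by auto
next
  case (3 p l a m b bs)
  have ml: "m < l" "p dvd l + a + b - m" and a: "0 < a" "a < p"
    and js: "js_blocks p ((m, b) # bs)" using "3.prems" by auto
  have m: "0 < m" "0 < b" "b < p" using js_blocks_hd[OF js] by auto
  from ml(2,1) show ?case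
  proof (cases rule: link_cases)
    case 1
    have IH: "weak_blocks p (peel_blocks p bs)"
      by (rule "3.IH"(1)) (use 1 js "3.prems" js_blocks_tl in auto)
    have b: "b + 1 < p" using 1 ml a by linarith
    have "weak_blocks p ((m - 1, b + 1) # peel_blocks p bs)"
    proof (cases bs)
      case Nil
      then show ?thesis using b by simp
    next
      case (Cons y ys)
      obtain n c where y: "y = (n, c)" by (cases y)
      obtain R where R: "peel_blocks p bs = (n - 1, c - 1) # R" using peel_blocks_Cons Cons y by metis
      have nm: "n < m" "p dvd m + b + c - n" using js Cons y by auto
      have "0 < n" "0 < c" using js_blocks_hd[of p n c ys] js_blocks_tl[OF js] Cons y by auto
      moreover from this have "m - 1 + (b + 1) + (c - 1) - (n - 1) = m + b + c - n" using nm m by linarith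
      ultimately show ?thesis using IH b nm unfolding R by auto
    qed
    moreover have "l - 1 + (a - 1) + (b + 1) - (m - 1) = p" using 1 ml a m by linarith
    ultimately show ?thesis using 1 ml a m by auto
  next
    case 2
    have IH: "weak_blocks p (peel_blocks p ((m, b) # bs))"
      by (rule "3.IH"(2)) (use 2 js "3.prems" in auto)
    obtain R where R: "peel_blocks p ((m, b) # bs) = (m - 1, b - 1) # R" using peel_blocks_Cons by metis
    have "p dvd l + a - p - 1 + 1 + (b - 1) - (m - 1)"
    proof -
      have "l + a - p - 1 + 1 + (b - 1) - (m - 1) = l + a + b - p - m" using 2 m by linarith
      then show ?thesis using dvd_link_peel[OF ml(2) 2] by simp
    qed
    then have "weak_blocks p ((l + a - p - 1, 1) # (m - 1, b - 1) # R)"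
      using IH 2 m "3.prems"(2) unfolding R by auto
    moreover have "l - 1 + (a - 1) + 1 - (l + a - p - 1) = p" using 2 ml a m by linarith
    ultimately show ?thesis using 2 ml a m R by auto
  qed
qed simp

lemma js_peel_blocks: "js_blocks p bs \<Longrightarrow> 2 \<le> p \<Longrightarrow> js_blocks p (proper_blocks (peel_blocks p bs))"
  by (simp add: js_proper_blocks weak_peel_blocks)

section \<open>Row numbers and type under peeling\<close>

definition rows :: "(nat \<times> nat) list \<Rightarrow> nat" where
  "rows bs = sum_list (map snd bs)"

lemma rows_simps [simp]: "rows [] = 0" "rows ((l, a) # bs) = a + rows bs"
  by (auto simp: rows_def)

lemma rows_peel_blocks:
  assumes "js_blocks p bs" "2 \<le> p"
  shows "rows (proper_blocks (peel_blocks p bs)) + lost_rows p bs = rows bs"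
  using assms
proof (induction p bs rule: peel_blocks.induct)
  case (2 p l a)
  then show ?case by auto
next
  case (3 p l a m b bs)
  have ml: "m < l" "p dvd l + a + b - m" and a: "0 < a" "a < p"
    and js: "js_blocks p ((m, b) # bs)" using "3.prems" by auto
  have m: "0 < m" "0 < b" "b < p" using js_blocks_hd[OF js] by auto
  from ml(2,1) show ?case
  proof (cases rule: link_cases)
    case 1
    have IH: "rows (proper_blocks (peel_blocks p bs)) + lost_rows p bs = rows bs"
      by (rule "3.IH"(1)) (use 1 js "3.prems" js_blocks_tl in auto)
    have m1: "1 < m" if ne: "bs \<noteq> []"
    proof -
      obtain n c ys where "bs = (n, c) # ys" using ne by (cases bs) auto
      then have "n < m" "0 < n" using js js_blocks_hd[of p n c ys] js_blocks_tl[OF js] by auto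
      then show ?thesis by simp
    qed
    show ?thesis using 1 IH m1 ml a m by (cases bs) auto
  next
    case 2
    have IH: "rows (proper_blocks (peel_blocks p ((m, b) # bs))) + lost_rows p ((m, b) # bs) = rows ((m, b) # bs)"
      by (rule "3.IH"(2)) (use 2 js "3.prems" in auto)
    then show ?thesis using 2 ml a m by auto
  qed
qed simp

definition block_type :: "(nat \<times> nat) list \<Rightarrow> int" where
  "block_type bs = int (fst (hd bs)) - int (snd (hd bs))"

lemma block_type_tl:
  assumes "js_blocks p ((l, a) # (m, b) # bs)"
  shows "[block_type ((l, a) # (m, b) # bs) + 2 * int (rows ((l, a) # (m, b) # bs)) =
    block_type ((m, b) # bs) + 2 * int (rows ((m, b) # bs))] (mod int p)"
proof -
  have "int p dvd int (l + a + b - m)" using assms by (simp only: int_dvd_int_iff js_blocks.simps)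
  moreover have "int (l + a + b - m) = int l + int a + int b - int m" using assms by auto
  ultimately show ?thesis by (simp add: cong_iff_dvd_diff block_type_def algebra_simps)
qed

text \<open>
  Here \<open>sg\<close> stands for type plus twice the number of rows, which modulo \<open>p\<close> is the same for all
  tails of the block list.
\<close>

definition end_relation :: "nat \<Rightarrow> int \<Rightarrow> nat \<Rightarrow> nat \<Rightarrow> bool" where
  "end_relation p sg t s \<longleftrightarrow> s < p \<and> t < p \<and>
     (t = 0 \<and> (s = 0 \<or> [int s = sg] (mod int p)) \<or>
      t \<noteq> 0 \<and> [int t = sg - 1] (mod int p) \<and> (s = 1 \<or> s = t))"

lemma end_relation_cong:
  "[sg = sg'] (mod int p) \<Longrightarrow> end_relation p sg' t s \<Longrightarrow> end_relation p sg t s"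
proof -
  assume c: "[sg = sg'] (mod int p)" and r: "end_relation p sg' t s"
  have "[z = sg'] (mod int p) \<longleftrightarrow> [z = sg] (mod int p)" for z
    using c by (simp add: cong_def)
  moreover have "[sg - 1 = sg' - 1] (mod int p)" using c by (rule cong_diff) simp
  then have "[z = sg' - 1] (mod int p) \<longleftrightarrow> [z = sg - 1] (mod int p)" for z
    by (simp add: cong_def)
  ultimately show ?thesis using r by (simp add: end_relation_def)
qed

text \<open>By \<open>block_type_tl\<close> it suffices to look at the last segment. For one block
  \<open>sg\<close> is \<open>l + a\<close>: either \<open>t = l + a - 1\<close>, with one row lost
  or, if \<open>l = 1\<close>, all \<open>a = t\<close> rows; or \<open>t = 0\<close>, with a row
  lost only if \<open>l + a = p + 1\<close>. For a joined pair with \<open>m = 1\<close>,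
  \<open>sg\<close> is \<open>p + b + 1\<close> and \<open>b + 1\<close> rows are lost.\<close>

lemma end_relation_blocks:
  assumes "js_blocks p bs" "2 \<le> p" "bs \<noteq> []"
  shows "end_relation p (block_type bs + 2 * int (rows bs)) (short_segment p bs) (lost_rows p bs)"
  using assms
proof (induction p bs rule: peel_blocks.induct)
  case (2 p l a)
  have "[1 = int l + int a] (mod int p)" if "l + a = p + 1"
  proof -
    have "int l + int a = 1 + int p" using that by linarith
    then show ?thesis by (simp add: cong_def)
  qed
  then show ?case using "2.prems" by (auto simp: end_relation_def block_type_def add.commute)
next
  case (3 p l a m b bs)
  have ml: "m < l" "p dvd l + a + b - m" and a: "0 < a" "a < p"
    and js: "js_blocks p ((m, b) # bs)" using "3.prems" by auto
  have m: "0 < m" "0 < b" "b < p" using js_blocks_hd[OF js] by auto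
  note tl1 = block_type_tl[OF "3.prems"(1)]
  from ml(2,1) show ?case
  proof (cases rule: link_cases)
    case 1
    show ?thesis
    proof (cases bs)
      case Nil
      have b: "b + 1 < p" using 1 ml a by linarith
      have "[int b + 1 = int l + int a + 2 * int b] (mod int p)" if "m = 1"
      proof -
        have eq: "int l + int a + 2 * int b = int b + 1 + int p" using 1 that by linarith
        show ?thesis unfolding eq by (simp add: cong_def)
      qed
      then show ?thesis using Nil 1 b by (auto simp: end_relation_def block_type_def algebra_simps)
    next
      case (Cons y ys)
      obtain n c where y: "y = (n, c)" by (cases y)
      have IH: "end_relation p (block_type bs + 2 * int (rows bs)) (short_segment p bs) (lost_rows p bs)"
        by (rule "3.IH"(1)) (use 1 js "3.prems" js_blocks_tl Cons in auto)
      have "[block_type ((l, a) # (m, b) # bs) + 2 * int (rows ((l, a) # (m, b) # bs)) =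
          block_type bs + 2 * int (rows bs)] (mod int p)"
        unfolding Cons y
        by (rule cong_trans[OF tl1[unfolded Cons y] block_type_tl[OF js[unfolded Cons y]]])
      from end_relation_cong[OF this IH] show ?thesis using 1 Cons by simp
    qed
  next
    case 2
    have "end_relation p (block_type ((m, b) # bs) + 2 * int (rows ((m, b) # bs)))
      (short_segment p ((m, b) # bs)) (lost_rows p ((m, b) # bs))"
      by (rule "3.IH"(2)) (use 2 js "3.prems" in auto)
    from end_relation_cong[OF tl1 this] show ?thesis using 2 "3.prems"(2) by auto
  qed
qed simp

text \<open>A discarded leading block has height 0, and then the link congruence says that
  \<open>l\<close> is congruent to \<open>m - b\<close>, the type of the next block.\<close>

lemma block_type_proper:
  assumes "weak_blocks p bs" "proper_blocks bs \<noteq> []"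
  shows "[block_type (proper_blocks bs) = block_type bs] (mod int p)"
  using assms
proof (induction bs)
  case (Cons x bs)
  obtain l a where x: "x = (l, a)" by (cases x)
  show ?case
  proof (cases "0 < l \<and> 0 < a")
    case True
    then show ?thesis by (simp add: x block_type_def)
  next
    case False
    then have ne: "proper_blocks bs \<noteq> []" using Cons.prems x by auto
    then obtain m b ys where bs: "bs = (m, b) # ys" by (cases bs) auto
    have w: "weak_blocks p bs" "m < l" "p dvd l + a + b - m" using Cons.prems x bs by auto
    have "a = 0" using False w by auto
    have "int p dvd int (l + a + b - m)" using w(3) by (simp only: int_dvd_int_iff)
    moreover have "int (l + a + b - m) = int l + int b - int m" using w \<open>a = 0\<close> by auto
    ultimately have "[block_type bs = block_type (x # bs)] (mod int p)"
      by (simp add: cong_iff_dvd_diff block_type_def x bs \<open>a = 0\<close> dvd_diff_commute algebra_simps)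
    moreover have "proper_blocks (x # bs) = proper_blocks bs" using False x by auto
    ultimately show ?thesis using Cons.IH[OF w(1) ne] by (simp add: cong_def)
  qed
qed simp

lemma block_type_peel:
  assumes "js_blocks p bs" "2 \<le> p" "proper_blocks (peel_blocks p bs) \<noteq> []"
  shows "[block_type (proper_blocks (peel_blocks p bs)) = block_type bs] (mod int p)"
proof -
  obtain l a ys where bs: "bs = (l, a) # ys" using assms(3) by (cases bs) auto
  obtain R where R: "peel_blocks p bs = (l - 1, a - 1) # R" using peel_blocks_Cons bs by metis
  have "0 < l" "0 < a" using js_blocks_hd assms(1) bs by auto
  then have "block_type (peel_blocks p bs) = block_type bs" unfolding R by (simp add: bs block_type_def)
  then show ?thesis using block_type_proper[OF weak_peel_blocks[OF assms(1,2)] assms(3)] by simp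
qed

section \<open>Counting full segments\<close>

lemma div_eq_oneI: "p \<le> n \<Longrightarrow> n < 2 * p \<Longrightarrow> n div p = (1::nat)"
  by (simp add: div_nat_eqI)

text \<open>The six configurations of \<open>t'\<close>, \<open>t\<close> and \<open>s\<close> that
  the case analyses below produce.\<close>

lemma segment_gain_simps:
  assumes "2 \<le> p"
  shows "t < p \<Longrightarrow> segment_gain p t 0 0 = (if t = 0 then 0 else 1)"
    "s \<le> t \<Longrightarrow> 0 < t \<Longrightarrow> t < p \<Longrightarrow> segment_gain p 0 t s = 0"
    "0 < s \<Longrightarrow> s < p \<Longrightarrow> segment_gain p 0 0 s = 1"
    "0 < t \<Longrightarrow> t + s + 1 = p \<Longrightarrow> segment_gain p t 0 s = 1"
    "0 < t' \<Longrightarrow> t' + 2 < p \<Longrightarrow> 0 < t \<Longrightarrow> segment_gain p t' t 1 = 0"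
    "0 < t' \<Longrightarrow> t' + s = p \<Longrightarrow> 0 < t \<Longrightarrow> 0 < s \<Longrightarrow> segment_gain p t' t s = 1"
  using assms by (auto simp: segment_gain_def div_eq_oneI intro!: div_nat_eqI)

text \<open>The list \<open>cs\<close> is left free, because the induction needs the relation both
  for the peeled list and for its tail.\<close>

definition peel_count :: "nat \<Rightarrow> (nat \<times> nat) list \<Rightarrow> (nat \<times> nat) list \<Rightarrow> bool" where
  "peel_count p bs cs \<longleftrightarrow> full_segments p bs =
     full_segments p cs + segment_gain p (short_segment p cs) (short_segment p bs) (lost_rows p bs)"

text \<open>In the second claim the bounds on \<open>l\<close> and \<open>a\<close> make the first
  peeled block nonempty, so \<open>tl\<close> really drops a block.\<close>

lemma peel_count_single:
  assumes "js_blocks p [(l, a)]" "2 \<le> p"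
  shows "peel_count p [(l, a)] (proper_blocks (peel_blocks p [(l, a)]))"
    and "2 \<le> l \<Longrightarrow> 2 \<le> a \<Longrightarrow> peel_count p [(l, a)] (proper_blocks (tl (peel_blocks p [(l, a)])))"
proof -
  note g = segment_gain_simps[OF assms(2)]
  have la: "0 < l" "0 < a" "a < p" using assms by auto
  show "peel_count p [(l, a)] (proper_blocks (peel_blocks p [(l, a)]))"
  proof (cases "l + a \<le> p")
    case True
    show ?thesis
    proof (cases "l = 1 \<or> a = 1")
      case a1: True
      have "lost_rows p [(l, a)] \<le> l + a - 1" "0 < l + a - 1" "l + a - 1 < p" using True a1 la by auto
      from g(2)[OF this] show ?thesis using True a1 la by (auto simp: peel_count_def)
    next
      case a2: False
      have "0 < l - 1 + (a - 1) - 1" "l - 1 + (a - 1) - 1 + 2 < p" "0 < l + a - 1" using True a2 la by auto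
      from g(5)[OF this] show ?thesis using True a2 la by (simp add: peel_count_def)
    qed
  next
    case False
    consider "a = 1" "l = p" | "a = 1" "p < l" | "2 \<le> a" "l + a = p + 1" | "2 \<le> a" "p + 1 < l + a"
      using False la by linarith
    then show ?thesis
    proof cases
      case 1
      then show ?thesis using g(3)[of 1] assms(2) by (simp add: peel_count_def)
    next
      case 2
      then show ?thesis using g(1)[of "if l - p + 1 \<le> p then l - p else 0"] assms(2) by (auto simp: peel_count_def)
    next
      case 3
      then have "0 < l - 1 + (a - 1) - 1" "l - 1 + (a - 1) - 1 + 1 + 1 = p" using la by auto
      from g(4)[OF this] show ?thesis using 3 la by (simp add: peel_count_def)
    next
      case 4
      then show ?thesis using g(1)[of 0] assms(2) la by (auto simp: peel_count_def)
    qed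
  qed
  assume la2: "2 \<le> l" "2 \<le> a"
  consider "l + a \<le> p" | "l + a = p + 1" | "p + 1 < l + a" by linarith
  then show "peel_count p [(l, a)] (proper_blocks (tl (peel_blocks p [(l, a)])))"
  proof cases
    case 1
    then show ?thesis using g(2)[of 1 "l + a - 1"] la2 by (auto simp: peel_count_def)
  next
    case 2
    then show ?thesis using g(3)[of 1] la2 assms(2) by (auto simp: peel_count_def)
  next
    case 3
    then show ?thesis using g(1)[of "l + a - p - 1"] g(1)[of 0] la2 assms(2)
      by (auto simp: peel_count_def)
  qed
qed

lemma peel_count_pair:
  assumes "js_blocks p [(l, a), (m, b)]" "2 \<le> p" "l + a + b = p + m"
  shows "peel_count p [(l, a), (m, b)] (proper_blocks (peel_blocks p [(l, a), (m, b)]))"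
    and "2 \<le> a \<Longrightarrow> peel_count p [(l, a), (m, b)] (proper_blocks (tl (peel_blocks p [(l, a), (m, b)])))"
proof -
  note g = segment_gain_simps[OF assms(2)]
  have la: "m < l" "0 < a" "a < p" "0 < m" "0 < b" "b < p" using assms by auto
  have b: "b + 1 < p" using assms(3) la by linarith
  consider "m = 1" "a = 1" | "m = 1" "2 \<le> a" | "2 \<le> m" "a = 1" | "2 \<le> m" "2 \<le> a" using la by linarith
  then show "peel_count p [(l, a), (m, b)] (proper_blocks (peel_blocks p [(l, a), (m, b)]))"
  proof cases
    case 1
    then show ?thesis using g(3)[of "b + 1"] assms(3) la b by (auto simp: peel_count_def)
  next
    case 2
    then have "0 < l - 1 + (a - 1) - 1" "l - 1 + (a - 1) - 1 + (b + 1) + 1 = p" using assms(3) la by auto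
    from g(4)[OF this] show ?thesis using 2 assms(3) la b by (simp add: peel_count_def)
  next
    case 3
    then show ?thesis using g(1)[of "if m + b \<le> p then m + b - 1 else 0"] assms(3) la b by (auto simp: peel_count_def)
  next
    case 4
    then show ?thesis using g(1)[of 0] assms(3) la b by (auto simp: peel_count_def)
  qed
  assume "2 \<le> a"
  show "peel_count p [(l, a), (m, b)] (proper_blocks (tl (peel_blocks p [(l, a), (m, b)])))"
  proof (cases "m = 1")
    case True
    then show ?thesis using g(3)[of "b + 1"] assms(3) la b by (auto simp: peel_count_def)
  next
    case False
    then show ?thesis using g(1)[of "if m + b \<le> p then m + b - 1 else 0"] assms(3) la b by (auto simp: peel_count_def)
  qed
qed

text \<open>Only hooks can vanish: a row or column of fewer than \<open>p\<close> nodes, a row of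
  \<open>p\<close> nodes, or a bent hook of \<open>p\<close> nodes.\<close>

lemma proper_peel_blocks_Nil:
  assumes "js_blocks p bs" "2 \<le> p" "bs \<noteq> []" "proper_blocks (peel_blocks p bs) = []"
  obtains l a where "bs = [(l, a)]" "l + a \<le> p" "l = 1 \<or> a = 1"
  | "bs = [(p, 1)]"
  | l b where "bs = [(l, 1), (1, b)]" "l + b = p" "0 < b"
proof -
  obtain l a bs' where bs: "bs = (l, a) # bs'" using assms(3) by (cases bs) auto
  have la: "0 < l" "0 < a" "a < p" using js_blocks_hd assms(1) bs by auto
  show ?thesis
  proof (cases bs')
    case Nil
    then show ?thesis using assms(4) bs la that(1,2) by (auto split: if_splits)
  next
    case (Cons y ys)
    obtain m b where y: "y = (m, b)" by (cases y)
    have ml: "m < l" "p dvd l + a + b - m" and js: "js_blocks p ((m, b) # ys)"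
      using assms(1) bs Cons y by auto
    have m: "0 < m" "0 < b" "b < p" using js_blocks_hd[OF js] by auto
    from ml(2,1) show ?thesis
    proof (cases rule: link_cases)
      case 1
      then have "m = 1" "a = 1" using assms(4) bs Cons y la ml m by (auto split: if_splits)
      moreover have "ys = []"
      proof (rule ccontr)
        assume "ys \<noteq> []"
        then obtain n c zs where ys: "ys = (n, c) # zs" by (cases ys) auto
        then have "n < m" "0 < n" using js js_blocks_hd[of p n c zs] js_blocks_tl[OF js] by auto
        then show False using \<open>m = 1\<close> by simp
      qed
      ultimately show ?thesis using 1 bs Cons y m that(3) by auto
    next
      case 2
      then have "l + a + b \<noteq> p + m" "0 < l + a - p - 1" using m assms(2) by linarith+
      then show ?thesis using assms(4) bs Cons y by (auto split: if_splits)
    qed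
  qed
qed

text \<open>
  The block \<open>v\<close> is what the previous segment leaves behind; either it absorbs the first block
  of the peeled tail into one segment, or it makes up a segment of its own.
\<close>

lemma peel_count_append:
  assumes js: "js_blocks p bs" and p: "2 \<le> p" and ne: "bs \<noteq> []"
    and w: "weak_blocks p ((n, c) # peel_blocks p bs)" and v: "0 < n" "0 < c"
    and IH: "peel_count p bs (proper_blocks (peel_blocks p bs))"
    and IH': "2 \<le> fst (hd bs) \<Longrightarrow> 2 \<le> snd (hd bs) \<Longrightarrow> peel_count p bs (proper_blocks (tl (peel_blocks p bs)))"
  defines "cs \<equiv> (n, c) # proper_blocks (peel_blocks p bs)"
  shows "Suc (full_segments p bs) = full_segments p cs +
    segment_gain p (short_segment p cs) (short_segment p bs) (lost_rows p bs)"
proof -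
  note g = segment_gain_simps[OF p]
  obtain l a bs' where bs: "bs = (l, a) # bs'" using ne by (cases bs) auto
  have la: "0 < l" "0 < a" "a < p" using js_blocks_hd js bs by auto
  obtain R where R: "peel_blocks p bs = (l - 1, a - 1) # R" using peel_blocks_Cons bs by metis
  have link: "l - 1 < n" "p dvd n + c + (a - 1) - (l - 1)" "c < p" using w R by auto
  have le_link: "p + (l - 1) \<le> n + c + (a - 1)" using link(2,1) by (cases rule: link_cases) auto
  have wR: "weak_blocks p (peel_blocks p bs)" using weak_peel_blocks js p by blast
  \<comment> \<open>Here the first segment of \<open>cs\<close> stays inside \<open>(n, c)\<close>:
    it adds one full segment, and the rest is counted by \<open>IH\<close>.\<close>
  have big: ?thesis if "proper_blocks (peel_blocks p bs) = (m, b) # cs'" "n + c + b \<noteq> p + m" for m b cs'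
    using IH that by (simp add: cs_def peel_count_def)
  show ?thesis
  proof (cases "proper_blocks (peel_blocks p bs) = []")
    case True
    show ?thesis using js p ne True
    proof (cases rule: proper_peel_blocks_Nil)
      case (1 l' a')
      then have eq: "l' = l" "a' = a" "bs' = []" using bs by auto
      show ?thesis
      proof (cases "n + c \<le> p")
        case False
        have "lost_rows p bs \<le> l + a - 1" "0 < l + a - 1" "l + a - 1 < p" using 1 eq la by auto
        from g(2)[OF this] show ?thesis using False 1 eq True by (simp add: cs_def)
      next
        case short: True
        \<comment> \<open>A larger multiple of \<open>p\<close> would force
          \<open>n + c > p\<close>. The exact link is what gives \<open>t' + s = p\<close> below,
          hence a gain of 1.\<close>
        have nc: "n + c + a = p + l"
          using link(2,1)
        proof (cases rule: link_cases)
          case 2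
          then show ?thesis using short la 1(3) eq by linarith
        qed (use la in linarith)
        have "0 < n + c - 1" "n + c - 1 + lost_rows p bs = p" "0 < l + a - 1" "0 < lost_rows p bs"
          using nc short la v 1 eq by auto
        from g(6)[OF this] show ?thesis using short 1 eq True by (simp add: cs_def)
      qed
    next
      case 2
      have "p < n + c" using le_link 2 bs p by auto
      then show ?thesis using 2 True g(3)[of 1] p by (simp add: cs_def)
    next
      case (3 l' b)
      have "2 \<le> l" using js 3 bs by auto
      then have "p < n + c" using le_link 3 bs p by auto
      moreover have "b + 1 < p" using 3 bs \<open>2 \<le> l\<close> by auto
      ultimately show ?thesis using 3 True g(3)[of "b + 1"] p by (simp add: cs_def)
    qed
  next
    case False
    show ?thesis
    proof (cases "2 \<le> l \<and> 2 \<le> a")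
      case True
      show ?thesis
      proof (cases "n + c + (a - 1) = p + (l - 1)")
        case eq: True
        then show ?thesis using IH' True R bs by (simp add: cs_def peel_count_def)
      next
        case neq: False
        then show ?thesis using big[of "l - 1" "a - 1" "proper_blocks R"] True R by simp
      qed
    next
      case zero: False
      then have "proper_blocks R \<noteq> []" using False R by auto
      then obtain m b R' where R': "R = (m, b) # R'" by (cases R) auto
      have l1: "m < l - 1" "p dvd l - 1 + (a - 1) + b - m" using wR R R' by auto
      then have a1: "a = 1" using zero la by auto
      \<comment> \<open>The first peeled block has height 0, so the links on its two sides add up:
        \<open>(n, c)\<close> and the next block are at least \<open>2 * p\<close> apart and cannot
        share a segment.\<close>
      have "m + p \<le> l - 1 + (a - 1) + b" using l1(2,1) by (cases rule: link_cases) auto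
      moreover have "l - 1 + p \<le> n + c" using le_link a1 by simp
      ultimately have far: "n + c + b \<noteq> p + m" using p a1 by linarith
      have "0 < m \<and> 0 < b"
      proof (rule ccontr)
        assume "\<not> (0 < m \<and> 0 < b)"
        moreover have "0 < b" using R R' bs p by (cases bs') (auto split: if_splits)
        ultimately have "m = 0" by simp
        then have "R' = []" using wR R R' by (cases R') auto
        then show False using False R R' a1 \<open>m = 0\<close> by simp
      qed
      then show ?thesis using big[of m b "proper_blocks R'"] far R R' a1 by simp
    qed
  qed
qed

text \<open>The second conjunct serves the case where the block left by the segment above absorbs
  the first peeled block; counting then continues on the peeled list without it.\<close>

lemma peel_count:
  assumes "js_blocks p bs" "2 \<le> p" "bs \<noteq> []"
  shows "peel_count p bs (proper_blocks (peel_blocks p bs)) \<and>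
    (2 \<le> fst (hd bs) \<longrightarrow> 2 \<le> snd (hd bs) \<longrightarrow> peel_count p bs (proper_blocks (tl (peel_blocks p bs))))"
  using assms
proof (induction p bs rule: peel_blocks.induct)
  case (2 p l a)
  then show ?case using peel_count_single[of p l a] by simp
next
  case (3 p l a m b bs)
  have ml: "m < l" "p dvd l + a + b - m" and a: "0 < a" "a < p"
    and js: "js_blocks p ((m, b) # bs)" using "3.prems" by auto
  have m: "0 < m" "0 < b" "b < p" using js_blocks_hd[OF js] by auto
  let ?bs = "(l, a) # (m, b) # bs"
  \<comment> \<open>\<open>V\<close> is the lower of the two blocks that the first segment leaves,
    and \<open>B\<close> consists of the blocks below that segment.\<close>
  define B where "B = (if l + a + b = p + m then bs else (m, b) # bs)"
  define V where "V = (if l + a + b = p + m then (m - 1, b + 1) else (l + a - p - 1, 1))"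
  show ?case
  proof (cases "B = []")
    case True
    then have "bs = []" "l + a + b = p + m" by (auto simp: B_def split: if_splits)
    then show ?thesis using peel_count_pair[of p l a m b] "3.prems" by simp
  next
    case False
    have jsB: "js_blocks p B" using js js_blocks_tl by (auto simp: B_def)
    have IH: "peel_count p B (proper_blocks (peel_blocks p B)) \<and>
    (2 \<le> fst (hd B) \<longrightarrow> 2 \<le> snd (hd B) \<longrightarrow> peel_count p B (proper_blocks (tl (peel_blocks p B))))"
      using "3.IH" jsB False "3.prems"(2) unfolding B_def by (auto split: if_splits)
    obtain n c where V: "V = (n, c)" by (cases V)
    have peel: "peel_blocks p ?bs = (l - 1, a - 1) # (n, c) # peel_blocks p B"
      using V by (auto simp: V_def B_def)
    have w: "weak_blocks p ((l - 1, a - 1) # (n, c) # peel_blocks p B)"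
      using weak_peel_blocks[OF "3.prems"(1,2)] peel by simp
    have link: "l - 1 + (a - 1) + c = p + n"
      using ml(2,1)
    proof (cases rule: link_cases)
      case 1
      then show ?thesis using V ml a m by (auto simp: V_def)
    next
      case 2
      then show ?thesis using V ml a m "3.prems"(2) by (auto simp: V_def split: if_splits)
    qed
    have v: "0 < n" "0 < c"
    proof -
      show "0 < c" using V by (auto simp: V_def split: if_splits)
      show "0 < n"
        using ml(2,1)
      proof (cases rule: link_cases)
        case 1
        then have B: "B = bs" by (simp add: B_def)
        then obtain i j zs where bs: "bs = (i, j) # zs" using False by (cases bs) auto
        then have "i < m" "0 < i" using js js_blocks_hd[of p i j zs] js_blocks_tl[OF js] by auto
        then show ?thesis using V 1 by (auto simp: V_def)
      next
        case 2
        then show ?thesis using V m "3.prems"(2) by (auto simp: V_def split: if_splits)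
      qed
    qed
    have stat: "full_segments p ?bs = Suc (full_segments p B)"
      "short_segment p ?bs = short_segment p B" "lost_rows p ?bs = lost_rows p B"
      using False by (auto simp: B_def)
    have "Suc (full_segments p B) = full_segments p ((n, c) # proper_blocks (peel_blocks p B)) +
      segment_gain p (short_segment p ((n, c) # proper_blocks (peel_blocks p B))) (short_segment p B) (lost_rows p B)"
      by (rule peel_count_append) (use jsB "3.prems"(2) False w v IH weak_blocks_Cons in auto)
    then have tail: "peel_count p ?bs ((n, c) # proper_blocks (peel_blocks p B))"
      using stat by (simp add: peel_count_def)
    have full: "peel_count p ?bs (proper_blocks (peel_blocks p ?bs))"
    proof (cases "0 < l - 1 \<and> 0 < a - 1")
      case True
      \<comment> \<open>By \<open>link\<close> the two blocks left by the full segment again make up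
        exactly one full segment, so both counts exceed those for \<open>B\<close> by one.\<close>
      have "peel_count p ?bs ((l - 1, a - 1) # (n, c) # proper_blocks (peel_blocks p B))"
        using IH stat link by (simp add: peel_count_def)
      then show ?thesis using peel True v by simp
    next
      case False
      then show ?thesis using peel tail v by auto
    qed
    then show ?thesis using tail peel v by simp
  qed
qed simp

section \<open>From blocks to partitions\<close>

definition expand_blocks :: "(nat \<times> nat) list \<Rightarrow> nat list" where
  "expand_blocks bs = concat (map (\<lambda>(l, a). replicate a l) bs)"

lemma expand_blocks_simps [simp]:
  "expand_blocks [] = []"
  "expand_blocks ((l, a) # bs) = replicate a l @ expand_blocks bs"
  by (auto simp: expand_blocks_def)

lemma length_expand_blocks [simp]: "length (expand_blocks bs) = rows bs"
  by (induction bs) auto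

lemma filter_expand_blocks: "filter (\<lambda>l. 0 < l) (expand_blocks bs) = expand_blocks (proper_blocks bs)"
  by (induction bs) auto

lemma is_partition_replicate_append:
  "0 < l \<Longrightarrow> first_part ys \<le> l \<Longrightarrow> is_partition ys \<Longrightarrow> is_partition (replicate a l @ ys)"
proof (induction a)
  case (Suc a)
  then show ?case by (cases a) (auto simp: is_partition_Cons)
qed simp

lemma first_part_replicate [simp]:
  "first_part (replicate a l @ ys) = (if a = 0 then first_part ys else l)"
  by (cases a) auto

lemma first_part_expand_js: "js_blocks p ((l, a) # bs) \<Longrightarrow> first_part (expand_blocks ((l, a) # bs)) = l"
  using js_blocks_hd[of p l a bs] by simp

lemma first_part_expand_tl: "js_blocks p ((l, a) # bs) \<Longrightarrow> first_part (expand_blocks bs) < l"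
proof (cases bs)
  case (Cons y ys)
  assume js: "js_blocks p ((l, a) # bs)"
  obtain m b where y: "y = (m, b)" by (cases y)
  then show ?thesis using js first_part_expand_js[of p m b ys] js_blocks_tl[OF js] Cons by auto
qed (use js_blocks_hd in auto)

lemma is_partition_expand_js: "js_blocks p bs \<Longrightarrow> is_partition (expand_blocks bs)"
proof (induction bs)
  case (Cons x bs)
  obtain l a where x: "x = (l, a)" by (cases x)
  then show ?case
    using Cons first_part_expand_tl[of p l a bs] js_blocks_tl js_blocks_hd[of p l a bs]
    by (auto intro!: is_partition_replicate_append)
qed simp

text \<open>Every row of a block except the last has a single rim node, so the state just counts
  down.\<close>

lemma strip_rim_replicate:
  assumes "0 < l" "n < c"
  shows "strip_rim p c (replicate (Suc n) l @ rest) = replicate n (l - 1) @ strip_rim p (c - n) (l # rest)"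
  using assms
proof (induction n arbitrary: c)
  case (Suc n)
  let ?xs = "replicate (Suc n) l @ rest"
  have cut: "row_cut c l ?xs = 1" using Suc.prems by (simp add: row_cut_def)
  then have "next_state p c l ?xs = c - 1" using Suc.prems by (simp add: next_state_def)
  then have "strip_rim p c (l # ?xs) = (l - 1) # strip_rim p (c - 1) ?xs" using cut by simp
  also have "strip_rim p (c - 1) ?xs = replicate n (l - 1) @ strip_rim p (c - 1 - n) (l # rest)"
    by (rule Suc.IH) (use Suc.prems in auto)
  finally show ?case by (simp del: strip_rim.simps)
qed simp

lemma strip_rim_block:
  assumes "0 < l" "0 < a" "a \<le> c"
  shows "strip_rim p c (replicate a l @ rest) =
    replicate (a - 1) (l - 1) @ strip_rim p (c - (a - 1)) (l # rest)"
  using strip_rim_replicate[of l "a - 1" c p rest] assms by (simp del: strip_rim.simps replicate_Suc)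

lemma pred_times: "0 < l \<Longrightarrow> 0 < a \<Longrightarrow> (a - 1) * (l - 1) + (l + a - 1) = a * (l :: nat)"
  by (cases l; cases a) auto

text \<open>The zeros account for the emptied bottom row of a short last block, which
  \<open>peel_blocks\<close> drops and \<open>strip_rim\<close> keeps. The second claim splits the
  \<open>p\<close>-rim into full segments and a short one.\<close>

lemma strip_rim_expand_js:
  assumes "js_blocks p bs" "2 \<le> p"
  shows "(\<exists>z. strip_rim p p (expand_blocks bs) = expand_blocks (peel_blocks p bs) @ replicate z 0) \<and>
    sum_list (expand_blocks bs) =
      sum_list (expand_blocks (peel_blocks p bs)) + p * full_segments p bs + short_segment p bs"
  using assms
proof (induction p bs rule: peel_blocks.induct)
  case (2 p l a)
  have la: "0 < l" "0 < a" "a < p" using "2.prems" by auto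
  have blk: "strip_rim p p (expand_blocks [(l, a)]) =
      replicate (a - 1) (l - 1) @ strip_rim p (p - (a - 1)) [l]"
    using strip_rim_block[of l a p p "[]"] la by (simp del: strip_rim.simps)
  have cut: "row_cut (p - (a - 1)) l [] = min (p - (a - 1)) l" by (simp add: row_cut_def)
  have al: "(a - 1) * (l - 1) + (l + a - 1) = a * l" by (rule pred_times) (use la in auto)
  show ?case
  proof (cases "l + a \<le> p")
    case True
    then have "strip_rim p p (expand_blocks [(l, a)]) = expand_blocks (peel_blocks p [(l, a)]) @ replicate 1 0"
      using blk cut la by simp
    moreover have "sum_list (expand_blocks [(l, a)]) = sum_list (expand_blocks (peel_blocks p [(l, a)])) +
        p * full_segments p [(l, a)] + short_segment p [(l, a)]"
      using True al by (simp add: sum_list_replicate)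
    ultimately show ?thesis by blast
  next
    case False
    then have "strip_rim p p (expand_blocks [(l, a)]) = expand_blocks (peel_blocks p [(l, a)]) @ replicate 0 0"
      using blk cut la by simp
    moreover have "(a - 1) * (l - 1) + (l + a - p - 1) + p = a * l" using al False by linarith
    then have "sum_list (expand_blocks [(l, a)]) = sum_list (expand_blocks (peel_blocks p [(l, a)])) +
        p * full_segments p [(l, a)] + short_segment p [(l, a)]"
      using False by (simp add: sum_list_replicate)
    ultimately show ?thesis by blast
  qed
next
  case (3 p l a m b bs)
  have ml: "m < l" "p dvd l + a + b - m" and a: "0 < a" "a < p"
    and js: "js_blocks p ((m, b) # bs)" using "3.prems" by auto
  have m: "0 < m" "0 < b" "b < p" using js_blocks_hd[OF js] by auto
  let ?E = "expand_blocks bs"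
  have tl: "first_part ?E < m" using first_part_expand_tl[OF js] .
  have al: "(a - 1) * (l - 1) + (l + a - 1) = a * l" by (rule pred_times) (use ml a in auto)
  have blk: "strip_rim p p (expand_blocks ((l, a) # (m, b) # bs)) =
      replicate (a - 1) (l - 1) @ strip_rim p (p - (a - 1)) (l # replicate b m @ ?E)"
    using strip_rim_block[of l a p p "replicate b m @ ?E"] a ml by (simp del: strip_rim.simps)
  have cut: "row_cut (p - (a - 1)) l (replicate b m @ ?E) = min (p - (a - 1)) (l + 1 - m)"
    using m by (simp add: row_cut_def)
  from ml(2,1) show ?case
  proof (cases rule: link_cases)
    case 1
    have IH: "(\<exists>z. strip_rim p p ?E = expand_blocks (peel_blocks p bs) @ replicate z 0) \<and>
      sum_list ?E = sum_list (expand_blocks (peel_blocks p bs)) + p * full_segments p bs + short_segment p bs"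
      by (rule "3.IH"(1)) (use 1 js "3.prems" js_blocks_tl in auto)
    then obtain z where z: "strip_rim p p ?E = expand_blocks (peel_blocks p bs) @ replicate z 0" by blast
    have k: "row_cut (p - (a - 1)) l (replicate b m @ ?E) = l + 1 - m"
      and ns: "next_state p (p - (a - 1)) l (replicate b m @ ?E) = b"
      using cut 1 a ml m by (auto simp: next_state_def)
    have "strip_rim p b (replicate b m @ ?E) = replicate (b - 1) (m - 1) @ strip_rim p (b - (b - 1)) (m # ?E)"
      by (rule strip_rim_block) (use m in auto)
    \<comment> \<open>The last row of the second block is entered with one node missing, so the
      segment ends exactly there and the rest starts at \<open>p\<close>.\<close>
    also have "strip_rim p (b - (b - 1)) (m # ?E) = (m - 1) # strip_rim p p ?E"
      using m tl by (simp add: next_state_def row_cut_def)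
    finally have "strip_rim p p (expand_blocks ((l, a) # (m, b) # bs)) =
        replicate (a - 1) (l - 1) @ (m - 1) # replicate (b - 1) (m - 1) @ (m - 1) # strip_rim p p ?E"
      using blk k ns ml by simp
    moreover have "replicate (b + 1) (m - 1) = (m - 1) # replicate (b - 1) (m - 1) @ [m - 1]"
      using m by (cases b) (simp_all add: replicate_append_same)
    ultimately have "strip_rim p p (expand_blocks ((l, a) # (m, b) # bs)) =
        expand_blocks (peel_blocks p ((l, a) # (m, b) # bs)) @ replicate z 0"
      using 1 z by (simp del: replicate_Suc strip_rim.simps add: replicate_add)
    moreover have "(a - 1) * (l - 1) + (b + 1) * (m - 1) + p = a * l + b * m"
    proof -
      have "(b + 1) * (m - 1) + b + 1 = b * m + m" using m by (cases m) auto
      then show ?thesis using al 1 a ml m by linarith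
    qed
    then have "sum_list (expand_blocks ((l, a) # (m, b) # bs)) =
        sum_list (expand_blocks (peel_blocks p ((l, a) # (m, b) # bs))) +
        p * full_segments p ((l, a) # (m, b) # bs) + short_segment p ((l, a) # (m, b) # bs)"
      using IH 1 by (simp add: sum_list_replicate del: One_nat_def)
    ultimately show ?thesis by blast
  next
    case 2
    have IH: "(\<exists>z. strip_rim p p (expand_blocks ((m, b) # bs)) = expand_blocks (peel_blocks p ((m, b) # bs)) @ replicate z 0) \<and>
      sum_list (expand_blocks ((m, b) # bs)) = sum_list (expand_blocks (peel_blocks p ((m, b) # bs)))
        + p * full_segments p ((m, b) # bs) + short_segment p ((m, b) # bs)"
      by (rule "3.IH"(2)) (use 2 js "3.prems" in auto)
    then obtain z where z: "strip_rim p p (expand_blocks ((m, b) # bs)) =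
        expand_blocks (peel_blocks p ((m, b) # bs)) @ replicate z 0" by blast
    have k: "row_cut (p - (a - 1)) l (replicate b m @ ?E) = p - (a - 1)"
      and ns: "next_state p (p - (a - 1)) l (replicate b m @ ?E) = p"
      using cut 2 a ml m by (auto simp: next_state_def)
    have "l - (p - (a - 1)) = l + a - p - 1" using 2 a ml m by linarith
    then have "strip_rim p p (expand_blocks ((l, a) # (m, b) # bs)) =
        replicate (a - 1) (l - 1) @ (l + a - p - 1) # strip_rim p p (expand_blocks ((m, b) # bs))"
      using blk k ns by simp
    then have "strip_rim p p (expand_blocks ((l, a) # (m, b) # bs)) =
        expand_blocks (peel_blocks p ((l, a) # (m, b) # bs)) @ replicate z 0"
      using 2 z "3.prems"(2) by (auto simp del: strip_rim.simps)
    moreover have "(a - 1) * (l - 1) + (l + a - p - 1) + p = a * l" using al 2 m by linarith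
    then have "sum_list (expand_blocks ((l, a) # (m, b) # bs)) =
        sum_list (expand_blocks (peel_blocks p ((l, a) # (m, b) # bs))) +
        p * full_segments p ((l, a) # (m, b) # bs) + short_segment p ((l, a) # (m, b) # bs)"
      using IH 2 "3.prems"(2) by (simp add: sum_list_replicate del: One_nat_def)
    ultimately show ?thesis by blast
  qed
qed simp

lemma remove_p_rim_expand_js:
  assumes "js_blocks p bs" "2 \<le> p"
  shows "remove_p_rim p (expand_blocks bs) = expand_blocks (proper_blocks (peel_blocks p bs))"
proof -
  obtain z where "strip_rim p p (expand_blocks bs) = expand_blocks (peel_blocks p bs) @ replicate z 0"
    using strip_rim_expand_js[OF assms] by blast
  then show ?thesis
    using is_partition_expand_js[OF assms(1)] assms(2)
    by (simp add: remove_p_rim_eq filter_expand_blocks[symmetric])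
qed

lemma length_p_rim_expand_js:
  assumes "js_blocks p bs" "2 \<le> p"
  shows "length (p_rim p (expand_blocks bs)) = p * full_segments p bs + short_segment p bs"
proof -
  have "sum_list (remove_p_rim p (expand_blocks bs)) = sum_list (expand_blocks (peel_blocks p bs))"
    using remove_p_rim_expand_js[OF assms] by (simp add: filter_expand_blocks[symmetric] sum_list_filter_pos)
  then show ?thesis
    using sum_remove_p_rim[OF is_partition_expand_js[OF assms(1)], of p] strip_rim_expand_js[OF assms] assms(2)
    by simp
qed

lemma ex_blocks:
  assumes "is_partition lam"
  shows "\<exists>bs. lam = expand_blocks bs \<and> sorted_wrt (>) (map fst bs) \<and> (\<forall>(l, a) \<in> set bs. 0 < l \<and> 0 < a)"
  using assms
proof (induction lam)
  case Nil
  then show ?case by (intro exI[of _ "[]"]) simp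
next
  case (Cons x xs)
  then obtain bs where bs: "xs = expand_blocks bs" "sorted_wrt (>) (map fst bs)"
    "\<forall>(l, a) \<in> set bs. 0 < l \<and> 0 < a" by (auto simp: is_partition_Cons)
  show ?case
  proof (cases bs)
    case Nil
    then show ?thesis using bs Cons.prems by (intro exI[of _ "[(x, 1)]"]) (auto simp: is_partition_Cons)
  next
    case (Cons y ys)
    obtain l a where y: "y = (l, a)" by (cases y)
    then have "first_part xs = l" using bs Cons by auto
    then have "l \<le> x" "0 < x" using Cons.prems by (auto simp: is_partition_Cons)
    then consider "x = l" | "l < x" by linarith
    then show ?thesis
    proof cases
      case 1
      then show ?thesis using bs y Cons by (intro exI[of _ "(l, Suc a) # ys"]) auto
    next
      case 2
      then show ?thesis using bs y Cons \<open>0 < x\<close> by (intro exI[of _ "(x, 1) # bs"]) auto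
    qed
  qed
qed

lemma remdups_replicate_append:
  "0 < a \<Longrightarrow> l \<notin> set ys \<Longrightarrow> remdups (replicate a l @ ys) = l # remdups ys"
proof (induction a)
  case (Suc a)
  then show ?case by (cases a) auto
qed simp

lemma set_expand_blocks: "set (expand_blocks bs) \<subseteq> fst ` set bs"
  by (induction bs) auto

lemma distinct_parts_expand:
  "sorted_wrt (>) (map fst bs) \<Longrightarrow> (\<forall>(l, a) \<in> set bs. 0 < l \<and> 0 < a) \<Longrightarrow>
    distinct_parts (expand_blocks bs) = map fst bs"
proof (induction bs)
  case (Cons x bs)
  obtain l a where x: "x = (l, a)" by (cases x)
  have "l \<notin> set (expand_blocks bs)" using Cons.prems x set_expand_blocks[of bs] by fastforce
  then show ?case using Cons x by (simp add: distinct_parts_def remdups_replicate_append)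
qed (simp add: distinct_parts_def)

lemma count_list_replicate: "count_list (replicate a l) x = (if x = l then a else 0)"
  by (induction a) auto

lemma count_list_expand:
  "sorted_wrt (>) (map fst bs) \<Longrightarrow> map (count_list (expand_blocks bs)) (map fst bs) = map snd bs"
proof (induction bs)
  case (Cons x bs)
  obtain l a where x: "x = (l, a)" by (cases x)
  have l: "l \<notin> fst ` set bs" using Cons.prems x by fastforce
  then have "count_list (expand_blocks bs) l = 0"
    using set_expand_blocks[of bs] by (auto simp: count_list_0_iff)
  moreover have "map (count_list (replicate a l @ expand_blocks bs)) (map fst bs) = map snd bs"
    using Cons l x by (auto simp: count_list_replicate)
  ultimately show ?case using x by (simp add: count_list_replicate)
qed simp

lemma js_blocks_nth:
  assumes "sorted_wrt (>) (map fst bs)" "\<forall>(l, a) \<in> set bs. 0 < l \<and> 0 < a" "\<forall>a \<in> set (map snd bs). a \<le> p - 1"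
    "\<forall>i. Suc i < length bs \<longrightarrow>
      [int (map fst bs ! i) - int (map fst bs ! Suc i) + int (map snd bs ! i) + int (map snd bs ! Suc i) = 0] (mod int p)"
  shows "js_blocks p bs"
  using assms
proof (induction bs)
  case (Cons x bs)
  obtain l a where x: "x = (l, a)" by (cases x)
  have la: "0 < l" "0 < a" "a < p" using Cons.prems x by auto
  show ?case
  proof (cases bs)
    case Nil
    then show ?thesis using la x by simp
  next
    case (Cons y ys)
    obtain m b where y: "y = (m, b)" by (cases y)
    have IH: "js_blocks p bs"
    proof (rule Cons.IH)
      show "\<forall>i. Suc i < length bs \<longrightarrow>
      [int (map fst bs ! i) - int (map fst bs ! Suc i) + int (map snd bs ! i) + int (map snd bs ! Suc i) = 0] (mod int p)"
      proof (intro allI impI)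
        fix i assume "Suc i < length bs"
        then show "[int (map fst bs ! i) - int (map fst bs ! Suc i) + int (map snd bs ! i) + int (map snd bs ! Suc i) = 0] (mod int p)"
          using Cons.prems(4)[rule_format, of "Suc i"] by simp
      qed
    qed (use Cons.prems in auto)
    have ml: "m < l" using Cons.prems x y Cons by simp
    have "[int l - int m + int a + int b = 0] (mod int p)"
      using Cons.prems(4)[rule_format, of 0] x y Cons by simp
    then have "int p dvd int l - int m + int a + int b" by (simp add: cong_0_iff)
    moreover have "int l - int m + int a + int b = int (l + a + b - m)" using ml by auto
    ultimately have "p dvd l + a + b - m" by (simp only: int_dvd_int_iff)
    then show ?thesis using IH la ml x y Cons by simp
  qed
qed simp

lemma JS_partition_blocks:
  assumes "JS_partition p lam"
  obtains bs where "js_blocks p bs" "lam = expand_blocks bs"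
    "lam \<noteq> [] \<Longrightarrow> JS_type p lam = block_type bs mod int p"
proof -
  have "is_partition lam" using assms by (simp add: JS_partition_def p_regular_def)
  then obtain bs where bs: "lam = expand_blocks bs" "sorted_wrt (>) (map fst bs)"
    "\<forall>(l, a) \<in> set bs. 0 < l \<and> 0 < a" using ex_blocks by blast
  have d: "distinct_parts lam = map fst bs" using distinct_parts_expand bs by simp
  then have m: "multiplicities lam = map snd bs"
    using count_list_expand[OF bs(2)] bs(1) by (simp add: multiplicities_def)
  have "js_blocks p bs"
    by (rule js_blocks_nth) (use assms bs d m in \<open>auto simp: JS_partition_def p_regular_def Let_def\<close>)
  moreover have "JS_type p lam = block_type bs mod int p" if "lam \<noteq> []"
  proof -
    have "bs \<noteq> []" using that bs by auto
    then show ?thesis using d m by (simp add: JS_type_def block_type_def hd_map)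
  qed
  ultimately show ?thesis using that bs by blast
qed

section \<open>Cores and beta-numbers\<close>

definition content :: "nat \<times> nat \<Rightarrow> int" where
  "content u = int (snd u) - int (fst u)"

lemma length_rim_from:
  "is_partition xs \<Longrightarrow> xs \<noteq> [] \<Longrightarrow> length (rim_from i xs) + 1 = first_part xs + length xs"
proof (induction xs arbitrary: i)
  case (Cons x xs)
  show ?case
  proof (cases "xs = []")
    case True
    then show ?thesis using Cons.prems by (simp add: is_partition_Cons)
  next
    case False
    then have "length (rim_from (Suc i) xs) + 1 = first_part xs + length xs"
      using Cons by (simp add: is_partition_Cons)
    moreover have "0 < first_part xs" "first_part xs \<le> x"
      using first_part_pos False Cons.prems by (auto simp: is_partition_Cons)
    ultimately show ?thesis by simp
  qed
qed simp

text \<open>Each step along the rim goes left or down and lowers the content by one, so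
  \<open>p\<close> consecutive rim nodes have \<open>p\<close> consecutive contents.\<close>

lemma content_rim_from:
  "is_partition xs \<Longrightarrow> k < length (rim_from i xs) \<Longrightarrow>
    content (rim_from i xs ! k) = int (first_part xs) - int i - int k"
proof (induction xs arbitrary: i k)
  case (Cons x xs)
  define n where "n = x + 1 - max 1 (first_part xs)"
  have le: "first_part xs \<le> x" "0 < x" using Cons.prems by (auto simp: is_partition_Cons)
  show ?case
  proof (cases "k < n")
    case True
    then have "rim_from i (x # xs) ! k = (i, x - k)"
      using le by (auto simp: n_def nth_append rev_nth)
    then show ?thesis using True le by (auto simp: content_def n_def)
  next
    case False
    have eq: "rim_from i (x # xs) ! k = rim_from (Suc i) xs ! (k - n)"
      using False by (simp add: n_def nth_append)
    have k: "k - n < length (rim_from (Suc i) xs)" using False Cons.prems by (auto simp: n_def)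
    then have "xs \<noteq> []" by auto
    then have "0 < first_part xs" using first_part_pos Cons.prems by (simp add: is_partition_Cons)
    then show ?thesis
      unfolding eq using Cons.IH[OF _ k] Cons.prems False le by (simp add: is_partition_Cons n_def)
  qed
qed simp

lemma content_rim:
  "is_partition lam \<Longrightarrow> k < length (rim lam) \<Longrightarrow> content (rim lam ! k) = int (first_part lam) - 1 - int k"
  using content_rim_from[of lam k 1] by (simp add: rim_eq_rim_from)

lemma set_rim: "set (rim lam) = {(i, j) \<in> diagram lam. (i + 1, j + 1) \<notin> diagram lam}"
  by (auto simp: rim_def diagram_def less_Suc_eq_le)

lemma set_take_drop:
  "i + p \<le> length xs \<Longrightarrow> set (take p (drop i xs)) = (\<lambda>k. xs ! (i + k)) ` {..<p}"
  using nth_image[of p "drop i xs"] by (simp add: atLeast0LessThan)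

lemma diagram_Sigma: "diagram lam = Sigma {1..length lam} (\<lambda>i. {1..lam ! (i - 1)})"
  by (auto simp: diagram_def)

lemma finite_diagram: "finite (diagram lam)"
  by (simp add: diagram_Sigma)

definition part :: "nat list \<Rightarrow> nat \<Rightarrow> nat" where
  "part lam i = (if i < length lam then lam ! i else 0)"

text \<open>Contents grow by one along a row, so each row contributes only its two ends. The row
  ends are the beta-numbers up to a shift; rows beyond the length contribute 0.\<close>

lemma sum_diagram_telescope:
  fixes f :: "int \<Rightarrow> int"
  assumes "length lam \<le> N"
  shows "(\<Sum>u\<in>diagram lam. f (content u) - f (content u - 1)) =
    (\<Sum>i<N. f (int (part lam i) - int (i + 1)) - f (- int (i + 1)))"
proof -
  have tel: "(\<Sum>j\<in>{1..n}. f (int j - i) - f (int j - i - 1)) = f (int n - i) - f (- i)" for n i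
    by (induction n) (auto simp: algebra_simps)
  have "(\<Sum>u\<in>diagram lam. f (content u) - f (content u - 1)) =
      (\<Sum>i\<in>{1..length lam}. \<Sum>j\<in>{1..lam ! (i - 1)}. f (int j - int i) - f (int j - int i - 1))"
    unfolding diagram_Sigma by (subst sum.Sigma) (auto simp: content_def case_prod_unfold)
  also have "\<dots> = (\<Sum>i\<in>{1..length lam}. f (int (lam ! (i - 1)) - int i) - f (- int i))"
    by (simp only: tel)
  also have "\<dots> = (\<Sum>i<length lam. f (int (lam ! i) - int (i + 1)) - f (- int (i + 1)))"
    by (rule sum.reindex_bij_witness[of _ "\<lambda>i. i + 1" "\<lambda>i. i - 1"]) auto
  also have "\<dots> = (\<Sum>i<length lam. f (int (part lam i) - int (i + 1)) - f (- int (i + 1)))"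
    by (simp add: part_def)
  also have "\<dots> = (\<Sum>i<N. f (int (part lam i) - int (i + 1)) - f (- int (i + 1)))"
    by (rule sum.mono_neutral_left) (use assms in \<open>auto simp: part_def\<close>)
  finally show ?thesis .
qed

lemma card_diagram: "card (diagram lam) = sum_list lam"
proof -
  have "card (diagram lam) = (\<Sum>i\<in>{1..length lam}. lam ! (i - 1))"
    by (simp add: diagram_Sigma)
  also have "\<dots> = (\<Sum>i<length lam. lam ! i)"
    by (rule sum.reindex_bij_witness[of _ "\<lambda>i. i + 1" "\<lambda>i. i - 1"]) auto
  finally show ?thesis by (simp add: sum_list_sum_nth atLeast0LessThan)
qed

text \<open>For a \<open>p\<close>-periodic \<open>f\<close> the sum over the \<open>p\<close>
  consecutive contents of the hook telescopes to \<open>f h - f (h - p) = 0\<close>. This shows that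
  removal preserves the number of beads in each residue class without tracing which bead
  moves.\<close>

lemma removes_rim_hook_sum:
  fixes f :: "int \<Rightarrow> int"
  assumes "is_partition lam" "removes_rim_hook p lam mu" "\<And>z. f (z - int p) = f z"
  shows "(\<Sum>u\<in>diagram mu. f (content u) - f (content u - 1)) = (\<Sum>u\<in>diagram lam. f (content u) - f (content u - 1))"
    and "sum_list mu + p = sum_list lam" and "diagram mu \<subseteq> diagram lam"
proof -
  let ?g = "\<lambda>u. f (content u) - f (content u - 1)"
  obtain i where i: "i + p \<le> length (rim lam)" and mu: "diagram mu = diagram lam - set (take p (drop i (rim lam)))"
    using assms(2) by (auto simp: removes_rim_hook_def)
  define T where "T = set (take p (drop i (rim lam)))"
  define h where "h = int (first_part lam) - 1 - int i"
  have T: "T = (\<lambda>k. rim lam ! (i + k)) ` {..<p}" using set_take_drop[OF i] by (simp add: T_def)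
  have c: "content (rim lam ! (i + k)) = h - int k" if "k < p" for k
    using content_rim[OF assms(1), of "i + k"] that i by (simp add: h_def)
  have inj: "inj_on (\<lambda>k. rim lam ! (i + k)) {..<p}"
    by (rule inj_onI) (metis c lessThan_iff diff_left_imp_eq of_nat_eq_iff)
  have sub: "T \<subseteq> diagram lam" unfolding T_def using set_rim[of lam] by (auto dest!: in_set_takeD in_set_dropD)
  have "(\<Sum>u\<in>T. ?g u) = (\<Sum>k<p. f (h - int k) - f (h - int k - 1))"
    unfolding T by (subst sum.reindex[OF inj]) (simp add: c)
  also have "\<dots> = f h - f (h - int p)"
    by (induction p) (auto simp: algebra_simps)
  finally have sT: "(\<Sum>u\<in>T. ?g u) = 0" using assms(3) by simp
  have mu': "diagram mu = diagram lam - T" using mu by (simp add: T_def)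
  show "(\<Sum>u\<in>diagram mu. ?g u) = (\<Sum>u\<in>diagram lam. ?g u)"
    unfolding mu' using sum_diff[OF finite_diagram sub, of ?g] sT by simp
  have "card T = p" unfolding T by (simp add: card_image[OF inj])
  moreover have "card (diagram mu) = card (diagram lam) - card T"
    unfolding mu' by (rule card_Diff_subset) (use sub finite_diagram finite_subset in auto)
  moreover have "card T \<le> card (diagram lam)" by (rule card_mono[OF finite_diagram sub])
  ultimately show "sum_list mu + p = sum_list lam" by (simp add: card_diagram)
  show "diagram mu \<subseteq> diagram lam" using mu' by auto
qed

lemma length_le_of_diagram_subset:
  assumes "is_partition mu" "diagram mu \<subseteq> diagram lam"
  shows "length mu \<le> length lam"
proof (cases "mu = []")
  case False
  then have "(length mu, 1) \<in> diagram mu"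
    using assms(1) by (auto simp: diagram_def is_partition_def Suc_le_eq)
  then show ?thesis using assms(2) by (auto simp: diagram_def)
qed simp

text \<open>The beta-numbers for \<open>N\<close> beads; the subtraction is exact for
  \<open>i < N\<close>.\<close>

definition bead :: "nat \<Rightarrow> nat list \<Rightarrow> nat \<Rightarrow> nat" where
  "bead N lam i = part lam i + (N - 1 - i)"

lemma part_mono: "is_partition lam \<Longrightarrow> i \<le> j \<Longrightarrow> part lam j \<le> part lam i"
  using sorted_wrt_ge_nth[of lam i j] by (auto simp: part_def is_partition_def)

lemma bead_strict_mono: "is_partition lam \<Longrightarrow> i < j \<Longrightarrow> j < N \<Longrightarrow> bead N lam j < bead N lam i"
  using part_mono[of lam i j] by (simp add: bead_def)

lemma inj_on_bead: "is_partition lam \<Longrightarrow> inj_on (bead N lam) {..<N}"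
  by (rule inj_onI) (metis bead_strict_mono lessThan_iff linorder_neqE_nat nat_less_le)

lemma bead_sum: 
  assumes "length lam \<le> N"
  shows "(\<Sum>i<N. bead N lam i) = sum_list lam + (\<Sum>i<N. i)"
proof -
  have "(\<Sum>i<N. part lam i) = (\<Sum>i<length lam. part lam i)"
    by (rule sum.mono_neutral_right) (use assms in \<open>auto simp: part_def\<close>)
  also have "\<dots> = sum_list lam" by (simp add: sum_list_sum_nth atLeast0LessThan part_def)
  finally have 1: "(\<Sum>i<N. part lam i) = sum_list lam" .
  have 2: "(\<Sum>i<N. N - 1 - i) = (\<Sum>i<N. i)" using sum.nat_diff_reindex[of "\<lambda>i. i" N] by simp
  show ?thesis by (simp only: bead_def sum.distrib 1 2)
qed

lemma removes_rim_hook_beads: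
  fixes f :: "int \<Rightarrow> int"
  assumes "(removes_rim_hook p)\<^sup>*\<^sup>* lam kap" "is_partition lam" "length lam \<le> N" "\<And>z. f (z - int p) = f z"
  shows "is_partition kap \<and> length kap \<le> N \<and> (\<Sum>i<N. f (int (bead N kap i))) = (\<Sum>i<N. f (int (bead N lam i)))"
  using assms(1)
proof (induction rule: rtranclp_induct)
  case base
  then show ?case using assms by simp
next
  case (step mu kap)
  have mu: "is_partition mu" "length mu \<le> N" using step.IH by auto
  have kap: "is_partition kap" using step.hyps(2) by (simp add: removes_rim_hook_def)
  define g where "g z = f (z + int N)" for z
  have per: "g (z - int p) = g z" for z using assms(4)[of "z + int N"] by (simp add: g_def algebra_simps)
  note h = removes_rim_hook_sum[OF mu(1) step.hyps(2), of g, OF per]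
  have len: "length kap \<le> N" using length_le_of_diagram_subset[OF kap h(3)] mu by simp
  have g: "(\<Sum>i<N. g (int (part nu i) - int (i + 1))) = (\<Sum>i<N. f (int (bead N nu i)))" for nu
    by (rule sum.cong) (auto simp: g_def bead_def of_nat_diff algebra_simps)
  have "(\<Sum>i<N. g (int (part kap i) - int (i + 1)) - g (- int (i + 1))) =
      (\<Sum>i<N. g (int (part mu i) - int (i + 1)) - g (- int (i + 1)))"
    using h(1) sum_diagram_telescope[OF len, of g] sum_diagram_telescope[OF mu(2), of g] by simp
  then have "(\<Sum>i<N. f (int (bead N kap i))) = (\<Sum>i<N. f (int (bead N mu i)))"
    unfolding sum_subtractf g by simp
  then show ?case using step.IH kap len by simp
qed

lemma ex_partition_of_antimono:
  assumes "\<And>i. 1 \<le> i \<Longrightarrow> i < N \<Longrightarrow> f (Suc i) \<le> f i"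
  shows "\<exists>mu. is_partition mu \<and> diagram mu = {(i, j). 1 \<le> i \<and> i \<le> N \<and> 1 \<le> j \<and> j \<le> (f i :: nat)}"
proof -
  define xs where "xs = map (\<lambda>i. f (Suc i)) [0..<N]"
  have mono: "f j \<le> f i" if "i \<le> j" "1 \<le> i" "j \<le> N" for i j
    using that
  proof (induction rule: dec_induct)
    case (step n)
    then show ?case using assms[of n] by simp
  qed simp
  have srt: "sorted_wrt (\<ge>) xs"
    unfolding sorted_wrt_iff_nth_less xs_def using mono by simp
  define mu where "mu = filter (\<lambda>l. 0 < l) xs"
  have xs: "xs = mu @ replicate (length (filter (\<lambda>l. l = 0) xs)) 0"
    using filter_pos_append_zeros[OF srt] by (simp add: mu_def)
  have "is_partition mu" unfolding mu_def by (rule is_partition_filter[OF srt])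
  moreover have "diagram mu = diagram xs"
  proof -
    have "diagram (mu @ replicate n 0) = diagram mu" for n
      by (auto simp: diagram_def nth_append split: if_splits)
    then show ?thesis using xs by metis
  qed
  moreover have "diagram xs = {(i, j). 1 \<le> i \<and> i \<le> N \<and> 1 \<le> j \<and> j \<le> f i}"
    by (auto simp: diagram_def xs_def)
  ultimately show ?thesis by blast
qed

text \<open>
  If the bead \<open>b\<close> of row \<open>s\<close> can move to the free position \<open>b - p\<close>, the \<open>p\<close> rim nodes starting at the
  end of row \<open>s\<close> form a removable hook: the shortened rows would fail to decrease only at a row
  whose bead is \<open>b - p\<close>.
\<close>

lemma removes_rim_hook_exists:
  assumes "is_partition kap" "1 \<le> s" "s \<le> length kap"
    and lo: "lo = int (kap ! (s - 1)) - int s - int p" "- int (length kap) \<le> lo"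
    and free: "\<And>i. i < length kap \<Longrightarrow> int (kap ! i) - int (i + 1) \<noteq> lo"
    and p: "0 < p"
  shows "\<exists>mu. removes_rim_hook p kap mu"
proof -
  define L where "L = length kap"
  define row where "row i = part kap (i - 1)" for i
  have row_mono: "row j \<le> row i" if "i \<le> j" for i j
    using part_mono[OF assms(1), of "i - 1" "j - 1"] that by (simp add: row_def)
  have row_pos: "0 < row i" if "1 \<le> i" "i \<le> L" for i
    using assms(1) that by (auto simp: row_def part_def L_def is_partition_def)
  have row0: "row i = 0" if "L < i" for i using that by (auto simp: row_def part_def L_def)
  have diag: "(i, j) \<in> diagram kap \<longleftrightarrow> 1 \<le> i \<and> i \<le> L \<and> 1 \<le> j \<and> j \<le> row i" for i j
    by (auto simp: diagram_def row_def part_def L_def)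
  define h where "h = int (row s) - int s"
  have h: "lo = h - int p" using lo assms(2,3) by (simp add: h_def row_def part_def)
  have hmono: "int (row j) - int j \<le> int (row i) - int i" if "i \<le> j" for i j
    using row_mono[OF that] that by simp
  \<comment> \<open>From row \<open>i \<ge> s\<close> the hook takes the rim nodes, in columns from
    \<open>row (Suc i)\<close> on, whose content exceeds \<open>lo\<close>. The columns kept are
    thus those up to \<open>row (Suc i) - 1\<close> or up to \<open>lo + i\<close>, whichever is
    larger.\<close>
  define f where "f i = (if i < s then row i else min (row i) (nat (max (int (row (Suc i)) - 1) (lo + int i))))" for i
  have anti: "f (Suc i) \<le> f i" if i: "1 \<le> i" "i < L" for i
  proof (cases "i < s")
    case True
    then show ?thesis using row_mono[of i "Suc i"] by (auto simp: f_def)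
  next
    case False
    have "int (row (Suc i)) - int (Suc i) \<noteq> lo"
      using free[of i] i by (simp add: row_def part_def L_def)
    then have "min (row (Suc i)) (nat (max (int (row (Suc (Suc i))) - 1) (lo + int (Suc i))))
        \<le> nat (max (int (row (Suc i)) - 1) (lo + int i))"
      using row_mono[of "Suc i" "Suc (Suc i)"] row_mono[of i "Suc i"] by linarith
    then show ?thesis using False row_mono[of i "Suc i"] by (simp add: f_def)
  qed
  obtain mu where mu: "is_partition mu" "diagram mu = {(i, j). 1 \<le> i \<and> i \<le> L \<and> 1 \<le> j \<and> j \<le> f i}"
    using ex_partition_of_antimono[of L f] anti by blast
  define k where "k = nat (int (first_part kap) - 1 - h)"
  have fp: "first_part kap = row 1" using assms(2,3) by (cases kap) (auto simp: row_def part_def)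
  have k: "int k = int (first_part kap) - 1 - h"
    using hmono[of 1 s] assms(2) fp by (simp add: k_def h_def)
  have ne: "kap \<noteq> []" using assms(2,3) by auto
  have len: "length (rim kap) + 1 = first_part kap + L"
    using length_rim_from[OF assms(1) ne, of 1] assms(1) by (simp add: rim_eq_rim_from L_def)
  \<comment> \<open>The bound \<open>- L \<le> lo\<close> says precisely that the hook does not run
    past the last node of the rim, which has \<open>first_part kap + L - 1\<close> nodes.\<close>
  have kp: "k + p \<le> length (rim kap)" using k h lo(2) len by (simp add: L_def)
  have T: "u \<in> set (take p (drop k (rim kap))) \<longleftrightarrow> u \<in> set (rim kap) \<and> lo < content u \<and> content u \<le> h" for u
  proof
    assume "u \<in> set (take p (drop k (rim kap)))"
    then obtain n where n: "n < p" "u = rim kap ! (k + n)" using set_take_drop[OF kp] by auto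
    moreover have "content u = h - int n"
      using content_rim[OF assms(1), of "k + n"] n kp k by simp
    ultimately show "u \<in> set (rim kap) \<and> lo < content u \<and> content u \<le> h" using h kp by simp
  next
    assume u: "u \<in> set (rim kap) \<and> lo < content u \<and> content u \<le> h"
    then obtain n where n: "n < length (rim kap)" "u = rim kap ! n" by (auto simp: in_set_conv_nth)
    have "content u = int (first_part kap) - 1 - int n" using content_rim[OF assms(1)] n by simp
    then have "k \<le> n" "n < k + p" using u k h by auto
    then show "u \<in> set (take p (drop k (rim kap)))"
      unfolding set_take_drop[OF kp] using n by (intro image_eqI[of _ _ "n - k"]) auto
  qed
  have "diagram kap - set (take p (drop k (rim kap))) = diagram mu"
  proof -
    have "(i, j) \<in> diagram kap - set (take p (drop k (rim kap))) \<longleftrightarrow> (i, j) \<in> diagram mu" for i j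
    proof (cases "1 \<le> i \<and> i \<le> L \<and> 1 \<le> j \<and> j \<le> row i")
      case True
      have "(i + 1, j + 1) \<in> diagram kap \<longleftrightarrow> j + 1 \<le> row (Suc i)"
        using diag[of "i + 1" "j + 1"] row0[of "Suc i"] by (cases "Suc i \<le> L") auto
      then have "(i, j) \<in> set (take p (drop k (rim kap))) \<longleftrightarrow>
          row (Suc i) \<le> j \<and> lo < int j - int i \<and> int j - int i \<le> h"
        using True diag by (auto simp: T set_rim content_def)
      moreover have "(row (Suc i) \<le> j \<and> lo < int j - int i \<and> int j - int i \<le> h) \<longleftrightarrow> \<not> j \<le> f i"
      proof (cases "i < s")
        case i: True
        have "h < int j - int i" if "row (Suc i) \<le> j"
          using hmono[of "Suc i" s] i that by (simp add: h_def)
        then show ?thesis using i True by (auto simp: f_def)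
      next
        case i: False
        have "int j - int i \<le> h" using hmono[of s i] i True by (simp add: h_def)
        then show ?thesis using i True by (auto simp: f_def)
      qed
      ultimately show ?thesis using True diag mu(2) by auto
    next
      case False
      have "f i \<le> row i" by (auto simp: f_def)
      then show ?thesis using False diag[of i j] mu(2) by auto
    qed
    then show ?thesis by (auto simp only: set_eq_iff split_paired_all)
  qed
  then show ?thesis unfolding removes_rim_hook_def using mu(1) kp by metis
qed

lemma core_beads_closed:
  assumes "is_partition kap" "length kap \<le> N" "\<nexists>mu. removes_rim_hook p kap mu" "0 < p"
    and b: "b \<in> bead N kap ` {..<N}" "p \<le> b"
  shows "b - p \<in> bead N kap ` {..<N}"
proof (rule ccontr)
  assume no: "b - p \<notin> bead N kap ` {..<N}"
  obtain i where i: "i < N" "b = bead N kap i" using b by auto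
  \<comment> \<open>The empty rows have their beads at all positions below
    \<open>N - length kap\<close>, so the free position \<open>b - p\<close> lies above these, and
    the hook fits into the rim.\<close>
  have tail: "N - 1 - j \<in> bead N kap ` {..<N}" if "length kap \<le> j" "j < N" for j
    by (rule image_eqI[of _ _ j]) (use that in \<open>auto simp: bead_def part_def\<close>)
  have small: "N - length kap \<le> b - p"
  proof (rule ccontr)
    assume "\<not> N - length kap \<le> b - p"
    then have "b - p = N - 1 - (N - 1 - (b - p))" "length kap \<le> N - 1 - (b - p)" "N - 1 - (b - p) < N"
      by auto
    then show False using tail[of "N - 1 - (b - p)"] no by simp
  qed
  have iL: "i < length kap"
  proof (rule ccontr)
    assume "\<not> i < length kap"
    then show False using small i b(2) assms(4) by (simp add: bead_def part_def)
  qed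
  have "\<exists>mu. removes_rim_hook p kap mu"
  proof (rule removes_rim_hook_exists[of kap "Suc i" "int (kap ! i) - int (Suc i) - int p"])
    show "- int (length kap) \<le> int (kap ! i) - int (Suc i) - int p"
      using small i iL b(2) assms(2) by (auto simp: bead_def part_def)
    fix j assume j: "j < length kap"
    show "int (kap ! j) - int (j + 1) \<noteq> int (kap ! i) - int (Suc i) - int p"
    proof
      assume "int (kap ! j) - int (j + 1) = int (kap ! i) - int (Suc i) - int p"
      then have "bead N kap j = b - p" using i iL j b(2) assms(2) by (auto simp: bead_def part_def)
      then show False using no j assms(2) by (metis imageI lessThan_iff order_less_le_trans)
    qed
  qed (use assms iL in auto)
  then show False using assms(3) by blast
qed

text \<open>Within a residue class a closed set is an initial segment. Two initial segments are
  comparable, so equal size makes them equal.\<close>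

lemma closed_sets_eq:
  fixes A B :: "nat set"
  assumes "finite A" "finite B" "0 < p"
    and A: "\<And>x. x \<in> A \<Longrightarrow> p \<le> x \<Longrightarrow> x - p \<in> A" and B: "\<And>x. x \<in> B \<Longrightarrow> p \<le> x \<Longrightarrow> x - p \<in> B"
    and card: "\<And>r. card {x \<in> A. x mod p = r} = card {x \<in> B. x mod p = r}"
  shows "A = B"
proof -
  have down: "y \<in> C" if C: "\<And>x. x \<in> C \<Longrightarrow> p \<le> x \<Longrightarrow> x - p \<in> C" and x: "x \<in> C" "y \<le> x" "x mod p = y mod p"
    for C :: "nat set" and x y
  proof -
    obtain m where "x = y + p * m" using x by (metis mod_eq_nat2E)
    then show ?thesis using x(1)
    proof (induction m arbitrary: x)
      case (Suc m)
      have "x - p \<in> C" "x - p = y + p * m" using C[of x] Suc.prems by auto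
      then show ?case using Suc.IH by blast
    qed simp
  qed
  have "{x \<in> A. x mod p = r} = {x \<in> B. x mod p = r}" for r
  proof -
    let ?A = "{x \<in> A. x mod p = r}" and ?B = "{x \<in> B. x mod p = r}"
    have "?A \<subseteq> ?B \<or> ?B \<subseteq> ?A"
    proof (rule ccontr)
      assume "\<not> ?thesis"
      then obtain x y where x: "x \<in> ?A" "x \<notin> ?B" and y: "y \<in> ?B" "y \<notin> ?A" by blast
      show False
      proof (cases "x \<le> y")
        case True
        then show False using down[of B y x, OF B] x y by auto
      next
        case False
        then show False using down[of A x y, OF A] x y by auto
      qed
    qed
    then show ?thesis using card_subset_eq[of ?B ?A] card_subset_eq[of ?A ?B] card[of r] assms(1,2) by auto
  qed
  then show ?thesis by blast
qed

text \<open>Beads decrease strictly from row to row, so their set determines which bead belongs to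
  which row.\<close>

lemma partition_eq_of_beads:
  assumes "is_partition lam" "is_partition mu" "length lam \<le> N" "length mu \<le> N"
    "bead N lam ` {..<N} = bead N mu ` {..<N}"
  shows "lam = mu"
proof -
  have srt: "sorted (rev (map (bead N nu) [0..<N])) \<and> distinct (rev (map (bead N nu) [0..<N]))" if "is_partition nu" for nu
    using bead_strict_mono[OF that] inj_on_bead[OF that]
    by (auto simp: sorted_rev_iff_nth_mono distinct_map atLeast0LessThan le_less)
  have "rev (map (bead N lam) [0..<N]) = rev (map (bead N mu) [0..<N])"
    using srt assms by (intro sorted_distinct_set_unique) (auto simp: atLeast0LessThan)
  then have bead: "bead N lam i = bead N mu i" if "i < N" for i
    using that by (auto simp: map_eq_conv)
  have part: "part lam i = part mu i" if "i < N" for i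
    using bead[OF that] unfolding bead_def by linarith
  have le: "length nu \<le> length nu'" if "is_partition nu" "length nu \<le> N" "\<And>i. i < N \<Longrightarrow> part nu i = part nu' i" for nu nu'
  proof (rule ccontr)
    assume "\<not> ?thesis"
    then have l: "length nu' < length nu" by simp
    then have "nu ! length nu' \<in> set nu" by simp
    then have "0 < nu ! length nu'" using that(1) by (simp add: is_partition_def)
    then show False using that(3)[of "length nu'"] that(2) l by (simp add: part_def)
  qed
  have "length lam = length mu" using le[of lam mu] le[of mu lam] part assms by auto
  then show ?thesis
  proof (rule nth_equalityI)
    fix i assume "i < length lam"
    then show "lam ! i = mu ! i"
      using part[of i] assms(3) \<open>length lam = length mu\<close> by (simp add: part_def)
  qed
qed


text \<open>Here \<open>a\<close> and \<open>c\<close> are the sides of a rectangle reduced modulo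
  \<open>p\<close>. Its largest hook has \<open>a + c - 1\<close> nodes, so for
  \<open>a + c \<le> p\<close> it is its own core.\<close>

definition core_size :: "nat \<Rightarrow> nat \<Rightarrow> nat \<Rightarrow> nat" where
  "core_size p a c = (if a + c \<le> p then a * c else (p - a) * (p - c))"

text \<open>The position of the \<open>i\<close>-th bead in the core of an \<open>r \<times> c\<close> rectangle (up to reordering).\<close>

definition core_bead :: "nat \<Rightarrow> nat \<Rightarrow> nat \<Rightarrow> nat" where
  "core_bead p c i = p * (i div p) + (c + i) mod p"

text \<open>The induction step of \<open>sum_core_bead\<close>: with \<open>a = r mod p\<close>, the
  bead of index \<open>r\<close> contributes
  \<open>core_bead p c r - r = (c + a) mod p - a\<close>.\<close>

lemma core_size_Suc:
  assumes "c < p" "2 \<le> p" "a < p"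
  shows "int (core_size p (Suc a mod p) c) = int (core_size p a c) + int ((c + a) mod p) - int a"
proof -
  have m: "(c + a) mod p = (if c + a < p then c + a else c + a - p)"
    using assms by (auto simp: mod_if)
  show ?thesis
  proof (cases "Suc a = p")
    case True
    then have a: "a = p - 1" by simp
    consider "c = 0" | "c = 1" | "2 \<le> c" by linarith
    then show ?thesis
    proof cases
      case 1
      then show ?thesis using True a assms by (auto simp: core_size_def m)
    next
      case 2
      then show ?thesis using True a assms by (auto simp: core_size_def m)
    next
      case 3
      then have "core_size p a c = p - c" using a assms by (auto simp: core_size_def)
      moreover have "(c + a) mod p = c - 1" using m a 3 assms by auto
      moreover have "core_size p (Suc a mod p) c = 0" using True assms by (simp add: core_size_def)
      ultimately show ?thesis using a assms 3 by (simp add: of_nat_diff)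
    qed
  next
    case False
    then have s: "Suc a mod p = Suc a" using assms by simp
    obtain u where u: "p = a + Suc u" using assms(3) by (metis less_imp_Suc_add add_Suc_right)
    obtain v where v: "p = c + v" using assms(1) by (metis less_imp_add_positive)
    consider "a + c < p" | "a + c = p" | "p < a + c" by linarith
    then show ?thesis
    proof cases
      case 1
      then show ?thesis unfolding s by (simp add: core_size_def m)
    next
      case 2
      then have "core_size p a c = a * Suc u" "core_size p (Suc a) c = u * a" "(c + a) mod p = 0"
        using u v by (auto simp: core_size_def m)
      then show ?thesis unfolding s by (simp add: algebra_simps)
    next
      case 3
      have "core_size p a c = Suc u * v" "core_size p (Suc a) c = u * v" "(c + a) mod p = c + a - p"
      proof -
        have pv: "p - a = Suc u" "p - Suc a = u" "p - c = v" using u v by auto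
        show "core_size p a c = Suc u * v" "core_size p (Suc a) c = u * v"
          using 3 by (simp_all add: core_size_def pv)
        show "(c + a) mod p = c + a - p" using 3 m by simp
      qed
      moreover have "int (c + a - p) = int c + int a - int p" using 3 by simp
      ultimately show ?thesis unfolding s using v by simp
    qed
  qed
qed

lemma sum_core_bead:
  assumes "c < p" "2 \<le> p"
  shows "(\<Sum>i<r. core_bead p c i) = (\<Sum>i<r. i) + core_size p (r mod p) c"
proof -
  have "int (\<Sum>i<r. core_bead p c i) = int (\<Sum>i<r. i) + int (core_size p (r mod p) c)"
  proof (induction r)
    case 0
    then show ?case by (auto simp: core_size_def)
  next
    case (Suc r)
    have "int (core_size p (Suc (r mod p) mod p) c) =
        int (core_size p (r mod p) c) + int ((c + r mod p) mod p) - int (r mod p)"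
      by (rule core_size_Suc) (use assms in auto)
    moreover have "int r = int (p * (r div p)) + int (r mod p)"
      by (metis mult_div_mod_eq of_nat_add)
    ultimately show ?case using Suc by (simp add: core_bead_def mod_Suc_eq mod_add_right_eq)
  qed
  then show ?thesis by linarith
qed

lemma inj_core_bead: "0 < p \<Longrightarrow> inj (core_bead p c)"
proof (rule injI)
  fix i j assume p: "0 < p" and eq: "core_bead p c i = core_bead p c j"
  have d: "core_bead p c i div p = i div p" "core_bead p c i mod p = (c + i) mod p" for i
    using p by (simp_all add: core_bead_def)
  have "i div p = j div p" "(c + i) mod p = (c + j) mod p" using d eq by metis+
  moreover from this(2) have "[i = j] (mod p)" by (simp add: cong_def[symmetric] cong_add_lcancel_nat)
  ultimately show "i = j" by (metis cong_def div_mult_mod_eq)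
qed

lemma core_bead_closed:
  assumes "0 < p" "x \<in> core_bead p c ` {..<r}" "p \<le> x"
  shows "x - p \<in> core_bead p c ` {..<r}"
proof -
  obtain i where i: "i < r" "x = core_bead p c i" using assms by auto
  have "p \<le> i"
  proof (rule ccontr)
    assume "\<not> p \<le> i"
    then have "x = (c + i) mod p" using i by (simp add: core_bead_def)
    then show False using assms by (metis mod_less_divisor not_le)
  qed
  then obtain j where j: "i = j + p" by (metis le_add_diff_inverse2)
  have "(j + p) div p = Suc (j div p)" using assms(1) div_add_self2[of p j] by simp
  then have "x - p = core_bead p c j" using i j by (simp add: core_bead_def add.assoc[symmetric])
  then show ?thesis using i j by auto
qed

text \<open>The row ends of the block \<open>(l, a)\<close> have contents \<open>l - a\<close> to
  \<open>l - 1\<close>. Those of the next block start at \<open>m - b - a\<close>, which is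
  congruent to \<open>l\<close> by the JS condition, so the residues continue without a gap. The
  shift \<open>k\<close> accounts for the rows above the current tail.\<close>

lemma sum_js_blocks:
  fixes f :: "int \<Rightarrow> int"
  assumes "js_blocks p bs" "\<And>x y. [x = y] (mod int p) \<Longrightarrow> f x = f y" "bs \<noteq> []"
  shows "(\<Sum>i<rows bs. f (int (expand_blocks bs ! i) - int (i + 1) - k)) =
    (\<Sum>i<rows bs. f (block_type bs + int i - k))"
  using assms
proof (induction bs arbitrary: k)
  case (Cons x bs)
  obtain l a where x: "x = (l, a)" by (cases x)
  have split: "(\<Sum>i<a + n. h i) = (\<Sum>i<a. h i) + (\<Sum>i<n. h (a + i))" for h :: "nat \<Rightarrow> int" and n
    by (induction n) auto
  have "(\<Sum>i<rows (x # bs). f (int (expand_blocks (x # bs) ! i) - int (i + 1) - k)) =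
     (\<Sum>i<a. f (int l - int (i + 1) - k)) +
     (\<Sum>i<rows bs. f (int (expand_blocks bs ! i) - int (i + 1) - (k + int a)))"
    unfolding x rows_simps split
    by (intro arg_cong2[where f = "(+)"] sum.cong) (auto simp: nth_append algebra_simps)
  also have "(\<Sum>i<a. f (int l - int (i + 1) - k)) = (\<Sum>i<a. f (block_type (x # bs) + int i - k))"
  proof -
    have "(\<Sum>i<a. f (int l - int (i + 1) - k)) = (\<Sum>i<a. f (int l - int (a - Suc i + 1) - k))"
      by (rule sum.nat_diff_reindex[symmetric])
    also have "\<dots> = (\<Sum>i<a. f (block_type (x # bs) + int i - k))"
      by (rule sum.cong) (auto simp: x block_type_def of_nat_diff algebra_simps)
    finally show ?thesis .
  qed
  also have "(\<Sum>i<rows bs. f (int (expand_blocks bs ! i) - int (i + 1) - (k + int a))) =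
      (\<Sum>i<rows bs. f (block_type (x # bs) + int (a + i) - k))"
  proof (cases bs)
    case Nil
    then show ?thesis by simp
  next
    case (Cons y ys)
    obtain m b where y: "y = (m, b)" by (cases y)
    have "(\<Sum>i<rows bs. f (int (expand_blocks bs ! i) - int (i + 1) - (k + int a))) =
        (\<Sum>i<rows bs. f (block_type bs + int i - (k + int a)))"
      by (rule Cons.IH) (use Cons.prems js_blocks_tl Cons in auto)
    also have "\<dots> = (\<Sum>i<rows bs. f (block_type (x # bs) + int (a + i) - k))"
    proof (rule sum.cong[OF refl], rule Cons.prems(2))
      fix i
      have "int p dvd int (l + a + b - m)"
        using Cons.prems(1) x y Cons by (simp only: int_dvd_int_iff js_blocks.simps)
      moreover have "m < l" using Cons.prems(1) x y Cons by simp
      then have "int (l + a + b - m) =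
          block_type (x # bs) + int (a + i) - k - (block_type bs + int i - (k + int a))"
        by (auto simp: x y Cons block_type_def)
      ultimately have "[block_type (x # bs) + int (a + i) - k = block_type bs + int i - (k + int a)] (mod int p)"
        unfolding cong_iff_dvd_diff by metis
      then show "[block_type bs + int i - (k + int a) = block_type (x # bs) + int (a + i) - k] (mod int p)"
        by (rule cong_sym)
    qed
    finally show ?thesis .
  qed
  finally show ?case unfolding x rows_simps split .
qed simp

lemma core_exists:
  assumes "0 < p" "is_partition lam"
  shows "\<exists>kap. (removes_rim_hook p)\<^sup>*\<^sup>* lam kap \<and> (\<nexists>mu. removes_rim_hook p kap mu)"
  using assms(2)
proof (induction "sum_list lam" arbitrary: lam rule: less_induct)
  case less
  show ?case
  proof (cases "\<exists>mu. removes_rim_hook p lam mu")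
    case True
    then obtain mu where mu: "removes_rim_hook p lam mu" by blast
    have "sum_list mu < sum_list lam"
      using removes_rim_hook_sum(2)[OF less.prems mu, of "\<lambda>_. 0"] assms(1) by simp
    moreover have "is_partition mu" using mu by (simp add: removes_rim_hook_def)
    ultimately obtain kap where "(removes_rim_hook p)\<^sup>*\<^sup>* mu kap" "\<nexists>nu. removes_rim_hook p kap nu"
      using less.hyps by blast
    then show ?thesis using mu by (meson converse_rtranclp_into_rtranclp)
  qed blast
qed

lemma card_filter_image:
  fixes f :: "nat \<Rightarrow> 'a"
  assumes "inj_on f {..<N}"
  shows "int (card {x \<in> f ` {..<N}. P x}) = (\<Sum>i<N. if P (f i) then 1 else 0)"
proof -
  have "{x \<in> f ` {..<N}. P x} = f ` {i \<in> {..<N}. P (f i)}" by auto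
  moreover have "inj_on f {i \<in> {..<N}. P (f i)}" using assms by (rule inj_on_subset) auto
  ultimately have "card {x \<in> f ` {..<N}. P x} = card {i \<in> {..<N}. P (f i)}" by (simp add: card_image)
  moreover have "(\<Sum>i\<in>{i \<in> {..<N}. P (f i)}. 1 :: int) = (\<Sum>i<N. if P (f i) then 1 else 0)"
    by (rule sum.inter_filter) simp
  ultimately show ?thesis by simp
qed

lemma js_core_beads:
  assumes js: "js_blocks p bs" and p: "2 \<le> p" and ne: "bs \<noteq> []"
    and c: "int c = (block_type bs + int (rows bs)) mod int p"
    and kap: "(removes_rim_hook p)\<^sup>*\<^sup>* (expand_blocks bs) kap" "\<nexists>mu. removes_rim_hook p kap mu"
  shows "is_partition kap" "length kap \<le> rows bs"
    "bead (rows bs) kap ` {..<rows bs} = core_bead p c ` {..<rows bs}"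
proof -
  define r where "r = rows bs"
  let ?lam = "expand_blocks bs"
  have lam: "is_partition ?lam" using is_partition_expand_js js by blast
  have inv: "is_partition kap \<and> length kap \<le> r \<and>
      (\<Sum>i<r. f (int (bead r kap i))) = (\<Sum>i<r. f (int (bead r ?lam i)))"
    if "\<And>z. f (z - int p) = f z" for f :: "int \<Rightarrow> int"
    by (rule removes_rim_hook_beads[OF kap(1) lam]) (use that in \<open>auto simp: r_def\<close>)
  from inv[of "\<lambda>_. 0"] have kp: "is_partition kap" "length kap \<le> r" by auto
  have "card {x \<in> bead r kap ` {..<r}. x mod p = q} = card {x \<in> core_bead p c ` {..<r}. x mod p = q}" for q
  proof -
    \<comment> \<open>The indicator of a residue class is periodic, so its sum over the beads, the
      number of beads in class \<open>q\<close>, survives hook removal.\<close>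
    define f where "f z = (if z mod int p = int q then 1 else 0 :: int)" for z
    have fcong: "f x = f y" if "[x = y] (mod int p)" for x y using that by (simp add: f_def cong_def)
    have fint: "f (int n) = (if n mod p = q then 1 else 0)" for n
      by (simp add: f_def flip: zmod_int)
    have "int (card {x \<in> bead r kap ` {..<r}. x mod p = q}) = (\<Sum>i<r. f (int (bead r kap i)))"
      by (simp add: card_filter_image[OF inj_on_bead[OF kp(1)]] fint)
    also have "\<dots> = (\<Sum>i<r. f (int (bead r ?lam i)))"
      using inv[of f] by (simp add: f_def)
    also have "\<dots> = (\<Sum>i<r. f (int (?lam ! i) - int (i + 1) - (- int r)))"
      by (rule sum.cong) (auto simp: bead_def part_def r_def of_nat_diff algebra_simps)
    also have "\<dots> = (\<Sum>i<r. f (block_type bs + int i - (- int r)))"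
      unfolding r_def by (rule sum_js_blocks[OF js _ ne]) (rule fcong)
    also have "\<dots> = (\<Sum>i<r. f (int (core_bead p c i)))"
    proof (rule sum.cong[OF refl], rule fcong)
      fix i
      have "[int (core_bead p c i) = int (c + i)] (mod int p)"
        by (simp add: core_bead_def cong_def zmod_int)
      moreover have "[int c = block_type bs + int r] (mod int p)" using c by (simp add: cong_def r_def)
      then have "[int c + int i = block_type bs + int r + int i] (mod int p)" by (rule cong_add) simp
      ultimately show "[block_type bs + int i - (- int r) = int (core_bead p c i)] (mod int p)"
        by (simp add: cong_def algebra_simps)
    qed
    also have "\<dots> = int (card {x \<in> core_bead p c ` {..<r}. x mod p = q})"
      using inj_on_subset[OF inj_core_bead] p by (subst card_filter_image) (auto simp: fint)
    finally show ?thesis by simp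
  qed
  then have "bead r kap ` {..<r} = core_bead p c ` {..<r}"
    using core_beads_closed[OF kp kap(2)] core_bead_closed[of p _ c r] p
    by (intro closed_sets_eq[of _ _ p]) auto
  then show "is_partition kap" "length kap \<le> rows bs"
    "bead (rows bs) kap ` {..<rows bs} = core_bead p c ` {..<rows bs}"
    using kp by (auto simp: r_def)
qed

text \<open>All partitions at which hook removal can stop have the same beads and hence coincide, so
  the description in \<open>p_core\<close> denotes one of them.\<close>

lemma js_core:
  assumes js: "js_blocks p bs" and p: "2 \<le> p" and ne: "bs \<noteq> []"
    and c: "int c = (block_type bs + int (rows bs)) mod int p"
  shows "sum_list (p_core p (expand_blocks bs)) = core_size p (rows bs mod p) c"
    and "\<exists>n. sum_list (expand_blocks bs) = sum_list (p_core p (expand_blocks bs)) + p * n"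
proof -
  define r where "r = rows bs"
  let ?lam = "expand_blocks bs"
  let ?nf = "\<lambda>kap. (removes_rim_hook p)\<^sup>*\<^sup>* ?lam kap \<and> (\<nexists>mu. removes_rim_hook p kap mu)"
  have lam: "is_partition ?lam" using is_partition_expand_js js by blast
  obtain kap where kap: "?nf kap" using core_exists[OF _ lam, of p] p by auto
  have uniq: "kap' = kap" if "?nf kap'" for kap'
    using js_core_beads[OF js p ne c, of kap] js_core_beads[OF js p ne c, of kap'] that kap
    by (intro partition_eq_of_beads[of _ _ "rows bs"]) auto
  have core: "p_core p ?lam = kap"
    unfolding p_core_def by (rule the_equality, rule kap, rule uniq)
  note b = js_core_beads[OF js p ne c conjunct1[OF kap] conjunct2[OF kap]]
  have "int c < int p" unfolding c by (rule pos_mod_bound) (use p in simp)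
  then have cp: "c < p" by simp
  have "sum_list kap + (\<Sum>i<r. i) = (\<Sum>i<r. bead r kap i)" using bead_sum b(2) by (simp add: r_def)
  also have "\<dots> = \<Sum> (bead r kap ` {..<r})" by (simp add: sum.reindex[OF inj_on_bead[OF b(1)]])
  also have "\<dots> = (\<Sum>i<r. core_bead p c i)"
    using b(3) sum.reindex[OF inj_on_subset[OF inj_core_bead subset_UNIV], of p "\<lambda>x. x" c "{..<r}"] p
    by (simp add: r_def)
  also have "\<dots> = (\<Sum>i<r. i) + core_size p (r mod p) c" by (rule sum_core_bead[OF cp p])
  finally show "sum_list (p_core p ?lam) = core_size p (rows bs mod p) c" by (simp add: core r_def)
  have "\<exists>n. sum_list ?lam = sum_list kap + p * n" using conjunct1[OF kap]
  proof (induction rule: rtranclp_induct)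
    case base
    then show ?case by (intro exI[of _ 0]) simp
  next
    case (step mu nu)
    then obtain n where n: "sum_list ?lam = sum_list mu + p * n" by blast
    have "is_partition mu" using removes_rim_hook_beads[OF step.hyps(1) lam, of "rows bs" "\<lambda>_. 0"] by simp
    then have "sum_list nu + p = sum_list mu" using removes_rim_hook_sum(2)[OF _ step.hyps(2), of "\<lambda>_. 0"] by simp
    then show ?case using n by (intro exI[of _ "Suc n"]) simp
  qed
  then show "\<exists>n. sum_list ?lam = sum_list (p_core p ?lam) + p * n" by (simp add: core)
qed

section \<open>The weight formula\<close>

text \<open>Complementing both sides exchanges \<open>a + c < p\<close> with
  \<open>a + c > p\<close> and thereby the two formulas, which agree for \<open>a + c = p\<close>.
  If a side is 0, both sizes are 0.\<close>

lemma core_size_swap: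
  assumes "a < p" "c < p"
  shows "core_size p ((p - c) mod p) ((p - a) mod p) = core_size p a c"
proof -
  consider "a = 0" | "c = 0" | "0 < a" "0 < c" by linarith
  then show ?thesis
  proof cases
    case 3
    then have "(p - c) mod p = p - c" "(p - a) mod p = p - a" using assms by auto
    moreover have "p - a + (p - c) \<le> p \<longleftrightarrow> p \<le> a + c" using assms by linarith
    moreover have "p - a = c" "p - c = a" if "a + c = p" using that by auto
    ultimately show ?thesis using assms by (auto simp: core_size_def add.commute mult.commute)
  qed (use assms in \<open>auto simp: core_size_def\<close>)
qed

lemma mod_eq_of_int_diff: "int m - int n = int p * k \<Longrightarrow> m mod p = n mod p"
  by (metis cong_def cong_iff_dvd_diff cong_int_iff dvd_triv_left)

text \<open>Either the rectangle loses the \<open>a + c - 1 = t\<close> nodes of a border hook, or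
  it gains \<open>p - t\<close> nodes: this happens for \<open>a + c > p\<close>, where the
  complementary rectangle grows, and when a side wraps around from 0 to
  \<open>p - 1\<close>.\<close>

lemma core_size_pred:
  assumes "a < p" "c < p" "2 \<le> p" "0 < t" "t < p" "[int a + int c = int t + 1] (mod int p)"
  defines "a' \<equiv> (a + p - 1) mod p" and "c' \<equiv> (c + p - 1) mod p"
  shows "int t + int (core_size p a' c') = int (core_size p a c) +
    (if core_size p a c < core_size p a' c' then int p else 0)"
proof -
  have pred: "(n + p - 1) mod p = (if n = 0 then p - 1 else n - 1)" if "n < p" for n
    using that assms(3) by (auto simp: mod_if)
  have dv: "int p dvd int a + int c - int t - 1" using assms(6) by (simp add: cong_iff_dvd_diff algebra_simps)
  then obtain k where k: "int a + int c - int t - 1 = int p * k" by auto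
  have "- int p \<le> int p * k" "int p * k < int p * 2" using k assms by linarith+
  then have "-1 \<le> k" "k < 2" using assms(3) by (auto simp: mult_less_cancel_left_pos)
     (metis mult.commute mult_le_cancel_right_pos mult_minus1 of_nat_0_less_iff order_less_le_trans zero_less_numeral)
  then consider "k = -1" | "k = 0" | "k = 1" by linarith
  then show ?thesis
  proof cases
    case 1
    then have "a = 0" "c = 0" "t = p - 1" using k assms by auto
    then have "a' = p - 1" "c' = p - 1" using pred[of 0] assms(3) by (auto simp: a'_def c'_def)
    moreover have "core_size p (p - 1) (p - 1) = 1" using assms(3) by (auto simp: core_size_def)
    ultimately show ?thesis using \<open>a = 0\<close> \<open>t = p - 1\<close> assms(3) by (simp add: core_size_def of_nat_diff)
  next
    case 2
    then have t: "a + c = t + 1" using k by simp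
    consider "a = 0" | "c = 0" | x y where "a = Suc x" "c = Suc y" by (metis not0_implies_Suc)
    then show ?thesis
    proof cases
      case 1
      then have "a' = p - 1" "c' = t" using pred assms t by (auto simp: a'_def c'_def)
      moreover have "core_size p (p - 1) t = p - t"
        using assms by (cases "t = 1") (auto simp: core_size_def)
      ultimately show ?thesis using 1 assms by (simp add: core_size_def of_nat_diff)
    next
      case 2
      then have "c' = p - 1" "a' = t" using pred assms t by (auto simp: a'_def c'_def)
      moreover have "core_size p t (p - 1) = p - t"
        using assms by (cases "t = 1") (auto simp: core_size_def)
      ultimately show ?thesis using 2 assms by (simp add: core_size_def of_nat_diff)
    next
      case (3 x y)
      then have "a' = x" "c' = y" using pred assms by (auto simp: a'_def c'_def)
      then show ?thesis using 3 t assms by (auto simp: core_size_def)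
    qed
  next
    case 3
    then have t: "a + c = t + 1 + p" using k by simp
    obtain u where u: "p = a + u" using assms(1) by (metis less_imp_add_positive)
    obtain v where v: "p = c + v" using assms(2) by (metis less_imp_add_positive)
    have ac: "0 < a" "0 < c" using t assms by linarith+
    have eq: "a' = a - 1" "c' = c - 1" using pred assms ac by (auto simp: a'_def c'_def)
    have d: "p - a = u" "p - c = v" "p - (a - 1) = Suc u" "p - (c - 1) = Suc v" using u v ac by auto
    have 1: "core_size p a c = u * v" using t by (simp add: core_size_def d)
    \<comment> \<open>Since \<open>a - 1 + (c - 1) = p + t - 1\<close>, the first case is the
      boundary \<open>t = 1\<close>, where both formulas agree.\<close>
    have 2: "core_size p a' c' = Suc u * Suc v"
    proof (cases "a - 1 + (c - 1) \<le> p")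
      case True
      then have "a - 1 = Suc v" "c - 1 = Suc u" using t assms u v by linarith+
      then show ?thesis using True eq by (simp add: core_size_def)
    next
      case False
      then show ?thesis unfolding core_size_def eq d(3,4) by (rule if_not_P)
    qed
    have "t + u + v + 1 = p" using t u v by linarith
    then show ?thesis unfolding 1 2 by simp
  qed
qed

text \<open>Losing \<open>s\<close> rows lowers both sides by \<open>s\<close> modulo
  \<open>p\<close>, and \<open>sg\<close> is congruent to \<open>a + c\<close>. For
  \<open>s = 1\<close> this is \<open>core_size_pred\<close>. For \<open>s\<close> congruent to
  \<open>a + c\<close> the sides become \<open>- c\<close> and \<open>- a\<close>, which is
  \<open>core_size_swap\<close>. For \<open>s = t\<close>, congruent to \<open>a + c - 1\<close>, it
  is both in succession.\<close>

lemma core_size_step: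
  assumes p: "2 \<le> p" and e: "end_relation p (al + 2 * int r) t s" and r: "r' + s = r"
    and c: "int c = (al + int r) mod int p" and c': "int c' = (al + int r') mod int p"
  shows "int t + int (core_size p (r' mod p) c') = int (core_size p (r mod p) c) +
    (if core_size p (r mod p) c < core_size p (r' mod p) c' then int p else 0)"
proof -
  define a where "a = r mod p"
  have a: "a < p" using p by (simp add: a_def)
  have lt: "c < p" "c' < p"
  proof -
    have "int c < int p" "int c' < int p" unfolding c c' by (rule pos_mod_bound, use p in simp)+
    then show "c < p" "c' < p" by auto
  qed
  have c'_mod: "c' mod p = c'" using lt by simp
  have r_int: "int r' = int r - int s" using r by simp
  have "[int a = int r] (mod int p)" by (simp add: a_def cong_def zmod_int)
  then obtain k1 where k1: "int a = int r + int p * k1"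
    by (metis cong_iff_lin cong_sym)
  have "[al + int r = int c] (mod int p)" using c by (simp add: cong_def)
  then obtain k2 where k2: "int c = al + int r + int p * k2"
    by (metis cong_iff_lin)
  have "[al + int r' = int c'] (mod int p)" using c' by (simp add: cong_def)
  then obtain k3 where k3: "int c' = al + int r' + int p * k3"
    by (metis cong_iff_lin)
  have tp: "t < p" using e by (simp add: end_relation_def)
  define a1 where "a1 = (a + p - 1) mod p"
  define c1 where "c1 = (c + p - 1) mod p"
  have lt1: "a1 < p" "c1 < p" using p by (auto simp: a1_def c1_def)
  have "[int (a + p - 1) = int a1] (mod int p)" by (simp add: a1_def cong_def zmod_int)
  then obtain k5 where "int a1 = int (a + p - 1) + int p * k5" by (metis cong_iff_lin)
  then have k5: "int a1 = int a - 1 + int p * (k5 + 1)" using p by (simp add: of_nat_diff algebra_simps)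
  have "[int (c + p - 1) = int c1] (mod int p)" by (simp add: c1_def cong_def zmod_int)
  then obtain k6 where "int c1 = int (c + p - 1) + int p * k6" by (metis cong_iff_lin)
  then have k6: "int c1 = int c - 1 + int p * (k6 + 1)" using p by (simp add: of_nat_diff algebra_simps)
  have pred: "int t + int (core_size p a1 c1) = int (core_size p a c) +
    (if core_size p a c < core_size p a1 c1 then int p else 0)"
    if t: "0 < t" "[al + 2 * int r - 1 = int t] (mod int p)"
    unfolding a1_def c1_def
  proof (rule core_size_pred)
    obtain k4 where k4: "int t = al + 2 * int r - 1 + int p * k4" using t(2) by (metis cong_iff_lin)
    have "int a + int c - (int t + 1) = int p * (k1 + k2 - k4)"
      using k1 k2 k4 by (simp add: algebra_simps)
    then show "[int a + int c = int t + 1] (mod int p)" by (simp add: cong_iff_dvd_diff)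
  qed (use a lt p t tp in auto)
  consider "t = 0" "s = 0" | "t = 0" "[al + 2 * int r = int s] (mod int p)"
    | "0 < t" "[al + 2 * int r - 1 = int t] (mod int p)" "s = 1"
    | "0 < t" "[al + 2 * int r - 1 = int t] (mod int p)" "s = t"
    using e by (auto simp: end_relation_def cong_sym_eq)
  then show ?thesis
  proof cases
    case 1
    then have "r' = r" "int c = int c'" using r c c' by auto
    then show ?thesis using 1 by simp
  next
    case 2
    then obtain k4 where k4: "int s = al + 2 * int r + int p * k4" by (metis cong_iff_lin)
    have "r' mod p = (p - c) mod p"
      by (rule mod_eq_of_int_diff[where k = "k2 - k4 - 1"])
        (use k2 k4 r_int lt in \<open>simp add: of_nat_diff algebra_simps\<close>)
    moreover have "c' mod p = (p - a) mod p"
      by (rule mod_eq_of_int_diff[where k = "k3 - 1 + k1 - k4"])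
        (use k1 k3 k4 r_int a in \<open>simp add: of_nat_diff algebra_simps\<close>)
    ultimately show ?thesis using core_size_swap[of a p c] a lt 2 c'_mod by (simp add: a_def)
  next
    case 3
    have "r' mod p = (a + p - 1) mod p"
      by (rule mod_eq_of_int_diff[where k = "- k1 - 1"])
        (use k1 3 r_int p in \<open>simp add: of_nat_diff algebra_simps\<close>)
    moreover have "c' mod p = (c + p - 1) mod p"
      by (rule mod_eq_of_int_diff[where k = "k3 - k2 - 1"])
        (use k2 k3 3 r_int p in \<open>simp add: of_nat_diff algebra_simps\<close>)
    ultimately show ?thesis using pred[OF 3(1,2)] c'_mod by (simp add: a_def a1_def c1_def)
  next
    case 4
    obtain k4 where k4: "int t = al + 2 * int r - 1 + int p * k4" using 4(2) by (metis cong_iff_lin)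
    have "r' mod p = (p - c1) mod p"
      by (rule mod_eq_of_int_diff[where k = "k2 - k4 + k6"])
        (use k2 k4 k6 r_int lt1 4 in \<open>simp add: of_nat_diff algebra_simps\<close>)
    moreover have "c' mod p = (p - a1) mod p"
      by (rule mod_eq_of_int_diff[where k = "k3 + k1 - k4 + k5"])
        (use k1 k3 k4 k5 r_int lt1 4 in \<open>simp add: of_nat_diff algebra_simps\<close>)
    ultimately show ?thesis
      using pred[OF 4(1,2)] core_size_swap[OF lt1] c'_mod by (simp add: a_def)
  qed
qed

text \<open>Subtracting core sizes from \<open>sum_list lam = sum_list mu + p * q + t\<close>
  (\<open>mu\<close> being \<open>lam\<close> peeled), \<open>core_size_step\<close> replaces
  \<open>t\<close> by a multiple of \<open>p\<close>, and dividing by \<open>p\<close> gives the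
  claim.\<close>

lemma peel_weight_step:
  assumes js: "js_blocks p bs" and p: "2 \<le> p" and ne: "bs \<noteq> []"
  defines "cs \<equiv> proper_blocks (peel_blocks p bs)"
  shows "int (p_weight p (expand_blocks bs)) =
    (if cs = [] then 0 else int (p_weight p (expand_blocks cs)) +
      (if sum_list (p_core p (expand_blocks bs)) < sum_list (p_core p (expand_blocks cs)) then 1 else 0))
    + int (full_segments p bs)"
proof -
  define al where "al = block_type bs"
  define c where "c = nat ((al + int (rows bs)) mod int p)"
  define c' where "c' = nat ((al + int (rows cs)) mod int p)"
  have c: "int c = (al + int (rows bs)) mod int p" and c': "int c' = (al + int (rows cs)) mod int p"
    using p by (auto simp: c_def c'_def)
  note core = js_core[OF js p ne c[unfolded al_def]]
  obtain n where n: "sum_list (expand_blocks bs) = sum_list (p_core p (expand_blocks bs)) + p * n"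
    using core(2) by blast
  have w: "p_weight p (expand_blocks bs) = n" using n p by (simp add: p_weight_def)
  have rows: "rows cs + lost_rows p bs = rows bs" using rows_peel_blocks[OF js p] by (simp add: cs_def)
  note step = core_size_step[OF p end_relation_blocks[OF js p ne, folded al_def] rows c c']
  have sum: "sum_list (expand_blocks bs) = sum_list (expand_blocks cs) + p * full_segments p bs + short_segment p bs"
    using strip_rim_expand_js[OF js p]
    by (simp add: cs_def filter_expand_blocks[symmetric] sum_list_filter_pos)
  let ?q = "full_segments p bs" and ?K = "core_size p (rows bs mod p) c" and ?K' = "core_size p (rows cs mod p) c'"
  show ?thesis
  proof (cases "cs = []")
    case True
    then have "?K' = 0" by (simp add: core_size_def)
    then have "short_segment p bs = ?K" using step by simp
    then have "p * n = p * ?q" using n sum core(1) True by auto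
    then show ?thesis using w p True by simp
  next
    case False
    have js': "js_blocks p cs" using js_peel_blocks js p by (simp add: cs_def)
    have "[block_type cs = al] (mod int p)" using block_type_peel[OF js p] False by (simp add: cs_def al_def)
    then have "[block_type cs + int (rows cs) = al + int (rows cs)] (mod int p)" by (rule cong_add) simp
    then have "int c' = (block_type cs + int (rows cs)) mod int p" using c' by (simp add: cong_def)
    note core' = js_core[OF js' p False this]
    obtain n' where n': "sum_list (expand_blocks cs) = sum_list (p_core p (expand_blocks cs)) + p * n'"
      using core'(2) by blast
    have w': "p_weight p (expand_blocks cs) = n'" using n' p by (simp add: p_weight_def)
    define e where "e = (if ?K < ?K' then 1 else 0 :: int)"
    have "int ?K + int (p * n) = int ?K' + int (p * n') + int (p * ?q) + int (short_segment p bs)"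
      using n n' sum core(1) core'(1) by linarith
    then have "int p * int n = int p * (int n' + int ?q + e)"
      using step by (simp add: e_def algebra_simps split: if_splits)
    then have "int n = int n' + int ?q + e" using p by simp
    then show ?thesis using w w' False core(1) core'(1) by (simp add: e_def)
  qed
qed

lemma symbol_column_expand:
  assumes "js_blocks p bs" "2 \<le> p"
  shows "symbol_column p (expand_blocks bs) =
    ((int (short_segment p bs) - int (rows bs)) mod int p, (1 - int (rows bs)) mod int p)"
  using length_p_rim_expand_js[OF assms] by (simp add: symbol_column_def add_diff_eq[symmetric])

lemma column_length_mod:
  fixes x y :: int
  shows "(x mod m - y mod m + 1) mod m = (x - y + 1) mod m"
  by (metis mod_add_left_eq mod_diff_eq)

text \<open>In a column, \<open>x - y + 1\<close> is the \<open>p\<close>-rim length modulo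
  \<open>p\<close>, which is the short segment; the difference of the \<open>y\<close> entries is
  the number of lost rows. All are below \<open>p\<close>, so reduction recovers them
  exactly.\<close>

lemma d_step_expand:
  assumes js: "js_blocks p bs" and p: "2 \<le> p" and ne: "bs \<noteq> []"
  defines "cs \<equiv> proper_blocks (peel_blocks p bs)"
  assumes ne': "cs \<noteq> []"
  shows "d_step p (symbol_column p (expand_blocks cs)) (symbol_column p (expand_blocks bs)) =
    int (segment_gain p (short_segment p cs) (short_segment p bs) (lost_rows p bs))"
proof -
  have js': "js_blocks p cs" using js_peel_blocks js p by (simp add: cs_def)
  let ?t = "short_segment p bs" and ?t' = "short_segment p cs" and ?s = "lost_rows p bs"
  have lt: "?t < p" "?s < p" "?t' < p"
    using end_relation_blocks[OF js p ne] end_relation_blocks[OF js' p ne'] by (auto simp: end_relation_def)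
  have rows: "rows cs + ?s = rows bs" using rows_peel_blocks[OF js p] by (simp add: cs_def)
  have t: "((int (short_segment p b) - int (rows b)) mod int p - (1 - int (rows b)) mod int p + 1) mod int p =
      int (short_segment p b)" if "short_segment p b < p" for b
    unfolding column_length_mod using that by simp
  have "((1 - int (rows cs)) mod int p - (1 - int (rows bs)) mod int p) mod int p = (int (rows bs) - int (rows cs)) mod int p"
    by (simp add: mod_diff_eq)
  also have "int (rows bs) - int (rows cs) = int ?s" using rows by linarith
  finally have s: "((1 - int (rows cs)) mod int p - (1 - int (rows bs)) mod int p) mod int p = int ?s"
    using lt by simp
  have "int (p - 1 + ?s - ?t) = int p - 1 + int ?s - int ?t" using lt by simp
  then show ?thesis
    unfolding symbol_column_expand[OF js p] symbol_column_expand[OF js' p] d_step_def Let_def prod.case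
      t[OF lt(1)] t[OF lt(3)] s
    by (auto simp: segment_gain_def zdiv_int algebra_simps)
qed

text \<open>After peeling nothing is left, so \<open>t' = 0\<close>, \<open>s = r\<close>, and the
  number of full segments is a single gain. It is 1 exactly for \<open>t = 0\<close>; then
  \<open>end_relation\<close> makes \<open>- r\<close> congruent to the type. Conversely, the column
  \<open>(al, al + 1)\<close> forces \<open>x - y + 1\<close>, and with it \<open>t\<close>, to be
  0.\<close>

lemma d_zero_expand:
  assumes js: "js_blocks p bs" and p: "2 \<le> p" and ne: "bs \<noteq> []"
    and Nil: "proper_blocks (peel_blocks p bs) = []" and al: "[al = block_type bs] (mod int p)"
  shows "d_zero p al (symbol_column p (expand_blocks bs)) = int (full_segments p bs)"
proof -
  let ?t = "short_segment p bs" and ?r = "rows bs"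
  have s: "lost_rows p bs = ?r" using rows_peel_blocks[OF js p] Nil by simp
  have r: "0 < ?r"
  proof -
    obtain l a bs' where "bs = (l, a) # bs'" using ne by (cases bs) auto
    then show ?thesis using js js_blocks_hd by fastforce
  qed
  have e: "end_relation p (block_type bs + 2 * int ?r) ?t ?r" using end_relation_blocks[OF js p ne] s by simp
  have q: "full_segments p bs = segment_gain p 0 ?t ?r"
    using peel_count[OF js p ne] Nil s by (simp add: peel_count_def)
  note g = segment_gain_simps[OF p]
  have dz: "d_zero p al (symbol_column p (expand_blocks bs)) =
      (if [int ?t - int ?r = al] (mod int p) \<and> [1 - int ?r = al + 1] (mod int p) then 1 else 0)"
    unfolding symbol_column_expand[OF js p] by (simp add: d_zero_def cong_def)
  show ?thesis
  proof (cases "?t = 0")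
    case True
    then have "[int ?r = block_type bs + 2 * int ?r] (mod int p)" using e r by (auto simp: end_relation_def)
    then have "int p dvd int ?r - (block_type bs + 2 * int ?r)" by (simp only: cong_iff_dvd_diff)
    moreover have "int ?r - (block_type bs + 2 * int ?r) = - int ?r - block_type bs" by simp
    ultimately have "int p dvd - int ?r - block_type bs" by metis
    then have "[- int ?r = block_type bs] (mod int p)" by (simp add: cong_iff_dvd_diff)
    then have "[- int ?r = al] (mod int p)" using al by (simp add: cong_def)
    moreover from this have "[- int ?r + 1 = al + 1] (mod int p)" by (rule cong_add) simp
    ultimately have "d_zero p al (symbol_column p (expand_blocks bs)) = 1" using dz True by simp
    moreover have "?r < p" using e by (simp add: end_relation_def)
    ultimately show ?thesis using q True g(3)[OF r] by simp
  next
    case False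
    have "\<not> ([int ?t - int ?r = al] (mod int p) \<and> [1 - int ?r = al + 1] (mod int p))"
    proof
      assume "[int ?t - int ?r = al] (mod int p) \<and> [1 - int ?r = al + 1] (mod int p)"
      then have "[int ?t - int ?r - (1 - int ?r) = al - (al + 1)] (mod int p)" by (intro cong_diff) auto
      then have "[int ?t - 1 + 1 = - 1 + 1] (mod int p)" by (intro cong_add) auto
      then have "int p dvd int ?t" by (simp add: cong_0_iff)
      moreover have "?t < p" using e by (simp add: end_relation_def)
      ultimately show False using False by (auto dest: nat_dvd_not_less)
    qed
    then have "d_zero p al (symbol_column p (expand_blocks bs)) = 0" unfolding dz by (rule if_not_P)
    moreover have "?r \<le> ?t" "?t < p" using e False by (auto simp: end_relation_def)
    ultimately show ?thesis using q False g(2)[of ?r ?t] by simp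
  qed
qed

lemma expand_blocks_eq_Nil: "js_blocks p bs \<Longrightarrow> expand_blocks bs = [] \<longleftrightarrow> bs = []"
  using js_blocks_hd by (cases bs) fastforce+

lemma d_coeff_append: "i < length R \<Longrightarrow> residue_symbol p lam = R @ S \<Longrightarrow> residue_symbol p mu = R \<Longrightarrow>
    d_coeff p al lam i = d_coeff p al mu i"
  by (cases i) (auto simp: d_coeff_def nth_append)

text \<open>The formula for \<open>full_segments\<close> is carried along because each weight step
  adds the full segments, that is, the sum of all \<open>d_coeff\<close> up to that index.\<close>

lemma js_weight:
  assumes "js_blocks p bs" "2 \<le> p" "p_regular p (expand_blocks bs)" "[al = block_type bs] (mod int p)"
    "length (residue_symbol p (expand_blocks bs)) = k + 1"
  shows "int (full_segments p bs) = (\<Sum>i = 0..k. d_coeff p al (expand_blocks bs) i) \<and>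
    int (p_weight p (expand_blocks bs)) =
      (\<Sum>i = 0..k. int (k + 1 - i) * d_coeff p al (expand_blocks bs) i) +
      (\<Sum>i = 1..k. e_coeff p (expand_blocks bs) i)"
  using assms
proof (induction k arbitrary: bs)
  case 0
  have ne: "bs \<noteq> []" using "0.prems"(5) by (auto simp: residue_symbol_Nil)
  let ?lam = "expand_blocks bs" and ?cs = "proper_blocks (peel_blocks p bs)"
  have part: "is_partition ?lam" "0 < p" "?lam \<noteq> []"
    using "0.prems" ne by (auto simp: is_partition_expand_js expand_blocks_eq_Nil)
  have R: "residue_symbol p ?lam = residue_symbol p (expand_blocks ?cs) @ [symbol_column p ?lam]"
    using residue_symbol_step[OF part(1,3,2)] remove_p_rim_expand_js[OF "0.prems"(1,2)] by simp
  have js': "js_blocks p ?cs" using js_peel_blocks "0.prems" by simp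
  have "residue_symbol p (expand_blocks ?cs) = []" using R "0.prems"(5) by simp
  then have cs: "?cs = []"
    using residue_symbol_eq_Nil_iff[OF is_partition_expand_js[OF js'] part(2)] expand_blocks_eq_Nil[OF js'] by simp
  then have R1: "residue_symbol p ?lam = [symbol_column p ?lam]" using R by (simp add: residue_symbol_Nil)
  have "d_coeff p al ?lam 0 = int (full_segments p bs)"
    using d_zero_expand[OF "0.prems"(1,2) ne cs "0.prems"(4)] R1 by (simp add: d_coeff_def)
  moreover have "int (p_weight p ?lam) = int (full_segments p bs)"
    using peel_weight_step[OF "0.prems"(1,2) ne] cs by simp
  ultimately show ?case by simp
next
  case (Suc k)
  have ne: "bs \<noteq> []" using Suc.prems(5) by (auto simp: residue_symbol_Nil)
  define cs where "cs = proper_blocks (peel_blocks p bs)"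
  let ?lam = "expand_blocks bs" and ?mu = "expand_blocks cs"
  have part: "is_partition ?lam" "0 < p" "?lam \<noteq> []"
    using Suc.prems ne by (auto simp: is_partition_expand_js expand_blocks_eq_Nil)
  have mu: "remove_p_rim p ?lam = ?mu" using remove_p_rim_expand_js[OF Suc.prems(1,2)] by (simp add: cs_def)
  have R: "residue_symbol p ?lam = residue_symbol p ?mu @ [symbol_column p ?lam]"
    using residue_symbol_step[OF part(1,3,2)] mu by simp
  have len: "length (residue_symbol p ?mu) = k + 1" using R Suc.prems(5) by simp
  then have ne': "cs \<noteq> []" by (auto simp: residue_symbol_Nil)
  have js': "js_blocks p cs" using js_peel_blocks Suc.prems by (simp add: cs_def)
  have reg': "p_regular p ?mu" using p_regular_remove_p_rim[OF Suc.prems(3,2)] mu by simp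
  have al': "[al = block_type cs] (mod int p)"
    using block_type_peel[OF Suc.prems(1,2)] ne' Suc.prems(4) by (simp add: cs_def cong_def)
  note IH = Suc.IH[OF js' Suc.prems(2) reg' al' len]
  have part': "is_partition ?mu" "?mu \<noteq> []"
    using js' ne' by (auto simp: is_partition_expand_js expand_blocks_eq_Nil)
  have R': "residue_symbol p ?mu = residue_symbol p (remove_p_rim p ?mu) @ [symbol_column p ?mu]"
    using residue_symbol_step[OF part' part(2)] .
  then have last: "residue_symbol p ?mu ! k = symbol_column p ?mu" using len by (simp add: nth_append)
  have d: "d_coeff p al ?lam i = d_coeff p al ?mu i" if "i \<le> k" for i
    by (rule d_coeff_append[OF _ R refl]) (use len that in simp)
  have dk: "d_coeff p al ?lam (Suc k) = d_step p (symbol_column p ?mu) (symbol_column p ?lam)"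
    using R len last by (simp add: d_coeff_def nth_append)
  then have dk: "d_coeff p al ?lam (Suc k) =
      int (segment_gain p (short_segment p cs) (short_segment p bs) (lost_rows p bs))"
    using d_step_expand[OF Suc.prems(1,2) ne] ne' by (simp add: cs_def)
  have "int (full_segments p bs) = int (full_segments p cs) + d_coeff p al ?lam (Suc k)"
    using peel_count[OF Suc.prems(1,2) ne] dk by (simp add: peel_count_def cs_def)
  also have "int (full_segments p cs) = (\<Sum>i = 0..k. d_coeff p al ?lam i)" using IH d by simp
  finally have q: "int (full_segments p bs) = (\<Sum>i = 0..Suc k. d_coeff p al ?lam i)" by simp
  have tr: "symbol_truncation p ?lam j = symbol_truncation p ?mu j" if "j \<le> k + 1" for j
    using symbol_truncation_remove_p_rim[OF part(1,3,2)] that len mu by simp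
  have e: "e_coeff p ?lam i = e_coeff p ?mu i" if "i \<le> k" for i
    using tr[of i] tr[of "i + 1"] that by (simp add: e_coeff_def)
  \<comment> \<open>Injectivity of the symbol identifies the last two truncations with
    \<open>?lam\<close> and its peeled partition.\<close>
  have "symbol_truncation p ?lam (Suc k + 1) = ?lam"
    using symbol_truncation_length[OF Suc.prems(3,2)] Suc.prems(5) by simp
  moreover have "symbol_truncation p ?lam (Suc k) = ?mu"
    using symbol_truncation_length[OF reg' Suc.prems(2)] len tr[of "k + 1"] by simp
  ultimately have ek: "e_coeff p ?lam (Suc k) =
      (if sum_list (p_core p ?lam) < sum_list (p_core p ?mu) then 1 else 0)"
    by (simp add: e_coeff_def)
  have "int (p_weight p ?lam) = int (p_weight p ?mu) + e_coeff p ?lam (Suc k) + int (full_segments p bs)"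
    using peel_weight_step[OF Suc.prems(1,2) ne] ne' ek by (simp add: cs_def)
  moreover have "(\<Sum>i = 0..Suc k. int (Suc k + 1 - i) * d_coeff p al ?lam i) =
      (\<Sum>i = 0..k. int (k + 1 - i) * d_coeff p al ?mu i) + (\<Sum>i = 0..Suc k. d_coeff p al ?lam i)"
  proof -
    have "(\<Sum>i = 0..k. int (Suc k + 1 - i) * d_coeff p al ?lam i) =
        (\<Sum>i = 0..k. int (k + 1 - i) * d_coeff p al ?mu i + d_coeff p al ?lam i)"
      by (rule sum.cong) (auto simp: d of_nat_diff algebra_simps)
    then show ?thesis by (simp add: sum.distrib)
  qed
  moreover have "(\<Sum>i = 1..Suc k. e_coeff p ?lam i) = (\<Sum>i = 1..k. e_coeff p ?mu i) + e_coeff p ?lam (Suc k)"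
    using e by simp
  ultimately show ?case using IH q by simp
qed

theorem theorem3p9:
  fixes p k :: nat and lam :: "nat list" and alpha :: int
  assumes "p \<ge> 2"
    and "JS_partition p lam"
    and "JS_type p lam = alpha"
    and "length (residue_symbol p lam) = k + 1"
  shows "int (p_weight p lam) =
    (\<Sum>i = 0..k. int (k + 1 - i) * d_coeff p alpha lam i) + (\<Sum>i = 1..k. e_coeff p lam i)"
proof -
  obtain bs where bs: "js_blocks p bs" "lam = expand_blocks bs"
    "lam \<noteq> [] \<Longrightarrow> JS_type p lam = block_type bs mod int p"
    using JS_partition_blocks[OF assms(2)] by blast
  have "lam \<noteq> []" using assms(4) by (auto simp: residue_symbol_Nil)
  then have "[alpha = block_type bs] (mod int p)" using bs(3) assms(3) by (auto simp: cong_def)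
  moreover have "p_regular p lam" using assms(2) by (simp add: JS_partition_def)
  ultimately show ?thesis using js_weight[of p bs alpha k] bs assms by simp
qed

end
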